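(* Multi-Choice Integer Programming can be solved in time $(d\Delta|P|)^{O(d)}(n+t)^{O(1)}$, where $t=\sum_{S\in P} t_S$.
   Context: Multi-Choice Integer Programming: the input consists of $n,d,\Delta\in\mathbb{N}$, a matrix $A\in\mathbb{Z}^{d\times n}$ with $|A_{ij}|\le\Delta$ for all entries, $b\in\mathbb{Z}^d$, $c\in\mathbb{Z}^n$, a partition $P$ of $\{1,\dotsc,n\}$, and a number $t_S\in\mathbb{N}$ for each $S\in P$. The task is to find $x\in\mathbb{Z}_{\ge0}^n$ maximizing $c^{\mathsf T}x$ subject to $Ax=b$ and $\sum_{i\in S}x_i=t_S$ for all $S\in P$ (or to report that no feasible $x$ exists). *)

theory Defs
  imports "Jordan_Normal_Form.Matrix" "HOL-Library.Disjoint_Sets"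
begin

section \<open>Random access machine with unit-cost additive arithmetic\<close>

text \<open>
  Running time is measured on a random access machine over the integers, in the style of Cook and
  Reckhow: addition, subtraction, comparison and indirect memory access cost one unit each.
  There is deliberately no multiplication, division or bit operation, so that in T steps the bit
  length of the stored numbers grows by only O(T), and the unit-cost convention cannot hide
  super-polynomial work.

  Programs are structured (while programs) instead of goto programs. A program text mentions
  finitely many registers and finitely many arrays, so interleaving the arrays in one memory
  and replacing loops by jumps gives an ordinary RAM program that is slower by a factor depending
  only on the program text.
\<close>

record state =
  reg :: "nat \<Rightarrow> int"
  arr :: "nat \<Rightarrow> nat \<Rightarrow> int"

datatype aexp =
    Const int
  | Reg nat
  | Read nat aexp
  | Plus aexp aexp
  | Minus aexp aexp

text \<open>Array cells are numbered by natural numbers; a negative address denotes cell 0.\<close>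

primrec aval :: "aexp \<Rightarrow> state \<Rightarrow> int" where
  "aval (Const k) s = k"
| "aval (Reg r) s = reg s r"
| "aval (Read a e) s = arr s a (nat (aval e s))"
| "aval (Plus e f) s = aval e s + aval f s"
| "aval (Minus e f) s = aval e s - aval f s"

primrec acost :: "aexp \<Rightarrow> nat" where
  "acost (Const k) = 1"
| "acost (Reg r) = 1"
| "acost (Read a e) = 1 + acost e"
| "acost (Plus e f) = 1 + acost e + acost f"
| "acost (Minus e f) = 1 + acost e + acost f"

text \<open>The tests of \<open>IfLess\<close> and \<open>WhileLess\<close> are \<open>e < f\<close> for their first two arguments.\<close>

datatype com =
    Skip
  | Assign nat aexp
  | Write nat aexp aexp
  | Seq com com
  | IfLess aexp aexp com com
  | WhileLess aexp aexp com

text \<open>\<open>exec p s T s'\<close>: started in \<open>s\<close>, the program \<open>p\<close> halts in \<open>s'\<close> after exactly \<open>T\<close> steps.\<close>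

inductive exec :: "com \<Rightarrow> state \<Rightarrow> nat \<Rightarrow> state \<Rightarrow> bool" where
  Skip: "exec Skip s 1 s"
| Assign: "exec (Assign r e) s (1 + acost e) (s\<lparr>reg := (reg s)(r := aval e s)\<rparr>)"
| Write: "exec (Write a e f) s (1 + acost e + acost f)
    (s\<lparr>arr := (arr s)(a := (arr s a)(nat (aval e s) := aval f s))\<rparr>)"
| Seq: "exec p s T s' \<Longrightarrow> exec q s' U s'' \<Longrightarrow> exec (Seq p q) s (T + U) s''"
| IfTrue: "aval e s < aval f s \<Longrightarrow> exec p s T s' \<Longrightarrow>
    exec (IfLess e f p q) s (1 + acost e + acost f + T) s'"
| IfFalse: "\<not> aval e s < aval f s \<Longrightarrow> exec q s T s' \<Longrightarrow>
    exec (IfLess e f p q) s (1 + acost e + acost f + T) s'"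
| WhileFalse: "\<not> aval e s < aval f s \<Longrightarrow>
    exec (WhileLess e f p) s (1 + acost e + acost f) s"
| WhileTrue: "aval e s < aval f s \<Longrightarrow> exec p s T s' \<Longrightarrow> exec (WhileLess e f p) s' U s'' \<Longrightarrow>
    exec (WhileLess e f p) s (1 + acost e + acost f + T + U) s''"

inductive_cases SkipE: "exec Skip s T s'"
inductive_cases AssignE: "exec (Assign r e) s T s'"
inductive_cases WriteE: "exec (Write a e f) s T s'"
inductive_cases SeqE: "exec (Seq p q) s T s'"
inductive_cases IfLessE: "exec (IfLess e f p q) s T s'"
inductive_cases WhileLessE: "exec (WhileLess e f p) s T s'"

lemma exec_deterministic:
  "exec p s T s' \<Longrightarrow> exec p s U s'' \<Longrightarrow> U = T \<and> s'' = s'"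
proof (induction arbitrary: U s'' rule: exec.induct)
  case (Skip s)
  then show ?case by (rule SkipE) simp
next
  case (Assign r e s)
  then show ?case by (rule AssignE) simp
next
  case (Write a e f s)
  then show ?case by (rule WriteE) simp
next
  case (Seq p s T s' q V t)
  from Seq.prems show ?case
    by (rule SeqE) (metis Seq.IH)
next
  case (IfTrue e s f p T s' q)
  from IfTrue.prems show ?case
    by (rule IfLessE) (use IfTrue.hyps in simp_all, metis IfTrue.IH)
next
  case (IfFalse e s f q T s' p)
  from IfFalse.prems show ?case
    by (rule IfLessE) (use IfFalse.hyps in simp_all, metis IfFalse.IH)
next
  case (WhileFalse e s f p)
  from WhileFalse.prems show ?case
    by (rule WhileLessE) (use WhileFalse.hyps in simp_all)
next
  case (WhileTrue e s f p T s' V t)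
  from WhileTrue.prems show ?case
    by (rule WhileLessE) (use WhileTrue.hyps in simp_all, metis WhileTrue.IH)
qed


section \<open>Multi-Choice Integer Programming\<close>

text \<open>Variables and rows are numbered from 0, as usual for \<open>vec\<close> and \<open>mat\<close>.\<close>

record mcip =
  num_vars :: nat
  num_rows :: nat
  entry_bound :: nat
  constr_mat :: "int mat"
  rhs :: "int vec"
  objective :: "int vec"
  parts :: "nat set set"
  part_sum :: "nat set \<Rightarrow> nat"

definition mcip_instance :: "mcip \<Rightarrow> bool" where
  "mcip_instance I \<longleftrightarrow>
     1 \<le> num_vars I \<and> 1 \<le> num_rows I \<and> 1 \<le> entry_bound I \<and>
     constr_mat I \<in> carrier_mat (num_rows I) (num_vars I) \<and>
     (\<forall>i<num_rows I. \<forall>j<num_vars I. \<bar>constr_mat I $$ (i, j)\<bar> \<le> int (entry_bound I)) \<and>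
     rhs I \<in> carrier_vec (num_rows I) \<and>
     objective I \<in> carrier_vec (num_vars I) \<and>
     partition_on {0..<num_vars I} (parts I)"

definition feasible :: "mcip \<Rightarrow> int vec \<Rightarrow> bool" where
  "feasible I x \<longleftrightarrow>
     x \<in> carrier_vec (num_vars I) \<and> (\<forall>j<num_vars I. 0 \<le> x $ j) \<and>
     constr_mat I *\<^sub>v x = rhs I \<and>
     (\<forall>S\<in>parts I. (\<Sum>j\<in>S. x $ j) = int (part_sum I S))"

definition optimal :: "mcip \<Rightarrow> int vec \<Rightarrow> bool" where
  "optimal I x \<longleftrightarrow> feasible I x \<and> (\<forall>y. feasible I y \<longrightarrow> objective I \<bullet> y \<le> objective I \<bullet> x)"

definition total_sum :: "mcip \<Rightarrow> nat" where
  "total_sum I = (\<Sum>S\<in>parts I. part_sum I S)"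


section \<open>Input, output and running time\<close>

text \<open>
  The partition is given to the machine by numbering its classes in some order \<open>Ss\<close>: every
  variable is labelled with the number of its class. All cells not used for the input are zero.
\<close>

definition class_label :: "nat set list \<Rightarrow> nat \<Rightarrow> nat" where
  "class_label Ss j = (LEAST k. k < length Ss \<and> j \<in> Ss ! k)"

definition input_reg :: "mcip \<Rightarrow> nat \<Rightarrow> int" where
  "input_reg I r =
     (if r = 0 then int (num_vars I)
      else if r = 1 then int (num_rows I)
      else if r = 2 then int (entry_bound I)
      else if r = 3 then int (card (parts I))
      else 0)"

text \<open>Array 0 holds the constraint matrix row by row.\<close>

definition input_arr :: "mcip \<Rightarrow> nat set list \<Rightarrow> nat \<Rightarrow> nat \<Rightarrow> int" where
  "input_arr I Ss a k =
     (if a = 0 \<and> k < num_rows I * num_vars I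
        then constr_mat I $$ (k div num_vars I, k mod num_vars I)
      else if a = 1 \<and> k < num_rows I then rhs I $ k
      else if a = 2 \<and> k < num_vars I then objective I $ k
      else if a = 3 \<and> k < num_vars I then int (class_label Ss k)
      else if a = 4 \<and> k < length Ss then int (part_sum I (Ss ! k))
      else 0)"

definition input_state :: "mcip \<Rightarrow> nat set list \<Rightarrow> state" where
  "input_state I Ss = \<lparr>reg = input_reg I, arr = input_arr I Ss\<rparr>"

text \<open>
  The answer is read off from register 4, which is 0 for ``no feasible solution'' and 1 if the
  first cells of array 5 contain an optimal solution.
\<close>

definition correct_output :: "mcip \<Rightarrow> state \<Rightarrow> bool" where
  "correct_output I s \<longleftrightarrow>
     (if \<exists>x. feasible I x
      then reg s 4 = 1 \<and> optimal I (vec (num_vars I) (arr s 5))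
      else reg s 4 = 0)"

definition solves_within :: "com \<Rightarrow> mcip \<Rightarrow> nat \<Rightarrow> bool" where
  "solves_within p I B \<longleftrightarrow>
     (\<forall>Ss. distinct Ss \<and> set Ss = parts I \<longrightarrow>
       (\<exists>T s. exec p (input_state I Ss) T s \<and> T \<le> B \<and> correct_output I s))"

end

theory Submission
  imports Defs
begin

text \<open>
  Let \<open>x\<close> be feasible. By the Steinitz lemma the \<open>t\<^sub>S\<close> columns that \<open>x\<close> selects from a class \<open>S\<close> can
  be ordered so that every partial sum stays within \<open>O(d \<Delta>)\<close> of the straight line to their total.
  Interleave the classes along a fixed schedule, independent of \<open>x\<close>, in which after \<open>k\<close> of the \<open>t\<close>
  picks every class \<open>S\<close> has been used \<open>k t\<^sub>S / t\<close> times up to an error of \<open>O(|P|)\<close>. All partial sums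
  then lie in a box of side length \<open>O(|P| \<Delta> (d + |P|))\<close> around \<open>k b / t\<close>, which contains
  \<open>(d \<Delta> |P|)\<^bsup>O(d)\<^esup>\<close> integer points, and since the schedule prescribes the class of each pick, the
  class constraints hold automatically. A dynamic program over pairs of a number of picks and a
  point of the box finds an optimal solution; its states are kept in a list, and searching it
  linearly only costs another factor \<open>(d \<Delta> |P|)\<^bsup>O(d)\<^esup> t\<close>.
\<close>

section \<open>The Steinitz lemma\<close>

text \<open>Four obstacles shape the development. The points of the line are rational, so partial
  sums are scaled to stay integral. Scaling by \<open>t + 1\<close> stretches the box in every
  coordinate and would cost a factor \<open>(t + 1) ^ d\<close>; this is undone by the observation
  that within one layer the scaled sums lie in a single residue class modulo \<open>t + 1\<close>,
  so that the number of states per layer is independent of \<open>t\<close>. The Steinitz lemma is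
  applied inside each class and not to all columns at once: an ordering of all columns would
  prescribe an order of the classes that depends on the unknown solution, whereas the program must
  know the order of the classes in advance. The machine cannot multiply, but every product that is
  needed has a factor bounded by the running time, so repeated addition is affordable. Finally, the
  base of the exponential bound may be 1, and then no power of it absorbs a constant; in that case
  \<open>d = 1\<close> and a fixed factor in front suffices.\<close>

lemma linear_dependence:
  fixes g :: "nat \<Rightarrow> 'a \<Rightarrow> real"
  assumes "finite F" "q < card F"
  shows "\<exists>\<alpha>. (\<exists>a\<in>F. \<alpha> a \<noteq> 0) \<and> (\<forall>i<q. (\<Sum>a\<in>F. \<alpha> a * g i a) = 0)"
  using assms
proof (induction q arbitrary: F g)
  case 0
  then have "F \<noteq> {}" by auto
  then show ?case by (intro exI[of _ "\<lambda>_. 1"]) auto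
next
  case (Suc q)
  show ?case
  proof (cases "\<forall>a\<in>F. g q a = 0")
    case True
    obtain \<alpha> where "\<exists>a\<in>F. \<alpha> a \<noteq> 0" "\<forall>i<q. (\<Sum>a\<in>F. \<alpha> a * g i a) = 0"
      using Suc.IH[of F g] Suc.prems by auto
    then show ?thesis
      using True by (intro exI[of _ \<alpha>]) (auto simp: less_Suc_eq)
  next
    case False
    then obtain p where p: "p \<in> F" "g q p \<noteq> 0" by auto
    define F' where "F' = F - {p}"
    have F': "finite F'" "p \<notin> F'" "F = insert p F'" "q < card F'"
      using Suc.prems p by (auto simp: F'_def)
    \<comment> \<open>Gaussian elimination: \<open>h\<close> is the system after the unknown
      \<open>p\<close> has been eliminated by equation \<open>q\<close> with pivot
      \<open>g q p\<close>.\<close>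
    define h where "h i a = g i a - g i p * g q a / g q p" for i a
    obtain \<alpha> where \<alpha>: "\<exists>a\<in>F'. \<alpha> a \<noteq> 0" "\<forall>i<q. (\<Sum>a\<in>F'. \<alpha> a * h i a) = 0"
      using Suc.IH[of F' h] F' by auto
    \<comment> \<open>The value at \<open>p\<close> is the one that solves equation
      \<open>q\<close>.\<close>
    define \<beta> where "\<beta> = \<alpha>(p := - (\<Sum>a\<in>F'. \<alpha> a * g q a) / g q p)"
    have \<beta>F': "(\<Sum>a\<in>F'. \<beta> a * g i a) = (\<Sum>a\<in>F'. \<alpha> a * g i a)" for i
      using F' by (intro sum.cong) (auto simp: \<beta>_def)
    have \<beta>: "(\<Sum>a\<in>F. \<beta> a * g i a) =
        (\<Sum>a\<in>F'. \<alpha> a * g i a) - (\<Sum>a\<in>F'. \<alpha> a * g q a) / g q p * g i p" for i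
      using F' \<beta>F' by (simp add: \<beta>_def)
    have "(\<Sum>a\<in>F. \<beta> a * g i a) = 0" if "i < Suc q" for i
    proof (cases "i = q")
      case True
      then show ?thesis using p \<beta>[of q] by simp
    next
      case False
      then have "(\<Sum>a\<in>F'. \<alpha> a * h i a) = 0" using \<alpha> that by simp
      moreover have "(\<Sum>a\<in>F'. \<alpha> a * h i a) =
          (\<Sum>a\<in>F'. \<alpha> a * g i a) - (\<Sum>a\<in>F'. \<alpha> a * g q a) / g q p * g i p"
        by (simp add: h_def right_diff_distrib sum_subtractf sum_distrib_left sum_divide_distrib
            ac_simps)
      ultimately show ?thesis using \<beta>[of i] by simp
    qed
    moreover have "\<exists>a\<in>F. \<beta> a \<noteq> 0"
      using \<alpha>(1) F' by (auto simp: \<beta>_def)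
    ultimately show ?thesis by blast
  qed
qed

text \<open>The fractional coordinates outnumber the equations, so some nonzero direction supported
  on them lies in the kernel. Moving along it preserves all equations, and the first coordinate that
  hits 0 or 1 ceases to be fractional.\<close>

lemma reduce_fractional:
  fixes g :: "nat \<Rightarrow> 'a \<Rightarrow> real"
  assumes fin: "finite A" and \<mu>: "\<forall>a\<in>A. 0 \<le> \<mu> a \<and> \<mu> a \<le> 1"
    and many: "q < card {a\<in>A. 0 < \<mu> a \<and> \<mu> a < 1}"
  shows "\<exists>\<nu>. (\<forall>a\<in>A. 0 \<le> \<nu> a \<and> \<nu> a \<le> 1) \<and>
    (\<forall>i<q. (\<Sum>a\<in>A. \<nu> a * g i a) = (\<Sum>a\<in>A. \<mu> a * g i a)) \<and>
    card {a\<in>A. 0 < \<nu> a \<and> \<nu> a < 1} < card {a\<in>A. 0 < \<mu> a \<and> \<mu> a < 1}"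
proof -
  define F where "F = {a\<in>A. 0 < \<mu> a \<and> \<mu> a < 1}"
  have F: "finite F" "F \<subseteq> A" using fin by (auto simp: F_def)
  obtain \<alpha> where \<alpha>: "\<exists>a\<in>F. \<alpha> a \<noteq> 0" "\<forall>i<q. (\<Sum>a\<in>F. \<alpha> a * g i a) = 0"
    using linear_dependence[of F q g] F many by (auto simp: F_def)
  define G where "G = {a\<in>F. \<alpha> a \<noteq> 0}"
  \<comment> \<open>The distance along \<alpha> at which coordinate \<open>a\<close> reaches 1 or 0;
    the minimum \<theta> is the longest move that stays inside the unit cube.\<close>
  define r where "r a = (if \<alpha> a > 0 then (1 - \<mu> a) / \<alpha> a else \<mu> a / - \<alpha> a)" for a
  define \<theta> where "\<theta> = Min (r ` G)"
  have G: "finite G" "G \<noteq> {}" using F \<alpha> by (auto simp: G_def)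
  have "\<theta> \<in> r ` G" unfolding \<theta>_def using G by (intro Min_in) auto
  then obtain p where p: "p \<in> G" "\<theta> = r p" by auto
  have \<theta>_le: "\<theta> \<le> r a" if "a \<in> G" for a
    using that G by (simp add: \<theta>_def)
  have "0 < r p" using p by (auto simp: r_def G_def F_def field_simps not_less)
  then have \<theta>_pos: "0 < \<theta>" using p by simp
  define \<nu> where "\<nu> a = (if a \<in> F then \<mu> a + \<theta> * \<alpha> a else \<mu> a)" for a
  have range: "0 \<le> \<nu> a \<and> \<nu> a \<le> 1" if a: "a \<in> A" for a
  proof (cases "a \<in> G")
    case True
    then have aF: "a \<in> F" "0 < \<mu> a" "\<mu> a < 1" by (auto simp: G_def F_def)
    show ?thesis
    proof (cases "\<alpha> a > 0")
      case True
      with \<theta>_le[OF \<open>a \<in> G\<close>] have "\<theta> * \<alpha> a \<le> 1 - \<mu> a"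
        by (simp add: r_def field_simps)
      moreover have "0 \<le> \<theta> * \<alpha> a" using True \<theta>_pos by simp
      ultimately show ?thesis using aF by (simp add: \<nu>_def)
    next
      case False
      then have neg: "\<alpha> a < 0" using \<open>a \<in> G\<close> by (auto simp: G_def)
      with \<theta>_le[OF \<open>a \<in> G\<close>] have "- \<mu> a \<le> \<theta> * \<alpha> a"
        by (simp add: r_def field_simps)
      moreover have "\<theta> * \<alpha> a \<le> 0" using neg \<theta>_pos by (simp add: mult_nonneg_nonpos)
      ultimately show ?thesis using aF by (simp add: \<nu>_def)
    qed
  next
    case False
    then have "\<nu> a = \<mu> a" by (auto simp: \<nu>_def G_def)
    then show ?thesis using \<mu> a by simp
  qed
  have "(\<Sum>a\<in>A. \<nu> a * g i a) = (\<Sum>a\<in>A. \<mu> a * g i a)" if "i < q" for i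
  proof -
    have "(\<Sum>a\<in>A. \<nu> a * g i a) =
        (\<Sum>a\<in>A. \<mu> a * g i a + (if a \<in> F then \<theta> * (\<alpha> a * g i a) else 0))"
      by (intro sum.cong) (auto simp: \<nu>_def algebra_simps)
    also have "\<dots> = (\<Sum>a\<in>A. \<mu> a * g i a) + (\<Sum>a\<in>F. \<theta> * (\<alpha> a * g i a))"
      using F fin by (simp add: sum.distrib sum.inter_restrict[symmetric] inf.absorb2)
    also have "(\<Sum>a\<in>F. \<theta> * (\<alpha> a * g i a)) = 0"
      using \<alpha>(2) that by (simp add: sum_distrib_left[symmetric])
    finally show ?thesis by simp
  qed
  moreover have "card {a\<in>A. 0 < \<nu> a \<and> \<nu> a < 1} < card F"
  proof (rule psubset_card_mono[OF F(1)])
    have "\<nu> p = 0 \<or> \<nu> p = 1"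
      using p by (auto simp: \<nu>_def r_def G_def)
    moreover have "p \<in> F" using p by (simp add: G_def)
    moreover have "{a\<in>A. 0 < \<nu> a \<and> \<nu> a < 1} \<subseteq> F"
      by (auto simp: \<nu>_def F_def split: if_splits)
    ultimately show "{a\<in>A. 0 < \<nu> a \<and> \<nu> a < 1} \<subset> F" by auto
  qed
  ultimately show ?thesis using range unfolding F_def by blast
qed

text \<open>The polyhedral background: a vertex of the polytope cut out of the unit cube by
  \<open>q\<close> equations has at most \<open>q\<close> coordinates strictly between 0 and
  1.\<close>

lemma few_fractional:
  fixes g :: "nat \<Rightarrow> 'a \<Rightarrow> real"
  assumes fin: "finite A" and \<mu>: "\<forall>a\<in>A. 0 \<le> \<mu> a \<and> \<mu> a \<le> 1"
  shows "\<exists>\<nu>. (\<forall>a\<in>A. 0 \<le> \<nu> a \<and> \<nu> a \<le> 1) \<and>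
    (\<forall>i<q. (\<Sum>a\<in>A. \<nu> a * g i a) = (\<Sum>a\<in>A. \<mu> a * g i a)) \<and>
    card {a\<in>A. 0 < \<nu> a \<and> \<nu> a < 1} \<le> q"
  using \<mu>
proof (induction "card {a\<in>A. 0 < \<mu> a \<and> \<mu> a < 1}" arbitrary: \<mu> rule: less_induct)
  case less
  show ?case
  proof (cases "q < card {a\<in>A. 0 < \<mu> a \<and> \<mu> a < 1}")
    case True
    then obtain \<nu> where \<nu>: "\<forall>a\<in>A. 0 \<le> \<nu> a \<and> \<nu> a \<le> 1"
      "\<forall>i<q. (\<Sum>a\<in>A. \<nu> a * g i a) = (\<Sum>a\<in>A. \<mu> a * g i a)"
      "card {a\<in>A. 0 < \<nu> a \<and> \<nu> a < 1} < card {a\<in>A. 0 < \<mu> a \<and> \<mu> a < 1}"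
      using reduce_fractional[OF fin less.prems True, of g] by blast
    from less.hyps[OF \<nu>(3,1)] obtain \<nu>' where "\<forall>a\<in>A. 0 \<le> \<nu>' a \<and> \<nu>' a \<le> 1"
      "\<forall>i<q. (\<Sum>a\<in>A. \<nu>' a * g i a) = (\<Sum>a\<in>A. \<nu> a * g i a)"
      "card {a\<in>A. 0 < \<nu>' a \<and> \<nu>' a < 1} \<le> q" by blast
    with \<nu>(2) show ?thesis by (intro exI[of _ \<nu>']) simp
  next
    case False
    then show ?thesis using less.prems by (intro exI[of _ \<mu>]) auto
  qed
qed

lemma weights_drop_element:
  fixes v :: "'a \<Rightarrow> nat \<Rightarrow> real"
  assumes fin: "finite A" and card: "d < card A"
    and \<mu>: "\<forall>a\<in>A. 0 \<le> \<mu> a \<and> \<mu> a \<le> 1" "(\<Sum>a\<in>A. \<mu> a) = real (card A) - real d"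
      "\<forall>i<d. (\<Sum>a\<in>A. \<mu> a * v a i) = 0"
  shows "\<exists>p\<in>A. \<exists>\<nu>. (\<forall>a\<in>A - {p}. 0 \<le> \<nu> a \<and> \<nu> a \<le> 1) \<and>
    (\<Sum>a\<in>A - {p}. \<nu> a) = real (card (A - {p})) - real d \<and>
    (\<forall>i<d. (\<Sum>a\<in>A - {p}. \<nu> a * v a i) = 0)"
proof -
  define k where "k = card A"
  define c where "c = (real k - 1 - real d) / (real k - real d)"
  have c: "0 \<le> c" "c \<le> 1" "c * (real k - real d) = real k - 1 - real d"
    using card by (auto simp: c_def k_def field_simps)
  define g where "g i a = (if i = d then 1 else v a i)" for i a
  have "\<forall>a\<in>A. 0 \<le> c * \<mu> a \<and> c * \<mu> a \<le> 1"
    using \<mu>(1) c(1,2) by (simp add: mult_le_one)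
  from few_fractional[OF fin this, of "Suc d" g] obtain \<nu> where
    \<nu>: "\<forall>a\<in>A. 0 \<le> \<nu> a \<and> \<nu> a \<le> 1"
      "\<forall>i<Suc d. (\<Sum>a\<in>A. \<nu> a * g i a) = (\<Sum>a\<in>A. c * \<mu> a * g i a)"
      "card {a\<in>A. 0 < \<nu> a \<and> \<nu> a < 1} \<le> Suc d" by blast
  have sum_\<nu>: "(\<Sum>a\<in>A. \<nu> a) = real k - 1 - real d"
  proof -
    have "(\<Sum>a\<in>A. \<nu> a) = (\<Sum>a\<in>A. c * \<mu> a)"
      using \<nu>(2)[rule_format, of d] by (simp add: g_def)
    also have "\<dots> = c * (real k - real d)"
      by (simp add: sum_distrib_left[symmetric] \<mu>(2) k_def)
    finally show ?thesis using c(3) by simp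
  qed
  have v\<nu>: "(\<Sum>a\<in>A. \<nu> a * v a i) = 0" if "i < d" for i
  proof -
    have "(\<Sum>a\<in>A. \<nu> a * v a i) = (\<Sum>a\<in>A. c * \<mu> a * v a i)"
      using \<nu>(2)[rule_format, of i] that by (simp add: g_def)
    also have "\<dots> = c * (\<Sum>a\<in>A. \<mu> a * v a i)"
      by (simp add: sum_distrib_left mult.assoc)
    finally show ?thesis using \<mu>(3) that by simp
  qed
  have "\<exists>p\<in>A. \<nu> p = 0"
  proof (rule ccontr)
    assume "\<not> ?thesis"
    then have pos: "\<forall>a\<in>A. 0 < \<nu> a" using \<nu>(1) by force
    define F where "F = {a\<in>A. 0 < \<nu> a \<and> \<nu> a < 1}"
    have F: "F \<subseteq> A" "finite F" using fin by (auto simp: F_def)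
    have "\<nu> a = 1" if "a \<in> A - F" for a
      using that \<nu>(1) pos by (force simp: F_def)
    then have "(\<Sum>a\<in>A. \<nu> a) = real (card (A - F)) + (\<Sum>a\<in>F. \<nu> a)"
      using sum.subset_diff[OF F(1) fin, of \<nu>] by simp
    moreover have "card (A - F) = k - card F" "card F \<le> k"
      using F fin by (auto simp: card_Diff_subset card_mono k_def)
    moreover have "card F \<le> Suc d" using \<nu>(3) by (simp add: F_def)
    moreover have "(\<Sum>a\<in>F. \<nu> a) > 0" if "F \<noteq> {}"
      using that F pos by (intro sum_pos) auto
    ultimately show False using sum_\<nu> by (cases "F = {}") auto
  qed
  then obtain p where p: "p \<in> A" "\<nu> p = 0" by blast
  have "(\<Sum>a\<in>A - {p}. \<nu> a) = real (card (A - {p})) - real d"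
    using p fin sum_\<nu> card by (simp add: sum_diff1 k_def of_nat_diff)
  moreover have "\<forall>i<d. (\<Sum>a\<in>A - {p}. \<nu> a * v a i) = 0"
    using p fin v\<nu> by (simp add: sum_diff1)
  ultimately show ?thesis using p \<nu>(1) by blast
qed

text \<open>The ordering is built from its end, the dropped element going last. Because the weighted
  sum vanishes, the plain sum equals the sum with weights \<open>1 - \<mu> a\<close>; these are
  nonnegative with total \<open>d\<close>, whence the bound \<open>d * B\<close>. For at most
  \<open>d\<close> elements the triangle inequality is enough.\<close>

lemma prefix_sums_from_weights:
  fixes v :: "'a \<Rightarrow> nat \<Rightarrow> real"
  assumes fin: "finite A" and bound: "\<forall>a\<in>A. \<forall>i<d. \<bar>v a i\<bar> \<le> B" and "0 \<le> B"
    and "card A \<le> d \<or> (\<exists>\<mu>. (\<forall>a\<in>A. 0 \<le> \<mu> a \<and> \<mu> a \<le> 1) \<and>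
      (\<Sum>a\<in>A. \<mu> a) = real (card A) - real d \<and> (\<forall>i<d. (\<Sum>a\<in>A. \<mu> a * v a i) = 0))"
  shows "\<exists>xs. distinct xs \<and> set xs = A \<and>
    (\<forall>k\<le>length xs. \<forall>i<d. \<bar>\<Sum>a\<in>set (take k xs). v a i\<bar> \<le> real d * B)"
  using assms
proof (induction "card A" arbitrary: A)
  case 0
  then show ?case by (intro exI[of _ "[]"]) auto
next
  case (Suc m)
  have whole: "\<bar>\<Sum>a\<in>A. v a i\<bar> \<le> real d * B" if i: "i < d" for i
  proof (cases "card A \<le> d")
    case True
    have "\<bar>\<Sum>a\<in>A. v a i\<bar> \<le> (\<Sum>a\<in>A. \<bar>v a i\<bar>)" by (rule sum_abs)
    also have "\<dots> \<le> real (card A) * B"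
      using Suc.prems(2) i by (intro sum_bounded_above) auto
    also have "\<dots> \<le> real d * B" using True Suc.prems(3) by (intro mult_right_mono) auto
    finally show ?thesis .
  next
    case False
    then obtain \<mu> where \<mu>: "\<forall>a\<in>A. 0 \<le> \<mu> a \<and> \<mu> a \<le> 1"
      "(\<Sum>a\<in>A. \<mu> a) = real (card A) - real d" "\<forall>i<d. (\<Sum>a\<in>A. \<mu> a * v a i) = 0"
      using Suc.prems(4) by blast
    have "(\<Sum>a\<in>A. v a i) = (\<Sum>a\<in>A. (1 - \<mu> a) * v a i)"
      using \<mu>(3) i by (simp add: left_diff_distrib sum_subtractf)
    also have "\<bar>\<dots>\<bar> \<le> (\<Sum>a\<in>A. \<bar>(1 - \<mu> a) * v a i\<bar>)" by (rule sum_abs)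
    also have "\<dots> \<le> (\<Sum>a\<in>A. (1 - \<mu> a) * B)"
      using \<mu>(1) Suc.prems(2) i by (intro sum_mono) (auto simp: abs_mult intro!: mult_mono)
    also have "\<dots> = (\<Sum>a\<in>A. 1 - \<mu> a) * B" by (simp add: sum_distrib_right)
    also have "(\<Sum>a\<in>A. 1 - \<mu> a) = real d" using \<mu>(2) by (simp add: sum_subtractf)
    finally show ?thesis .
  qed
  obtain p where p: "p \<in> A" and rest: "card (A - {p}) \<le> d \<or>
      (\<exists>\<mu>. (\<forall>a\<in>A - {p}. 0 \<le> \<mu> a \<and> \<mu> a \<le> 1) \<and>
        (\<Sum>a\<in>A - {p}. \<mu> a) = real (card (A - {p})) - real d \<and>
        (\<forall>i<d. (\<Sum>a\<in>A - {p}. \<mu> a * v a i) = 0))"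
  proof (cases "card A \<le> d")
    case True
    obtain p where "p \<in> A" using Suc.hyps(2) by fastforce
    then show ?thesis using that[of p] True by (simp add: le_diff_conv)
  next
    case False
    then obtain \<mu> where \<mu>: "\<forall>a\<in>A. 0 \<le> \<mu> a \<and> \<mu> a \<le> 1"
      "(\<Sum>a\<in>A. \<mu> a) = real (card A) - real d" "\<forall>i<d. (\<Sum>a\<in>A. \<mu> a * v a i) = 0"
      using Suc.prems(4) by blast
    from weights_drop_element[OF Suc.prems(1) _ \<mu>] False obtain p \<nu> where "p \<in> A"
      "(\<forall>a\<in>A - {p}. 0 \<le> \<nu> a \<and> \<nu> a \<le> 1) \<and>
       (\<Sum>a\<in>A - {p}. \<nu> a) = real (card (A - {p})) - real d \<and>
       (\<forall>i<d. (\<Sum>a\<in>A - {p}. \<nu> a * v a i) = 0)" by (auto simp: not_le)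
    then show ?thesis using that by blast
  qed
  have "m = card (A - {p})" using p Suc.hyps(2) by (simp add: Suc.prems(1))
  from Suc.hyps(1)[OF this] rest Suc.prems(1-3) obtain ys where
    ys: "distinct ys" "set ys = A - {p}"
      "\<forall>k\<le>length ys. \<forall>i<d. \<bar>\<Sum>a\<in>set (take k ys). v a i\<bar> \<le> real d * B"
    by auto
  have "set (ys @ [p]) = A" using ys(2) p by auto
  moreover have "\<bar>\<Sum>a\<in>set (take k (ys @ [p])). v a i\<bar> \<le> real d * B"
    if "k \<le> length (ys @ [p])" "i < d" for k i
  proof (cases "k \<le> length ys")
    case True
    then show ?thesis using ys(3) that by simp
  next
    case False
    then have "take k (ys @ [p]) = ys @ [p]" using that by simp
    then show ?thesis using whole[OF that(2)] \<open>set (ys @ [p]) = A\<close> by simp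
  qed
  ultimately show ?case using ys(1,2) by (intro exI[of _ "ys @ [p]"]) auto
qed

text \<open>The argument is due to Grinberg and Sevastyanov.\<close>

theorem steinitz:
  fixes v :: "'a \<Rightarrow> nat \<Rightarrow> real"
  assumes "finite A" "\<forall>a\<in>A. \<forall>i<d. \<bar>v a i\<bar> \<le> B" "0 \<le> B" "\<forall>i<d. (\<Sum>a\<in>A. v a i) = 0"
  shows "\<exists>xs. distinct xs \<and> set xs = A \<and>
    (\<forall>k\<le>length xs. \<forall>i<d. \<bar>\<Sum>a\<in>set (take k xs). v a i\<bar> \<le> real d * B)"
proof (rule prefix_sums_from_weights)
  show "card A \<le> d \<or> (\<exists>\<mu>. (\<forall>a\<in>A. 0 \<le> \<mu> a \<and> \<mu> a \<le> 1) \<and>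
      (\<Sum>a\<in>A. \<mu> a) = real (card A) - real d \<and> (\<forall>i<d. (\<Sum>a\<in>A. \<mu> a * v a i) = 0))"
  proof (cases "card A \<le> d")
    case False
    \<comment> \<open>The vectors sum to zero, so uniform weights of the right total start the
      process.\<close>
    define c where "c = (real (card A) - real d) / real (card A)"
    have "0 \<le> c" "c \<le> 1" "real (card A) * c = real (card A) - real d"
      using False by (auto simp: c_def field_simps)
    then show ?thesis
      using assms(4) by (intro disjI2 exI[of _ "\<lambda>_. c"]) (simp add: sum_distrib_left[symmetric])
  qed simp
qed (use assms in auto)

text \<open>The Steinitz lemma is applied to the vectors \<open>length l * f i x\<close> minus the
  total of \<open>f i\<close> over \<open>l\<close>, which sum to zero; multiplying by the length
  instead of dividing keeps everything integral. They are indexed by positions because elements of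
  \<open>l\<close> may repeat. Centring doubles the bound on their size, hence the factor 2.\<close>

lemma balanced_permutation:
  fixes f :: "nat \<Rightarrow> 'a \<Rightarrow> int"
  assumes bound: "\<forall>x\<in>set l. \<forall>i<d. \<bar>f i x\<bar> \<le> B"
  shows "\<exists>l'. mset l' = mset l \<and> (\<forall>k\<le>length l. \<forall>i<d.
    \<bar>int (length l) * (\<Sum>x\<leftarrow>take k l'. f i x) - int k * (\<Sum>x\<leftarrow>l. f i x)\<bar>
      \<le> int (length l) * (2 * int d * B))"
proof (cases "l = []")
  case True
  then show ?thesis by simp
next
  case False
  then have B: "0 \<le> B" if "0 < d" using bound that by (cases l) force+
  define m where "m = length l"
  have m: "0 < m" using False by (simp add: m_def)
  define s where "s i = (\<Sum>x\<leftarrow>l. f i x)" for i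
  have s_alt: "s i = (\<Sum>q<m. f i (l ! q))" for i
    by (simp add: s_def m_def sum_list_sum_nth atLeast0LessThan)
  have fq: "\<bar>f i (l ! q)\<bar> \<le> B" if "q < m" "i < d" for q i
    using bound that by (simp add: m_def)
  define v where "v q i = real_of_int (int m * f i (l ! q) - s i)" for q i
  \<comment> \<open>For \<open>d = 0\<close> nothing forces \<open>B\<close> to be nonnegative,
    hence the absolute value.\<close>
  have v_bound: "\<forall>q\<in>{..<m}. \<forall>i<d. \<bar>v q i\<bar> \<le> real_of_int (2 * int m * \<bar>B\<bar>)"
  proof (intro ballI allI impI)
    fix q i assume *: "q \<in> {..<m}" "i < d"
    have "\<bar>s i\<bar> \<le> (\<Sum>q<m. \<bar>f i (l ! q)\<bar>)" unfolding s_alt by (rule sum_abs)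
    also have "\<dots> \<le> int m * B" using fq * sum_bounded_above[of "{..<m}" "\<lambda>q. \<bar>f i (l ! q)\<bar>" B]
      by simp
    finally have "\<bar>s i\<bar> \<le> int m * B" .
    moreover have "\<bar>int m * f i (l ! q)\<bar> \<le> int m * B"
      using fq * m by (simp add: abs_mult)
    moreover have "int m * B = int m * \<bar>B\<bar>" using B * by simp
    ultimately have "\<bar>int m * f i (l ! q) - s i\<bar> \<le> 2 * int m * \<bar>B\<bar>" by linarith
    then show "\<bar>v q i\<bar> \<le> real_of_int (2 * int m * \<bar>B\<bar>)"
      unfolding v_def by (metis of_int_abs of_int_le_iff)
  qed
  have "(\<Sum>q<m. v q i) = 0" for i
  proof -
    have "(\<Sum>q<m. int m * f i (l ! q) - s i) = 0"
      by (simp add: sum_subtractf s_alt flip: sum_distrib_left)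
    then show ?thesis unfolding v_def of_int_sum[symmetric] by simp
  qed
  then have "\<forall>i<d. (\<Sum>q<m. v q i) = 0" by simp
  from steinitz[OF _ v_bound _ this] obtain xs where xs: "distinct xs" "set xs = {..<m}"
    "\<forall>k\<le>length xs. \<forall>i<d. \<bar>\<Sum>q\<in>set (take k xs). v q i\<bar> \<le> real d * real_of_int (2 * int m * \<bar>B\<bar>)"
    by auto
  have len: "length xs = m" using distinct_card[OF xs(1)] xs(2) by simp
  define l' where "l' = map ((!) l) xs"
  have "mset xs = mset [0..<m]"
    using mset_set_set[OF xs(1)] xs(2) by (simp add: atLeast0LessThan)
  then have "mset l' = mset (map ((!) l) [0..<m])" by (simp add: l'_def)
  then have "mset l' = mset l" by (simp add: m_def map_nth)
  moreover have "\<bar>int m * (\<Sum>x\<leftarrow>take k l'. f i x) - int k * s i\<bar> \<le> int m * (2 * int d * B)"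
    if "k \<le> m" "i < d" for k i
  proof -
    have d: "distinct (take k xs)" using xs(1) by simp
    have "(\<Sum>q\<in>set (take k xs). v q i) = (\<Sum>q\<leftarrow>take k xs. v q i)"
      using sum_list_distinct_conv_sum_set[OF d, of "\<lambda>q. v q i"] by simp
    also have "\<dots> = real m * (\<Sum>q\<leftarrow>take k xs. real_of_int (f i (l ! q))) - real k * s i"
      using that len by (simp add: v_def sum_list_subtractf sum_list_const_mult sum_list_triv)
    also have "(\<Sum>q\<leftarrow>take k xs. real_of_int (f i (l ! q))) = real_of_int (\<Sum>x\<leftarrow>take k l'. f i x)"
      by (simp add: l'_def take_map comp_def of_int_hom.hom_sum_list)
    finally have "real_of_int \<bar>int m * (\<Sum>x\<leftarrow>take k l'. f i x) - int k * s i\<bar>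
        = \<bar>\<Sum>q\<in>set (take k xs). v q i\<bar>" by simp
    also have "\<dots> \<le> real d * real_of_int (2 * int m * \<bar>B\<bar>)" using xs(3) that len by simp
    also have "\<dots> = real_of_int (int m * (2 * int d * B))" using B that by simp
    finally show ?thesis by linarith
  qed
  ultimately show ?thesis unfolding m_def s_def by blast
qed

section \<open>Weakest preconditions with running time\<close>

text \<open>Execution is deterministic, so the existence of one run already expresses total
  correctness. The postcondition receives the step count, which lets costs add up along a
  sequence.\<close>

definition wp :: "com \<Rightarrow> (nat \<Rightarrow> state \<Rightarrow> bool) \<Rightarrow> state \<Rightarrow> bool" where
  "wp p Q s \<longleftrightarrow> (\<exists>T s'. exec p s T s' \<and> Q T s')"

lemma wp_exec: "exec p s T s' \<Longrightarrow> wp p Q s \<longleftrightarrow> Q T s'"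
  unfolding wp_def using exec_deterministic by blast

lemmas wp_Skip [simp] = wp_exec[OF exec.Skip]
  and wp_Assign [simp] = wp_exec[OF exec.Assign]
  and wp_Write [simp] = wp_exec[OF exec.Write]

lemma wp_Seq [simp]: "wp (Seq p q) Q s \<longleftrightarrow> wp p (\<lambda>T. wp q (\<lambda>U. Q (T + U))) s"
  unfolding wp_def by (blast elim: SeqE intro: exec.Seq)

lemma wp_IfLess [simp]:
  "wp (IfLess e f p q) Q s \<longleftrightarrow>
    (if aval e s < aval f s then wp p (\<lambda>T. Q (1 + acost e + acost f + T)) s
     else wp q (\<lambda>T. Q (1 + acost e + acost f + T)) s)"
  unfolding wp_def
  by (auto elim!: IfLessE intro: exec.IfTrue[simplified] exec.IfFalse[simplified])

section \<open>Frame conditions: what a program leaves untouched\<close>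

primrec written_regs :: "com \<Rightarrow> nat set" where
  "written_regs Skip = {}"
| "written_regs (Assign r e) = {r}"
| "written_regs (Write a e f) = {}"
| "written_regs (Seq p q) = written_regs p \<union> written_regs q"
| "written_regs (IfLess e f p q) = written_regs p \<union> written_regs q"
| "written_regs (WhileLess e f p) = written_regs p"

primrec written_arrs :: "com \<Rightarrow> nat set" where
  "written_arrs Skip = {}"
| "written_arrs (Assign r e) = {}"
| "written_arrs (Write a e f) = {a}"
| "written_arrs (Seq p q) = written_arrs p \<union> written_arrs q"
| "written_arrs (IfLess e f p q) = written_arrs p \<union> written_arrs q"
| "written_arrs (WhileLess e f p) = written_arrs p"

definition unchanged :: "com \<Rightarrow> state \<Rightarrow> state \<Rightarrow> bool" where
  "unchanged p s s' \<longleftrightarrow> (\<forall>r. r \<notin> written_regs p \<longrightarrow> reg s' r = reg s r) \<and>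
    (\<forall>a. a \<notin> written_arrs p \<longrightarrow> arr s' a = arr s a)"

lemma unchanged_reg: "unchanged p s s' \<Longrightarrow> r \<notin> written_regs p \<Longrightarrow> reg s' r = reg s r"
  and unchanged_arr: "unchanged p s s' \<Longrightarrow> a \<notin> written_arrs p \<Longrightarrow> arr s' a = arr s a"
  by (simp_all add: unchanged_def)

lemma unchanged_refl: "unchanged p s s"
  by (simp add: unchanged_def)

lemma unchanged_trans: "unchanged p s s' \<Longrightarrow> unchanged p s' s'' \<Longrightarrow> unchanged p s s''"
  by (simp add: unchanged_def)

lemma exec_unchanged: "exec p s T s' \<Longrightarrow> unchanged p s s'"
  by (induction rule: exec.induct) (auto simp: unchanged_def)

lemma wp_mono:
  assumes "wp p Q s" and "\<And>T s'. unchanged p s s' \<Longrightarrow> Q T s' \<Longrightarrow> Q' T s'"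
  shows "wp p Q' s"
  using assms exec_unchanged unfolding wp_def by blast

text \<open>The index of the invariant counts the finished rounds and doubles as the variant, since
  the test may succeed only while \<open>k < N\<close>. \<open>Suc N\<close> instead of
  \<open>N\<close> pays for the last, failing test.\<close>

lemma wp_WhileLess:
  assumes "I 0 s"
    and step: "\<And>k s'. unchanged p s s' \<Longrightarrow> I k s' \<Longrightarrow> aval e s' < aval f s' \<Longrightarrow>
      k < N \<and> wp p (\<lambda>T s''. T \<le> B \<and> I (Suc k) s'') s'"
    and exit: "\<And>T k s'. unchanged p s s' \<Longrightarrow> I k s' \<Longrightarrow> \<not> aval e s' < aval f s' \<Longrightarrow>
      T \<le> Suc N * (B + acost e + acost f + 1) \<Longrightarrow> Q T s'"
  shows "wp (WhileLess e f p) Q s"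
proof -
  let ?c = "acost e + acost f + 1"
  have "\<exists>T s''. exec (WhileLess e f p) s' T s'' \<and> T \<le> (N - k) * (B + ?c) + ?c \<and>
      unchanged p s s'' \<and> (\<exists>k. I k s'') \<and> \<not> aval e s'' < aval f s''"
    if "unchanged p s s'" "I k s'" for k s'
    using that
  proof (induction "N - k" arbitrary: k s' rule: less_induct)
    case less
    show ?case
    proof (cases "aval e s' < aval f s'")
      case True
      with step[OF less.prems] have k: "k < N"
        and w: "wp p (\<lambda>T s''. T \<le> B \<and> I (Suc k) s'') s'" by blast+
      from w obtain T u where u: "exec p s' T u" "T \<le> B" "I (Suc k) u"
        unfolding wp_def by blast
      have "unchanged p s u"
        using less.prems(1) exec_unchanged[OF u(1)] by (rule unchanged_trans)
      from less.hyps[OF _ this u(3)] k obtain U v where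
        v: "exec (WhileLess e f p) u U v" "U \<le> (N - Suc k) * (B + ?c) + ?c"
          "unchanged p s v" "\<exists>k. I k v" "\<not> aval e v < aval f v"
        using diff_less_mono2[OF lessI k] by blast
      have "N - k = Suc (N - Suc k)" using k by simp
      then have "1 + acost e + acost f + T + U \<le> (N - k) * (B + ?c) + ?c"
        using u(2) v(2) by simp
      then show ?thesis using exec.WhileTrue[OF True u(1) v(1)] v(3-5) by blast
    next
      case False
      then show ?thesis using exec.WhileFalse[OF False] less.prems
        by (intro exI[of _ "1 + acost e + acost f"] exI[of _ s']) auto
    qed
  qed
  from this[OF unchanged_refl \<open>I 0 s\<close>] obtain T s' where
    *: "exec (WhileLess e f p) s T s'" "T \<le> N * (B + ?c) + ?c" "unchanged p s s'"
      "\<exists>k. I k s'" "\<not> aval e s' < aval f s'" by auto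
  have "T \<le> Suc N * (B + acost e + acost f + 1)" using *(2) by (simp add: algebra_simps)
  then show ?thesis using * exit unfolding wp_def by blast
qed

section \<open>Counted loops and multiplication\<close>

definition For :: "nat \<Rightarrow> aexp \<Rightarrow> com \<Rightarrow> com" where
  "For i f p = Seq (Assign i (Const 0))
    (WhileLess (Reg i) f (Seq p (Assign i (Plus (Reg i) (Const 1)))))"

lemma written_For [simp]:
  "written_regs (For i f p) = insert i (written_regs p)"
  "written_arrs (For i f p) = written_arrs p"
  by (auto simp: For_def)

text \<open>The limit \<open>f\<close> is evaluated anew in every round, hence the assumption about
  all states that differ only in what the loop writes. In the 8, the increment accounts for 4, the
  test apart from \<open>f\<close> for 2, and the initial assignment for 2. Charging to some
  \<open>X\<close> above \<open>N\<close> also pays for the failing test and gives all loops the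
  same unit of cost.\<close>

lemma wp_For:
  assumes i: "i \<notin> written_regs p" and "N < X"
    and limit: "\<And>s'. unchanged (For i f p) s s' \<Longrightarrow> aval f s' = int N"
    and init: "I 0 (s\<lparr>reg := (reg s)(i := 0)\<rparr>)"
    and step: "\<And>k s'. k < N \<Longrightarrow> unchanged (For i f p) s s' \<Longrightarrow> reg s' i = int k \<Longrightarrow> I k s' \<Longrightarrow>
      wp p (\<lambda>T s''. T \<le> B \<and> I (Suc k) (s''\<lparr>reg := (reg s'')(i := int k + 1)\<rparr>)) s'"
    and exit: "\<And>T s'. unchanged (For i f p) s s' \<Longrightarrow> reg s' i = int N \<Longrightarrow> I N s' \<Longrightarrow>
      T \<le> X * (B + acost f + 8) \<Longrightarrow> Q T s'"
  shows "wp (For i f p) Q s"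
proof -
  let ?s0 = "s\<lparr>reg := (reg s)(i := 0)\<rparr>"
  let ?body = "Seq p (Assign i (Plus (Reg i) (Const 1)))"
  have un: "unchanged (For i f p) s s'" if "unchanged ?body ?s0 s'" for s'
    using that by (auto simp: unchanged_def For_def)
  have "wp (WhileLess (Reg i) f ?body) (\<lambda>T. Q (2 + T)) ?s0"
  proof (rule wp_WhileLess[where N = N and B = "B + 4" and
        I = "\<lambda>k s'. k \<le> N \<and> reg s' i = int k \<and> I k s'"])
    show "0 \<le> N \<and> reg ?s0 i = int 0 \<and> I 0 ?s0" using init by simp
  next
    fix k s'
    assume u: "unchanged ?body ?s0 s'" and k: "k \<le> N \<and> reg s' i = int k \<and> I k s'"
      and less: "aval (Reg i) s' < aval f s'"
    from less limit[OF un[OF u]] k have "k < N" by simp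
    moreover from this have "wp p (\<lambda>T s''. T \<le> B \<and>
        I (Suc k) (s''\<lparr>reg := (reg s'')(i := int k + 1)\<rparr>)) s'"
      using step[OF _ un[OF u]] k by blast
    then have "wp ?body (\<lambda>T s''. T \<le> B + 4 \<and> Suc k \<le> N \<and> reg s'' i = int (Suc k) \<and>
        I (Suc k) s'') s'"
      unfolding wp_Seq wp_Assign
    proof (rule wp_mono)
      fix T s'' assume "unchanged p s' s''"
        and *: "T \<le> B \<and> I (Suc k) (s''\<lparr>reg := (reg s'')(i := int k + 1)\<rparr>)"
      then have "reg s'' i = int k" using i k unchanged_reg by metis
      with * \<open>k < N\<close> show "T + (1 + acost (Plus (Reg i) (Const 1))) \<le> B + 4 \<and> Suc k \<le> N \<and>
          reg (s''\<lparr>reg := (reg s'')(i := aval (Plus (Reg i) (Const 1)) s'')\<rparr>) i = int (Suc k) \<and>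
          I (Suc k) (s''\<lparr>reg := (reg s'')(i := aval (Plus (Reg i) (Const 1)) s'')\<rparr>)"
        by simp
    qed
    ultimately show "k < N \<and> wp ?body (\<lambda>T s''. T \<le> B + 4 \<and> Suc k \<le> N \<and>
        reg s'' i = int (Suc k) \<and> I (Suc k) s'') s'" by blast
  next
    fix T k s'
    assume u: "unchanged ?body ?s0 s'" and k: "k \<le> N \<and> reg s' i = int k \<and> I k s'"
      and ge: "\<not> aval (Reg i) s' < aval f s'"
      and T: "T \<le> Suc N * (B + 4 + acost (Reg i) + acost f + 1)"
    from ge limit[OF un[OF u]] k have "k = N" by simp
    have "Suc N * (B + 4 + acost (Reg i) + acost f + 1) \<le> X * (B + acost f + 6)"
      using \<open>N < X\<close> by (intro mult_mono) auto
    moreover have "X * (B + acost f + 6) + 2 \<le> X * (B + acost f + 8)"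
      using \<open>N < X\<close> by (simp add: algebra_simps)
    ultimately have "2 + T \<le> X * (B + acost f + 8)" using T by linarith
    then show "Q (2 + T) s'" using exit[OF un[OF u]] k \<open>k = N\<close> by blast
  qed
  then show ?thesis by (simp add: For_def)
qed

text \<open>Only the first factor is counted down to, so it must be small and nonnegative; the
  second may be any integer.\<close>

definition Mul :: "nat \<Rightarrow> nat \<Rightarrow> aexp \<Rightarrow> aexp \<Rightarrow> com" where
  "Mul r i e f = Seq (Assign r (Const 0)) (For i e (Assign r (Plus (Reg r) f)))"

lemma written_Mul [simp]:
  "written_regs (Mul r i e f) = {r, i}" "written_arrs (Mul r i e f) = {}"
  by (auto simp: Mul_def)

lemma wp_Mul:
  assumes "r \<noteq> i" and "N < X"
    and e: "\<And>x y. aval e (s\<lparr>reg := (reg s)(r := x, i := y)\<rparr>) = int N"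
    and f: "\<And>x y. aval f (s\<lparr>reg := (reg s)(r := x, i := y)\<rparr>) = F"
    and exit: "\<And>T. T \<le> X * (acost e + acost f + 13) \<Longrightarrow>
      Q T (s\<lparr>reg := (reg s)(r := int N * F, i := int N)\<rparr>)"
  shows "wp (Mul r i e f) Q s"
proof -
  let ?s0 = "s\<lparr>reg := (reg s)(r := 0)\<rparr>"
  let ?p = "Assign r (Plus (Reg r) f)"
  have "wp (For i e ?p) (\<lambda>T. Q (2 + T)) ?s0"
  proof (rule wp_For[where N = N and X = X and B = "3 + acost f" and
        I = "\<lambda>k s'. s' = s\<lparr>reg := (reg s)(r := int k * F, i := int k)\<rparr>"])
    fix s' assume u: "unchanged (For i e ?p) ?s0 s'"
    have "s' = s\<lparr>reg := (reg s)(r := reg s' r, i := reg s' i)\<rparr>"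
      using u by (cases s, cases s') (auto simp: unchanged_def fun_eq_iff)
    then show "aval e s' = int N" using e by metis
  next
    fix T s' assume "s' = s\<lparr>reg := (reg s)(r := int N * F, i := int N)\<rparr>"
      and T: "T \<le> X * (3 + acost f + acost e + 8)"
    moreover have "2 + T \<le> X * (acost e + acost f + 13)"
    proof -
      have "X * (3 + acost f + acost e + 8) + 2 \<le> X * (acost e + acost f + 13)"
        using \<open>N < X\<close> by (simp add: algebra_simps)
      with T show ?thesis by linarith
    qed
    ultimately show "Q (2 + T) s'" using exit by blast
  qed (use assms(1,2) f in \<open>auto simp: fun_upd_twist algebra_simps\<close>)
  then show ?thesis by (simp add: Mul_def)
qed

section \<open>Schedules and balanced paths\<close>

definition occ :: "(nat \<Rightarrow> nat) \<Rightarrow> nat \<Rightarrow> nat \<Rightarrow> nat" where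
  "occ \<sigma> q k = card {k'. k' < k \<and> \<sigma> k' = q}"

lemma occ_0 [simp]: "occ \<sigma> q 0 = 0"
  by (simp add: occ_def)

lemma occ_Suc: "occ \<sigma> q (Suc k) = occ \<sigma> q k + (if \<sigma> k = q then 1 else 0)"
proof -
  have "{k'. k' < Suc k \<and> \<sigma> k' = q} =
      {k'. k' < k \<and> \<sigma> k' = q} \<union> (if \<sigma> k = q then {k} else {})"
    by (auto simp: less_Suc_eq)
  then show ?thesis by (simp add: occ_def)
qed

lemma occ_mono: "k \<le> l \<Longrightarrow> occ \<sigma> q k \<le> occ \<sigma> q l"
  unfolding occ_def by (intro card_mono) auto

lemma occ_cong: "(\<And>k'. k' < k \<Longrightarrow> \<sigma> k' = \<tau> k') \<Longrightarrow> occ \<sigma> q k = occ \<tau> q k"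
  unfolding occ_def by (rule arg_cong[of _ _ card]) auto

lemma sum_occ: "(\<And>k'. k' < k \<Longrightarrow> \<sigma> k' < P) \<Longrightarrow> (\<Sum>q<P. occ \<sigma> q k) = k"
  by (induction k) (simp_all add: occ_Suc sum.distrib)

text \<open>
  \<open>D\<close> is the paper's \<open>\<Delta>\<close>, \<open>lab j\<close> the number of the class of variable \<open>j\<close>, and \<open>tp q\<close> is \<open>t\<^sub>S\<close> for
  the class \<open>S\<close> with number \<open>q\<close>.
\<close>

locale problem =
  fixes n d D P :: nat and A :: "nat \<Rightarrow> nat \<Rightarrow> int" and b c :: "nat \<Rightarrow> int"
    and lab tp :: "nat \<Rightarrow> nat"
  assumes n_pos: "1 \<le> n" and d_pos: "1 \<le> d" and D_pos: "1 \<le> D" and P_pos: "1 \<le> P"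
    and A_bound: "i < d \<Longrightarrow> j < n \<Longrightarrow> \<bar>A i j\<bar> \<le> int D"
    and lab_less: "j < n \<Longrightarrow> lab j < P"
begin

definition t :: nat where "t = (\<Sum>q<P. tp q)"

definition feas :: "(nat \<Rightarrow> int) \<Rightarrow> bool" where
  "feas x \<longleftrightarrow> (\<forall>j<n. 0 \<le> x j) \<and> (\<forall>i<d. (\<Sum>j<n. A i j * x j) = b i) \<and>
    (\<forall>q<P. (\<Sum>j | j < n \<and> lab j = q. x j) = int (tp q))"

text \<open>
  A schedule \<open>\<sigma>\<close> names the class of each of the \<open>t\<close> picks. It is balanced up to step \<open>k\<close> if no
  class is ever a full pick or more ahead of its proportional share \<open>k * tp q / t\<close>.
\<close>

definition balanced :: "(nat \<Rightarrow> nat) \<Rightarrow> nat \<Rightarrow> bool" where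
  "balanced \<sigma> k \<longleftrightarrow> (\<forall>k'<k. \<sigma> k' < P) \<and>
    (\<forall>q<P. \<forall>k'\<le>k. 0 < t \<longrightarrow> int t * int (occ \<sigma> q k') < int k' * int (tp q) + int t)"

lemma balanced_0: "balanced \<sigma> 0"
  by (simp add: balanced_def)

lemma balanced_cong:
  assumes "\<And>k'. k' < k \<Longrightarrow> \<sigma> k' = \<tau> k'"
  shows "balanced \<sigma> k \<longleftrightarrow> balanced \<tau> k"
proof -
  have "occ \<sigma> q k' = occ \<tau> q k'" if "k' \<le> k" for q k'
    using assms that by (intro occ_cong) auto
  then show ?thesis unfolding balanced_def using assms by auto
qed

text \<open>A class whose share after \<open>k + 1\<close> picks exceeds the number of its picks so
  far can be picked without getting a full pick ahead. The shares of the other classes do not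
  shrink.\<close>

lemma balanced_Suc:
  assumes "balanced \<sigma> k" "\<sigma> k < P" "int t * int (occ \<sigma> (\<sigma> k) k) < int (Suc k) * int (tp (\<sigma> k))"
  shows "balanced \<sigma> (Suc k)"
proof -
  have "int t * int (occ \<sigma> q (Suc k)) < int (Suc k) * int (tp q) + int t"
    if "q < P" "0 < t" for q
  proof (cases "\<sigma> k = q")
    case True
    then show ?thesis using assms(3) by (simp add: occ_Suc algebra_simps)
  next
    case False
    have "int t * int (occ \<sigma> q k) < int k * int (tp q) + int t"
      using assms(1) that by (simp add: balanced_def)
    also have "\<dots> \<le> int (Suc k) * int (tp q) + int t" by (simp add: algebra_simps)
    finally show ?thesis using False by (simp add: occ_Suc)
  qed
  then show ?thesis
    using assms(1,2) unfolding balanced_def by (auto simp: less_Suc_eq le_Suc_eq)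
qed

lemma int_sum_occ:
  assumes "balanced \<sigma> k" "k' \<le> k"
  shows "(\<Sum>q<P. int (occ \<sigma> q k')) = int k'"
  using sum_occ[of k' \<sigma> P] assms by (simp add: balanced_def flip: of_nat_sum)

lemma int_t: "int t = (\<Sum>q<P. int (tp q))"
  by (simp add: t_def)

lemma sum_lag:
  assumes "balanced \<sigma> k" "k' \<le> k"
  shows "(\<Sum>q<P. int k' * int (tp q) - int t * int (occ \<sigma> q k')) = 0"
  using int_sum_occ[OF assms] int_t by (simp add: sum_subtractf flip: sum_distrib_left)

text \<open>Averaging: the shares after \<open>k + 1\<close> picks add up to \<open>k + 1\<close>,
  but only \<open>k\<close> picks have been made. Hence the greedy construction of a schedule never
  gets stuck.\<close>

lemma lagging_class:
  assumes "balanced \<sigma> k" "0 < t"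
  shows "\<exists>q<P. int t * int (occ \<sigma> q k) < int (Suc k) * int (tp q)"
proof (rule ccontr)
  assume "\<not> ?thesis"
  then have "\<forall>q<P. int (Suc k) * int (tp q) \<le> int t * int (occ \<sigma> q k)"
    by (meson not_less)
  then have "(\<Sum>q<P. int (Suc k) * int (tp q)) \<le> (\<Sum>q<P. int t * int (occ \<sigma> q k))"
    by (intro sum_mono) blast
  then have "int (Suc k) * int t \<le> int t * int k"
    using int_sum_occ[OF assms(1), of k] int_t by (simp flip: sum_distrib_left)
  then show False using assms(2) by simp
qed

text \<open>Balance bounds the lags from one side only. As they sum to zero and each is at least
  \<open>- t\<close>, none exceeds \<open>(P - 1) * t\<close>.\<close>

lemma lag_bound:
  assumes "balanced \<sigma> t" "q < P" "k \<le> t"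
  shows "\<bar>int k * int (tp q) - int t * int (occ \<sigma> q k)\<bar> \<le> int P * int t"
proof -
  define lag where "lag q = int k * int (tp q) - int t * int (occ \<sigma> q k)" for q
  have low: "- int t \<le> lag q" if "q < P" for q
  proof (cases "t = 0")
    case True
    then show ?thesis using assms(3) by (simp add: lag_def)
  next
    case False
    then have "int t * int (occ \<sigma> q k) < int k * int (tp q) + int t"
      using assms(1,3) that unfolding balanced_def by blast
    then show ?thesis by (simp add: lag_def)
  qed
  have "0 = lag q + (\<Sum>q'\<in>{..<P} - {q}. lag q')"
    using sum_lag[OF assms(1,3)] sum.remove[of "{..<P}" q lag] assms(2) by (simp add: lag_def)
  moreover have "(\<Sum>q'\<in>{..<P} - {q}. - int t) \<le> (\<Sum>q'\<in>{..<P} - {q}. lag q')"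
    using low by (intro sum_mono) auto
  moreover have "(\<Sum>q'\<in>{..<P} - {q}. - int t) = int t - int P * int t"
    using assms(2) P_pos by (simp add: card_Diff_subset of_nat_diff algebra_simps)
  moreover have "int t \<le> int P * int t" using P_pos mult_right_mono[of 1 "int P" "int t"] by simp
  ultimately show ?thesis using low[OF assms(2)] unfolding lag_def[symmetric] by linarith
qed

text \<open>At \<open>k = t\<close> the strict inequality of balance and integrality give at most
  \<open>tp q\<close> picks of each class; both sides have the sum \<open>t\<close>, so equality
  holds throughout.\<close>

lemma occ_total:
  assumes "balanced \<sigma> t" "q < P"
  shows "occ \<sigma> q t = tp q"
proof (cases "t = 0")
  case True
  then show ?thesis using assms(2) by (simp add: t_def)
next
  case False
  have le: "occ \<sigma> q t \<le> tp q" if "q < P" for q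
  proof -
    have "int t * int (occ \<sigma> q t) < int t * int (tp q) + int t"
      using assms(1) that False unfolding balanced_def by blast
    then have "int t * int (occ \<sigma> q t) < int t * (int (tp q) + 1)"
      by (simp add: algebra_simps)
    then show ?thesis using False by simp
  qed
  have "(\<Sum>q<P. occ \<sigma> q t) = (\<Sum>q<P. tp q)"
    using sum_occ[of t \<sigma> P] assms(1) by (simp add: balanced_def t_def)
  moreover have "(\<Sum>q<P. occ \<sigma> q t) < (\<Sum>q<P. tp q)" if "occ \<sigma> q t < tp q"
    using le that assms(2) by (intro sum_strict_mono_ex1) auto
  ultimately show ?thesis using le[OF assms(2)] by force
qed

text \<open>The radius of the box before scaling. Each of the \<open>P\<close> classes contributes
  \<open>2 * d * D\<close> from its Steinitz ordering and \<open>(P + 1) * D\<close> from its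
  deviation from the schedule.\<close>

definition R :: nat where "R = P * D * (2 * d + P + 1)"

definition K :: int where "K = int R * int (t + 1)"

text \<open>
  Partial sums are compared with the line through \<open>b\<close> after scaling by \<open>t + 1\<close> rather than \<open>t\<close>,
  so that a complete sequence of picks ends exactly in \<open>b\<close>, also when \<open>t = 0\<close>.
\<close>

definition w :: "nat \<Rightarrow> nat \<Rightarrow> int" where "w i j = int (t + 1) * A i j - b i"

definition path :: "(nat \<Rightarrow> nat) \<Rightarrow> nat list \<Rightarrow> bool" where
  "path \<sigma> js \<longleftrightarrow> length js \<le> t \<and> (\<forall>k<length js. js ! k < n \<and> lab (js ! k) = \<sigma> k)"

lemma path_Nil: "path \<sigma> []"
  by (simp add: path_def)

lemma path_snoc:
  "path \<sigma> (js @ [j]) \<longleftrightarrow> path \<sigma> js \<and> length js < t \<and> j < n \<and> lab j = \<sigma> (length js)"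
  unfolding path_def by (auto simp: nth_append less_Suc_eq)

section \<open>From a feasible point to a sequence of picks near the line\<close>

definition picks :: "(nat \<Rightarrow> int) \<Rightarrow> nat \<Rightarrow> nat list" where
  "picks x q = concat (map (\<lambda>j. replicate (nat (x j)) j) (filter (\<lambda>j. lab j = q) [0..<n]))"

lemma set_picks: "set (picks x q) \<subseteq> {j. j < n \<and> lab j = q}"
  by (auto simp: picks_def)

lemma sum_picks:
  fixes f :: "nat \<Rightarrow> int"
  assumes "feas x"
  shows "(\<Sum>j\<leftarrow>picks x q. f j) = (\<Sum>j | j < n \<and> lab j = q. f j * x j)"
proof -
  have "(\<Sum>j\<leftarrow>concat (map (\<lambda>j. replicate (nat (x j)) j) js). f j) =
      (\<Sum>j\<leftarrow>js. int (nat (x j)) * f j)" for js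
    by (induction js) (simp_all add: sum_list_replicate map_replicate)
  then have "(\<Sum>j\<leftarrow>picks x q. f j) =
      (\<Sum>j\<leftarrow>filter (\<lambda>j. lab j = q) [0..<n]. int (nat (x j)) * f j)"
    by (simp add: picks_def)
  also have "\<dots> = (\<Sum>j\<in>{j. j < n \<and> lab j = q}. int (nat (x j)) * f j)"
    by (subst sum_list_distinct_conv_sum_set) (auto intro!: sum.cong)
  also have "\<dots> = (\<Sum>j | j < n \<and> lab j = q. f j * x j)"
    using assms by (intro sum.cong) (auto simp: feas_def)
  finally show ?thesis .
qed

lemma length_picks:
  assumes "feas x" "q < P"
  shows "length (picks x q) = tp q"
proof -
  have "int (length (picks x q)) = (\<Sum>j\<leftarrow>picks x q. 1)" by (simp add: sum_list_triv)
  also have "\<dots> = int (tp q)" using sum_picks[OF assms(1), of "\<lambda>_. 1" q] assms by (simp add: feas_def)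
  finally show ?thesis by simp
qed

lemma sum_over_classes:
  fixes f :: "nat \<Rightarrow> int"
  shows "(\<Sum>q<P. \<Sum>j | j < n \<and> lab j = q. f j) = (\<Sum>j<n. f j)"
proof -
  have "(\<Sum>q<P. \<Sum>j | j < n \<and> lab j = q. f j) = (\<Sum>q<P. \<Sum>j | j \<in> {..<n} \<and> lab j = q. f j)"
    by simp
  also have "\<dots> = (\<Sum>j<n. f j)"
    using lab_less by (intro sum.group) auto
  finally show ?thesis .
qed

text \<open>One class in one coordinate: \<open>m\<close> is its size, \<open>r\<close> the number
  of its picks among the first \<open>k\<close>, \<open>S\<close> and \<open>B\<close> are the
  partial and the complete column sum. With \<open>u = t + 1\<close>, the identity \<open>m * (u * S
  - k * B) = u * (m * S - r * B) + (u * r - k * m) * B\<close> separates the error of the ordering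
  from that of the schedule. Replacing \<open>t\<close> by \<open>u\<close> in the latter costs one
  more \<open>r\<close>, which is at most \<open>t\<close>.\<close>

lemma class_deviation:
  fixes m r k :: nat and S B :: int
  assumes "\<bar>int m * S - int r * B\<bar> \<le> int m * (2 * int d * int D)"
    and "\<bar>B\<bar> \<le> int m * int D" and "\<bar>int k * int m - int t * int r\<bar> \<le> int P * int t"
    and "r \<le> m" "r \<le> t" "m = 0 \<Longrightarrow> S = 0"
  shows "\<bar>int (t + 1) * S - int k * B\<bar> \<le> int (t + 1) * (int D * int (2 * d + P + 1))"
proof (cases "m = 0")
  case True
  then show ?thesis using assms by simp
next
  case False
  define u where "u = int (t + 1)"
  have u: "0 \<le> u" "int t \<le> u" by (simp_all add: u_def)
  have "\<bar>u * int r - int k * int m\<bar> \<le> int P * int t + int r"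
    using assms(3) by (simp add: u_def algebra_simps abs_le_iff)
  also have "\<dots> \<le> (int P + 1) * u"
    using assms(5) u mult_left_mono[of "int t" u "int P"] by (simp add: algebra_simps)
  finally have lag: "\<bar>u * int r - int k * int m\<bar> \<le> (int P + 1) * u" .
  have "int m * (u * S - int k * B) = u * (int m * S - int r * B) + (u * int r - int k * int m) * B"
    by (simp add: algebra_simps)
  then have "\<bar>int m * (u * S - int k * B)\<bar> \<le>
      \<bar>u * (int m * S - int r * B)\<bar> + \<bar>(u * int r - int k * int m) * B\<bar>"
    by (simp only: abs_triangle_ineq)
  also have "\<dots> \<le> u * (int m * (2 * int d * int D)) + ((int P + 1) * u) * (int m * int D)"
    using assms(1,2) lag u by (intro add_mono) (auto simp: abs_mult intro!: mult_mono)
  also have "\<dots> = int m * (u * (int D * int (2 * d + P + 1)))"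
    by (simp add: algebra_simps)
  finally have "int m * \<bar>u * S - int k * B\<bar> \<le> int m * (u * (int D * int (2 * d + P + 1)))"
    by (simp add: abs_mult)
  then show ?thesis using False unfolding u_def by (simp add: mult_le_cancel_left)
qed

lemma occ_less_total:
  assumes "balanced \<sigma> t" "k < t"
  shows "occ \<sigma> (\<sigma> k) k < tp (\<sigma> k)"
proof -
  have "occ \<sigma> (\<sigma> k) (Suc k) \<le> occ \<sigma> (\<sigma> k) t" using assms(2) by (intro occ_mono) simp
  moreover have "occ \<sigma> (\<sigma> k) t = tp (\<sigma> k)"
    using assms by (intro occ_total) (auto simp: balanced_def)
  ultimately show ?thesis by (simp add: occ_Suc)
qed

text \<open>The Steinitz orderings of the classes are merged along the schedule. A prefix of the
  merged sequence consists of one prefix of every ordering, so its deviation is at most the sum of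
  the deviations of the classes.\<close>

lemma path_of_feasible:
  assumes bal: "balanced \<sigma> t" and x: "feas x"
  obtains js where "path \<sigma> js" "length js = t"
    "\<And>k i. k \<le> t \<Longrightarrow> i < d \<Longrightarrow> \<bar>\<Sum>j\<leftarrow>take k js. w i j\<bar> \<le> K"
    "\<And>i. i < d \<Longrightarrow> (\<Sum>j\<leftarrow>js. w i j) = b i"
    "(\<Sum>j\<leftarrow>js. c j) = (\<Sum>j<n. c j * x j)"
proof -
  have "\<forall>q<P. \<exists>l. mset l = mset (picks x q) \<and> (\<forall>k\<le>tp q. \<forall>i<d.
      \<bar>int (tp q) * (\<Sum>j\<leftarrow>take k l. A i j) - int k * (\<Sum>j\<leftarrow>picks x q. A i j)\<bar>
        \<le> int (tp q) * (2 * int d * int D))"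
  proof (intro allI impI)
    fix q assume "q < P"
    have "\<forall>j\<in>set (picks x q). \<forall>i<d. \<bar>A i j\<bar> \<le> int D" using set_picks A_bound by blast
    from balanced_permutation[OF this] length_picks[OF x \<open>q < P\<close>]
    show "\<exists>l. mset l = mset (picks x q) \<and> (\<forall>k\<le>tp q. \<forall>i<d.
      \<bar>int (tp q) * (\<Sum>j\<leftarrow>take k l. A i j) - int k * (\<Sum>j\<leftarrow>picks x q. A i j)\<bar>
        \<le> int (tp q) * (2 * int d * int D))" by simp
  qed
  then obtain l where l: "\<And>q. q < P \<Longrightarrow> mset (l q) = mset (picks x q)"
    and dev: "\<And>q k i. q < P \<Longrightarrow> k \<le> tp q \<Longrightarrow> i < d \<Longrightarrow>
      \<bar>int (tp q) * (\<Sum>j\<leftarrow>take k (l q). A i j) - int k * (\<Sum>j\<leftarrow>picks x q. A i j)\<bar>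
        \<le> int (tp q) * (2 * int d * int D)"
    by metis
  have len: "length (l q) = tp q" if "q < P" for q
    using l[OF that] length_picks[OF x that] by (metis size_mset)
  have set_l: "set (l q) \<subseteq> {j. j < n \<and> lab j = q}" if "q < P" for q
    using l[OF that] set_picks by (metis set_mset_mset)
  have sum_l: "(\<Sum>j\<leftarrow>l q. f j) = (\<Sum>j | j < n \<and> lab j = q. f j * x j)"
    if "q < P" for q and f :: "nat \<Rightarrow> int"
  proof -
    have "(\<Sum>j\<leftarrow>l q. f j) = (\<Sum>j\<leftarrow>picks x q. f j)"
      using l[OF that] by (metis mset_map sum_mset_sum_list)
    then show ?thesis using sum_picks[OF x] by simp
  qed
  have \<sigma>: "\<sigma> k < P" if "k < t" for k using bal that by (simp add: balanced_def)
  define pick where "pick k = l (\<sigma> k) ! occ \<sigma> (\<sigma> k) k" for k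
  define js where "js = map pick [0..<t]"
  have [simp]: "length js = t" by (simp add: js_def)
  have "path \<sigma> js"
    unfolding path_def
  proof (intro conjI allI impI)
    fix k assume "k < length js"
    then have k: "k < t" by simp
    have "pick k \<in> set (l (\<sigma> k))"
      using occ_less_total[OF bal k] len[OF \<sigma>[OF k]] by (simp add: pick_def)
    then show "js ! k < n" "lab (js ! k) = \<sigma> k"
      using set_l[OF \<sigma>[OF k]] k by (auto simp: js_def)
  qed simp
  have prefix: "(\<Sum>j\<leftarrow>take k js. f j) = (\<Sum>q<P. \<Sum>j\<leftarrow>take (occ \<sigma> q k) (l q). f j)"
    if "k \<le> t" for k and f :: "nat \<Rightarrow> int"
    using that
  proof (induction k)
    case (Suc k)
    then have k: "k < t" by simp
    have "(\<Sum>j\<leftarrow>take (occ \<sigma> q (Suc k)) (l q). f j) =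
        (\<Sum>j\<leftarrow>take (occ \<sigma> q k) (l q). f j) + (if \<sigma> k = q then f (pick k) else 0)"
      if "q < P" for q
      using occ_less_total[OF bal k] len[OF \<sigma>[OF k]]
      by (auto simp: occ_Suc take_Suc_conv_app_nth pick_def)
    then have "(\<Sum>q<P. \<Sum>j\<leftarrow>take (occ \<sigma> q (Suc k)) (l q). f j) =
        (\<Sum>q<P. \<Sum>j\<leftarrow>take (occ \<sigma> q k) (l q). f j) + f (pick k)"
      using \<sigma>[OF k] by (simp add: sum.distrib)
    moreover have "take (Suc k) js = take k js @ [pick k]"
      using k by (simp add: js_def take_Suc_conv_app_nth)
    ultimately show ?case using Suc by simp
  qed simp
  have whole: "(\<Sum>j\<leftarrow>js. f j) = (\<Sum>j<n. f j * x j)" for f :: "nat \<Rightarrow> int"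
  proof -
    have "(\<Sum>j\<leftarrow>js. f j) = (\<Sum>q<P. \<Sum>j\<leftarrow>take (occ \<sigma> q t) (l q). f j)"
      using prefix[of t f] by simp
    also have "\<dots> = (\<Sum>q<P. \<Sum>j | j < n \<and> lab j = q. f j * x j)"
      using occ_total[OF bal] len sum_l by (intro sum.cong) auto
    finally show ?thesis by (simp add: sum_over_classes)
  qed
  have w_sum: "(\<Sum>j\<leftarrow>xs. w i j) = int (t + 1) * (\<Sum>j\<leftarrow>xs. A i j) - int (length xs) * b i" for i xs
    by (simp add: w_def sum_list_subtractf sum_list_const_mult sum_list_triv)
  have Ax: "(\<Sum>j<n. A i j * x j) = b i" if "i < d" for i
    using x that by (simp add: feas_def)
  have "(\<Sum>j\<leftarrow>js. w i j) = b i" if "i < d" for i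
    using w_sum[of i js] whole[of "A i"] Ax[OF that] by (simp add: algebra_simps)
  moreover have "\<bar>\<Sum>j\<leftarrow>take k js. w i j\<bar> \<le> K" if "k \<le> t" "i < d" for k i
  proof -
    define S where "S q = (\<Sum>j\<leftarrow>take (occ \<sigma> q k) (l q). A i j)" for q
    define B where "B q = (\<Sum>j\<leftarrow>picks x q. A i j)" for q
    have "(\<Sum>q<P. B q) = b i"
      using Ax[OF that(2)] by (simp add: B_def sum_picks[OF x] sum_over_classes)
    then have "(\<Sum>j\<leftarrow>take k js. w i j) = (\<Sum>q<P. int (t + 1) * S q - int k * B q)"
      using that by (simp add: w_sum prefix S_def sum_subtractf min_def flip: sum_distrib_left)
    also have "\<bar>\<dots>\<bar> \<le> (\<Sum>q<P. \<bar>int (t + 1) * S q - int k * B q\<bar>)" by (rule sum_abs)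
    also have "\<dots> \<le> (\<Sum>q<P. int (t + 1) * (int D * int (2 * d + P + 1)))"
    proof (intro sum_mono)
      fix q assume "q \<in> {..<P}"
      then have q: "q < P" by simp
      have r: "occ \<sigma> q k \<le> tp q" using occ_mono[OF that(1)] occ_total[OF bal q] by metis
      have "\<bar>B q\<bar> \<le> (\<Sum>j\<leftarrow>picks x q. \<bar>A i j\<bar>)"
        unfolding B_def by (rule sum_list_abs[of "map _ _", simplified comp_def map_map])
      also have "\<dots> \<le> (\<Sum>j\<leftarrow>picks x q. int D)"
        using set_picks A_bound[OF that(2)] by (intro sum_list_mono) blast
      also have "\<dots> = int (tp q) * int D" using length_picks[OF x q] by (simp add: sum_list_triv)
      finally have B: "\<bar>B q\<bar> \<le> int (tp q) * int D" .
      have "occ \<sigma> q k \<le> k"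
        unfolding occ_def using card_mono[of "{..<k}" "{k'. k' < k \<and> \<sigma> k' = q}"] by auto
      then have "occ \<sigma> q k \<le> t" using that(1) by simp
      show "\<bar>int (t + 1) * S q - int k * B q\<bar> \<le> int (t + 1) * (int D * int (2 * d + P + 1))"
      proof (rule class_deviation[OF _ B lag_bound[OF bal q that(1)] r])
        show "occ \<sigma> q k \<le> t" by fact
        show "\<bar>int (tp q) * S q - int (occ \<sigma> q k) * B q\<bar> \<le> int (tp q) * (2 * int d * int D)"
          using dev[OF q r that(2)] by (simp add: S_def B_def)
      qed (use len[OF q] in \<open>simp_all add: S_def\<close>)
    qed
    also have "\<dots> = K" by (simp add: K_def R_def algebra_simps)
    finally show ?thesis .
  qed
  ultimately show ?thesis using that[of js] \<open>path \<sigma> js\<close> whole by auto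
qed

section \<open>From a sequence of picks back to a feasible point\<close>

lemma sum_list_count:
  fixes f :: "nat \<Rightarrow> int"
  assumes "set js \<subseteq> {..<m}"
  shows "(\<Sum>j\<leftarrow>js. f j) = (\<Sum>j<m. f j * int (count_list js j))"
  using assms
proof (induction js)
  case (Cons a js)
  then have "(\<Sum>j<m. f j * int (count_list (a # js) j)) =
      (\<Sum>j<m. f j * int (count_list js j) + (if j = a then f j else 0))"
    by (intro sum.cong) (auto simp: algebra_simps)
  with Cons show ?case by (simp add: sum.distrib)
qed simp

text \<open>With \<open>t\<close> picks the target equation reads
  \<open>(t + 1) * A x - t * b = b\<close>, and \<open>t + 1\<close> cancels even for
  \<open>t = 0\<close>. The class sums are the occurrence counts of the schedule, fixed by
  \<open>occ_total\<close>.\<close>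

lemma feasible_of_path:
  assumes bal: "balanced \<sigma> t" and js: "path \<sigma> js" "length js = t"
    and target: "\<And>i. i < d \<Longrightarrow> (\<Sum>j\<leftarrow>js. w i j) = b i"
  defines "x \<equiv> \<lambda>j. int (count_list js j)"
  shows "feas x" and "(\<Sum>j<n. c j * x j) = (\<Sum>j\<leftarrow>js. c j)"
proof -
  have sub: "set js \<subseteq> {..<n}" using js by (auto simp: path_def in_set_conv_nth)
  have sum: "(\<Sum>j\<leftarrow>js. f j) = (\<Sum>j<n. f j * x j)" for f
    unfolding x_def by (rule sum_list_count[OF sub])
  then show "(\<Sum>j<n. c j * x j) = (\<Sum>j\<leftarrow>js. c j)" by simp
  have "(\<Sum>j<n. A i j * x j) = b i" if "i < d" for i
  proof -
    have "b i = int (t + 1) * (\<Sum>j\<leftarrow>js. A i j) - int t * b i"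
      using target[OF that] js(2)
      by (simp add: w_def sum_list_subtractf sum_list_const_mult sum_list_triv)
    then have "int (t + 1) * b i = int (t + 1) * (\<Sum>j\<leftarrow>js. A i j)" by (simp add: algebra_simps)
    then show ?thesis unfolding sum by (simp add: mult_cancel_left)
  qed
  moreover have "(\<Sum>j | j < n \<and> lab j = q. x j) = int (tp q)" if q: "q < P" for q
  proof -
    have "(\<Sum>j | j < n \<and> lab j = q. x j) = (\<Sum>j<n. (if lab j = q then 1 else 0) * x j)"
      by (simp add: if_distrib[of "\<lambda>u. u * _"] sum.If_cases Int_def cong: if_cong)
    also have "\<dots> = (\<Sum>j\<leftarrow>js. if lab j = q then 1 else 0)" using sum by simp
    also have "\<dots> = (\<Sum>k<t. if \<sigma> k = q then 1 else 0)"
      using js by (simp add: sum_list_sum_nth path_def atLeast0LessThan)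
    also have "\<dots> = int (occ \<sigma> q t)" by (simp add: occ_def sum.If_cases Int_def)
    finally show ?thesis using occ_total[OF bal q] by simp
  qed
  ultimately show "feas x" by (simp add: feas_def x_def)
qed

end

section \<open>The dynamic program\<close>

text \<open>Entries occupy consecutive blocks of \<open>d\<close> cells; writing one block does not
  disturb another.\<close>

lemma cell_eq_iff:
  fixes e e' d i i' :: nat
  assumes "i < d" "i' < d"
  shows "e * d + i = e' * d + i' \<longleftrightarrow> e = e' \<and> i = i'"
proof
  assume eq: "e * d + i = e' * d + i'"
  have "(e * d + i) div d = e" "(e' * d + i') div d = e'" using assms by auto
  with eq have "e = e'" by metis
  with eq show "e = e' \<and> i = i'" by simp
qed simp

text \<open>Used with \<open>q = t + 1\<close>. The interval alone has about
  \<open>2 * R * q\<close> points, but a fixed residue modulo \<open>q\<close> leaves only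
  \<open>2 * R + 1\<close>; this removes the cost of scaling.\<close>

lemma card_scaled_box:
  fixes q o' :: int
  assumes "0 < q"
  shows "card {z. \<bar>z\<bar> \<le> int R * q \<and> q dvd z + o'} \<le> 2 * R + 1"
    and "finite {z. \<bar>z\<bar> \<le> int R * q \<and> q dvd z + o'}"
proof -
  let ?S = "{z. \<bar>z\<bar> \<le> int R * q \<and> q dvd z + o'}"
  have "?S \<subseteq> {- (int R * q)..int R * q}" by auto
  then show fin: "finite ?S" by (rule finite_subset) simp
  define lo where "lo = (- (int R * q) + o') div q"
  have "(\<lambda>z. (z + o') div q) ` ?S \<subseteq> {lo..lo + 2 * int R}"
  proof safe
    fix z assume z: "\<bar>z\<bar> \<le> int R * q" "q dvd z + o'"
    have "lo \<le> (z + o') div q" unfolding lo_def using z assms by (intro zdiv_mono1) (auto simp: abs_le_iff algebra_simps)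
    moreover have "(z + o') div q \<le> (- (int R * q) + o' + 2 * int R * q) div q"
      using z assms by (intro zdiv_mono1) (auto simp: abs_le_iff algebra_simps)
    moreover have "(- (int R * q) + o' + 2 * int R * q) div q = lo + 2 * int R"
      using div_mult_self1[of q "- (int R * q) + o'" "2 * int R"] assms unfolding lo_def by linarith
    ultimately show "(z + o') div q \<in> {lo..lo + 2 * int R}" by simp
  qed
  moreover have "inj_on (\<lambda>z. (z + o') div q) ?S"
  proof (rule inj_onI)
    fix y z assume "y \<in> ?S" "z \<in> ?S" and eq: "(y + o') div q = (z + o') div q"
    then have dvd: "q dvd y + o'" "q dvd z + o'" by simp_all
    have "y + o' = (y + o') div q * q" using dvd(1) by simp
    also have "\<dots> = z + o'" unfolding eq using dvd(2) by simp
    finally show "y = z" by simp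
  qed
  ultimately have "card ?S \<le> card {lo..lo + 2 * int R}"
    by (intro card_inj_on_le) auto
  then show "card ?S \<le> 2 * R + 1" by simp
qed

context problem
begin

text \<open>
  The dynamic program keeps a list of reachable states. Entry \<open>e\<close> consists of its layer \<open>lay e\<close>
  (the number of picks so far), its scaled and centred partial sum, stored in the cells
  \<open>Z (e * d), \<dots>, Z (e * d + d - 1)\<close>, the best objective value \<open>val e\<close> known for it, and
  a predecessor \<open>par e\<close> with the pick \<open>via e\<close> leading from it to \<open>e\<close>.
\<close>

definition same :: "(nat \<Rightarrow> int) \<Rightarrow> (nat \<Rightarrow> int) \<Rightarrow> nat \<Rightarrow> nat \<Rightarrow> bool" where
  "same Z lay e e' \<longleftrightarrow> lay e = lay e' \<and> (\<forall>i<d. Z (e * d + i) = Z (e' * d + i))"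

definition legal :: "(nat \<Rightarrow> nat) \<Rightarrow> (nat \<Rightarrow> int) \<Rightarrow> nat \<Rightarrow> nat \<Rightarrow> bool" where
  "legal \<sigma> lay e j \<longleftrightarrow> j < n \<and> (\<exists>k<t. lay e = int k \<and> lab j = \<sigma> k)"

definition child :: "(nat \<Rightarrow> int) \<Rightarrow> (nat \<Rightarrow> int) \<Rightarrow> nat \<Rightarrow> nat \<Rightarrow> nat \<Rightarrow> bool" where
  "child Z lay e j e' \<longleftrightarrow> lay e' = lay e + 1 \<and> (\<forall>i<d. Z (e' * d + i) = Z (e * d + i) + w i j)"

text \<open>The invariant of a breadth-first search: \<open>L\<close> entries exist, those below
  \<open>h\<close> are fully expanded, and at \<open>h\<close> the columns below \<open>m\<close>
  have been tried. Predecessors have index at most \<open>h\<close>, while new or improved entries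
  belong to layer \<open>lay h + 1\<close> and hence lie behind \<open>h\<close>; so the values up
  to \<open>h\<close> are final. The last clause carries optimality: every admissible pick tried so
  far is represented by an entry of at least the resulting value.\<close>

definition tree :: "(nat \<Rightarrow> nat) \<Rightarrow> nat \<Rightarrow> nat \<Rightarrow> nat \<Rightarrow> (nat \<Rightarrow> int) \<Rightarrow> (nat \<Rightarrow> int) \<Rightarrow>
    (nat \<Rightarrow> int) \<Rightarrow> (nat \<Rightarrow> int) \<Rightarrow> (nat \<Rightarrow> int) \<Rightarrow> bool" where
  "tree \<sigma> L h m Z lay val par via \<longleftrightarrow>
    0 < L \<and> h \<le> L \<and> lay 0 = 0 \<and> val 0 = 0 \<and> (\<forall>i<d. Z i = 0) \<and>
    (\<forall>e. 0 < e \<and> e < L \<longrightarrow> (\<exists>p j. par e = int p \<and> via e = int j \<and> p < e \<and> p \<le> h \<and>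
      legal \<sigma> lay p j \<and> child Z lay p j e \<and> (\<forall>i<d. \<bar>Z (e * d + i)\<bar> \<le> K) \<and>
      val e = val p + c j)) \<and>
    (\<forall>e e'. e < e' \<and> e' < L \<longrightarrow> lay e \<le> lay e' \<and> \<not> same Z lay e e') \<and>
    (\<forall>e e'. e < L \<and> h \<le> e' \<and> e' < L \<longrightarrow> lay e \<le> lay e' + 1) \<and>
    (\<forall>e j. e < L \<and> (e < h \<or> e = h \<and> j < m) \<and> legal \<sigma> lay e j \<and>
        (\<forall>i<d. \<bar>Z (e * d + i) + w i j\<bar> \<le> K) \<longrightarrow>
      (\<exists>e'<L. child Z lay e j e' \<and> val e + c j \<le> val e'))"

lemma treeD:
  assumes "tree \<sigma> L h m Z lay val par via"
  shows "0 < L" "h \<le> L" "lay 0 = 0" "val 0 = 0" "\<And>i. i < d \<Longrightarrow> Z i = 0"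
    and tree_entry: "\<And>e. 0 < e \<Longrightarrow> e < L \<Longrightarrow>
      \<exists>p j. par e = int p \<and> via e = int j \<and> p < e \<and> p \<le> h \<and> legal \<sigma> lay p j \<and> child Z lay p j e \<and> (\<forall>i<d. \<bar>Z (e * d + i)\<bar> \<le> K) \<and> val e = val p + c j"
    and tree_mono: "\<And>e e'. e < e' \<Longrightarrow> e' < L \<Longrightarrow> lay e \<le> lay e'"
    and tree_distinct: "\<And>e e'. e < e' \<Longrightarrow> e' < L \<Longrightarrow> \<not> same Z lay e e'"
    and tree_top: "\<And>e e'. e < L \<Longrightarrow> h \<le> e' \<Longrightarrow> e' < L \<Longrightarrow> lay e \<le> lay e' + 1"
    and tree_done: "\<And>e j. e < L \<Longrightarrow> e < h \<or> e = h \<and> j < m \<Longrightarrow> legal \<sigma> lay e j \<Longrightarrow>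
      (\<And>i. i < d \<Longrightarrow> \<bar>Z (e * d + i) + w i j\<bar> \<le> K) \<Longrightarrow>
      \<exists>e'<L. child Z lay e j e' \<and> val e + c j \<le> val e'"
proof -
  note c = assms[unfolded tree_def]
  note c1 = conjunct2[OF c] note c2 = conjunct2[OF c1] note c3 = conjunct2[OF c2]
  note c4 = conjunct2[OF c3] note c5 = conjunct2[OF c4] note c6 = conjunct2[OF c5]
  note c7 = conjunct2[OF c6] note c8 = conjunct2[OF c7]
  show "0 < L" "h \<le> L" "lay 0 = 0" "val 0 = 0"
    using conjunct1[OF c] conjunct1[OF c1] conjunct1[OF c2] conjunct1[OF c3] by blast+
  show "Z i = 0" if "i < d" for i using conjunct1[OF c4] that by blast
  show "\<exists>p j. par e = int p \<and> via e = int j \<and> p < e \<and> p \<le> h \<and>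
      legal \<sigma> lay p j \<and> child Z lay p j e \<and> (\<forall>i<d. \<bar>Z (e * d + i)\<bar> \<le> K) \<and> val e = val p + c j"
    if "0 < e" "e < L" for e using conjunct1[OF c5] that by blast
  show "lay e \<le> lay e'" "\<not> same Z lay e e'" if "e < e'" "e' < L" for e e'
    using conjunct1[OF c6] that by blast+
  show "lay e \<le> lay e' + 1" if "e < L" "h \<le> e'" "e' < L" for e e'
    using conjunct1[OF c7] that by blast
  show "\<exists>e'<L. child Z lay e j e' \<and> val e + c j \<le> val e'"
    if "e < L" "e < h \<or> e = h \<and> j < m" "legal \<sigma> lay e j"
      "\<And>i. i < d \<Longrightarrow> \<bar>Z (e * d + i) + w i j\<bar> \<le> K" for e j
    using c8[rule_format, of e j] that by blast
qed

lemma K_nonneg: "0 \<le> K"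
  by (simp add: K_def)

section \<open>Steps that preserve the invariant\<close>

lemma tree_init:
  assumes "\<And>i. Z i = 0" "\<And>e. lay e = 0" "\<And>e. val e = 0"
  shows "tree \<sigma> 1 0 0 Z lay val par via"
  using assms by (auto simp: tree_def)

text \<open>For a column that is inadmissible, and equally for one whose successor is already listed
  with a value at least as good.\<close>

lemma tree_advance:
  assumes tr: "tree \<sigma> L h m Z lay val par via"
    and new: "legal \<sigma> lay h m \<Longrightarrow> (\<And>i. i < d \<Longrightarrow> \<bar>Z (h * d + i) + w i m\<bar> \<le> K) \<Longrightarrow>
      \<exists>e'<L. child Z lay h m e' \<and> val h + c m \<le> val e'"
  shows "tree \<sigma> L h (Suc m) Z lay val par via"
proof -
  have "\<forall>e j. e < L \<and> (e < h \<or> e = h \<and> j < Suc m) \<and> legal \<sigma> lay e j \<and>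
      (\<forall>i<d. \<bar>Z (e * d + i) + w i j\<bar> \<le> K) \<longrightarrow>
    (\<exists>e'<L. child Z lay e j e' \<and> val e + c j \<le> val e')"
  proof (intro allI impI; elim conjE)
    fix e j
    assume e: "e < L" "e < h \<or> e = h \<and> j < Suc m" "legal \<sigma> lay e j"
      "\<forall>i<d. \<bar>Z (e * d + i) + w i j\<bar> \<le> K"
    show "\<exists>e'<L. child Z lay e j e' \<and> val e + c j \<le> val e'"
    proof (cases "e = h \<and> j = m")
      case True
      then show ?thesis using e new by blast
    next
      case False
      then show ?thesis using e by (intro tree_done[OF tr]) auto
    qed
  qed
  then show ?thesis using tr unfolding tree_def by (elim conjE) (intro conjI; assumption)
qed

text \<open>Legal picks are below \<open>n\<close>, so \<open>n\<close> tried columns finish entry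
  \<open>h\<close>.\<close>

lemma tree_next:
  assumes tr: "tree \<sigma> L h n Z lay val par via" and "h < L"
  shows "tree \<sigma> L (Suc h) 0 Z lay val par via"
  unfolding tree_def
proof (intro conjI allI impI; (elim conjE)?)
  show "0 < L" "Suc h \<le> L" using assms(2) by auto
  show "lay 0 = 0" "val 0 = 0" using treeD(3,4)[OF tr] by auto
  show "Z i = 0" if "i < d" for i using treeD(5)[OF tr that] .
  show "\<exists>p j. par e = int p \<and> via e = int j \<and> p < e \<and> p \<le> Suc h \<and> legal \<sigma> lay p j \<and>
      child Z lay p j e \<and> (\<forall>i<d. \<bar>Z (e * d + i)\<bar> \<le> K) \<and> val e = val p + c j"
    if e: "0 < e" "e < L" for e
    using tree_entry[OF tr e] le_SucI by blast
  show "lay e \<le> lay e'" "\<not> same Z lay e e'" if "e < e'" "e' < L" for e e'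
    using tree_mono[OF tr that] tree_distinct[OF tr that] by auto
  show "lay e \<le> lay e' + 1" if "e < L" "Suc h \<le> e'" "e' < L" for e e'
    using that by (intro tree_top[OF tr]) auto
  show "\<exists>e'<L. child Z lay e j e' \<and> val e + c j \<le> val e'"
    if "e < L" "e < Suc h \<or> e = Suc h \<and> j < 0" "legal \<sigma> lay e j"
      "\<forall>i<d. \<bar>Z (e * d + i) + w i j\<bar> \<le> K" for e j
    using that by (intro tree_done[OF tr]) (auto simp: legal_def)
qed

text \<open>Allows the slot behind the last entry to be used as scratch space.\<close>

lemma tree_cong:
  assumes "tree \<sigma> L h m Z lay val par via"
    and "\<And>e i. e < L \<Longrightarrow> i < d \<Longrightarrow> Z' (e * d + i) = Z (e * d + i)"
    and "\<And>e. e < L \<Longrightarrow> lay' e = lay e" "\<And>e. e < L \<Longrightarrow> val' e = val e"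
    and "\<And>e. e < L \<Longrightarrow> par' e = par e" "\<And>e. e < L \<Longrightarrow> via' e = via e"
  shows "tree \<sigma> L h m Z' lay' val' par' via'"
  unfolding tree_def
proof (intro conjI allI impI; (elim conjE)?)
  note tr = assms(1) and cong = assms(2-)
  have L: "0 < L" using treeD(1)[OF tr] .
  have child: "child Z' lay' e j e' \<longleftrightarrow> child Z lay e j e'" if "e < L" "e' < L" for e j e'
    using that by (simp add: child_def cong)
  have legal: "legal \<sigma> lay' e j \<longleftrightarrow> legal \<sigma> lay e j" if "e < L" for e j
    using that by (simp add: legal_def cong)
  show "0 < L" "h \<le> L" using treeD[OF tr] by auto
  show "lay' 0 = 0" "val' 0 = 0" using treeD[OF tr] cong L by auto
  show "Z' i = 0" if "i < d" for i using cong(1)[OF L that] treeD(5)[OF tr that] by simp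
  show "\<exists>p j. par' e = int p \<and> via' e = int j \<and> p < e \<and> p \<le> h \<and> legal \<sigma> lay' p j \<and>
      child Z' lay' p j e \<and> (\<forall>i<d. \<bar>Z' (e * d + i)\<bar> \<le> K) \<and> val' e = val' p + c j"
    if e: "0 < e" "e < L" for e
  proof -
    obtain p j where *: "par e = int p \<and> via e = int j \<and> p < e \<and> p \<le> h \<and> legal \<sigma> lay p j \<and>
      child Z lay p j e \<and> (\<forall>i<d. \<bar>Z (e * d + i)\<bar> \<le> K) \<and> val e = val p + c j"
      using tree_entry[OF tr e] by blast
    then have p: "p < L" using e by simp
    show ?thesis
      using * e p child[OF p e(2)] legal[OF p] cong by (intro exI[of _ p] exI[of _ j]) simp
  qed
  show "lay' e \<le> lay' e'" "\<not> same Z' lay' e e'" if "e < e'" "e' < L" for e e'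
    using tree_mono[OF tr that] tree_distinct[OF tr that] that cong by (auto simp: same_def)
  show "lay' e \<le> lay' e' + 1" if "e < L" "h \<le> e'" "e' < L" for e e'
    using tree_top[OF tr that] that cong by simp
  show "\<exists>e'<L. child Z' lay' e j e' \<and> val' e + c j \<le> val' e'"
    if "e < L" "e < h \<or> e = h \<and> j < m" "legal \<sigma> lay' e j"
      "\<forall>i<d. \<bar>Z' (e * d + i) + w i j\<bar> \<le> K" for e j
  proof -
    have "\<exists>e'<L. child Z lay e j e' \<and> val e + c j \<le> val e'"
      using that legal cong by (intro tree_done[OF tr]) auto
    then show ?thesis using child[OF that(1)] cong that(1) by auto
  qed
qed

text \<open>No existing layer exceeds \<open>lay h + 1\<close>, the layer of the new entry, so
  appending keeps the list sorted by layer.\<close>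

lemma tree_insert:
  assumes tr: "tree \<sigma> L h m Z lay val par via" and h: "h < L" and legal: "legal \<sigma> lay h m"
    and child: "child Z lay h m L" and box: "\<And>i. i < d \<Longrightarrow> \<bar>Z (L * d + i)\<bar> \<le> K"
    and new: "\<And>e. e < L \<Longrightarrow> \<not> same Z lay e L"
    and slot: "val L = val h + c m" "par L = int h" "via L = int m"
  shows "tree \<sigma> (Suc L) h (Suc m) Z lay val par via"
  unfolding tree_def
proof (intro conjI allI impI; (elim conjE)?)
  show "0 < Suc L" "h \<le> Suc L" using h by auto
  show "lay 0 = 0" "val 0 = 0" using treeD[OF tr] by auto
  show "Z i = 0" if "i < d" for i using treeD(5)[OF tr that] .
  have lay_L: "lay L = lay h + 1" using child by (simp add: child_def)
  show "\<exists>p j. par e = int p \<and> via e = int j \<and> p < e \<and> p \<le> h \<and> legal \<sigma> lay p j \<and>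
      child Z lay p j e \<and> (\<forall>i<d. \<bar>Z (e * d + i)\<bar> \<le> K) \<and> val e = val p + c j"
    if e: "0 < e" "e < Suc L" for e
  proof (cases "e = L")
    case True
    then show ?thesis using h legal child box slot by (intro exI[of _ h] exI[of _ m]) simp
  next
    case False
    then have "e < L" using e by simp
    then show ?thesis using tree_entry[OF tr e(1)] by blast
  qed
  have top: "lay e \<le> lay L" if "e < L" for e using tree_top[OF tr that order_refl h] lay_L by simp
  show "lay e \<le> lay e'" "\<not> same Z lay e e'" if "e < e'" "e' < Suc L" for e e'
  proof -
    have "lay e \<le> lay e' \<and> \<not> same Z lay e e'"
    proof (cases "e' = L")
      case True
      then show ?thesis using top new that(1) by simp
    next
      case False
      then have "e' < L" using that by simp
      then show ?thesis using tree_mono[OF tr that(1)] tree_distinct[OF tr that(1)] by blast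
    qed
    then show "lay e \<le> lay e'" "\<not> same Z lay e e'" by auto
  qed
  show "lay e \<le> lay e' + 1" if "e < Suc L" "h \<le> e'" "e' < Suc L" for e e'
  proof -
    have "lay h \<le> lay e'"
    proof (cases "h = e' \<or> e' = L")
      case True
      then show ?thesis using lay_L by auto
    next
      case False
      then have "h < e'" "e' < L" using that by auto
      then show ?thesis by (rule tree_mono[OF tr])
    qed
    moreover have "lay e \<le> lay h + 1" using top that lay_L by (cases "e = L") auto
    ultimately show ?thesis by simp
  qed
  show "\<exists>e'<Suc L. child Z lay e j e' \<and> val e + c j \<le> val e'"
    if e: "e < Suc L" "e < h \<or> e = h \<and> j < Suc m" "legal \<sigma> lay e j"
      "\<forall>i<d. \<bar>Z (e * d + i) + w i j\<bar> \<le> K" for e j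
  proof (cases "e = h \<and> j = m")
    case True
    then show ?thesis using child slot by (intro exI[of _ L]) simp
  next
    case False
    then have "\<exists>e'<L. child Z lay e j e' \<and> val e + c j \<le> val e'"
      using e h by (intro tree_done[OF tr]) auto
    then show ?thesis by (meson less_SucI)
  qed
qed

text \<open>Entry \<open>e0\<close> is one layer above \<open>h\<close> and therefore behind
  \<open>h\<close> in the list. No recorded predecessor lies behind \<open>h\<close>, so raising
  \<open>val e0\<close> invalidates no equation \<open>val e = val p + c j\<close> of another
  entry.\<close>

lemma tree_improve:
  assumes tr: "tree \<sigma> L h m Z lay val par via" and h: "h < L" and legal: "legal \<sigma> lay h m"
    and e0: "e0 < L" and child: "child Z lay h m e0" and better: "val e0 < val h + c m"
  shows "tree \<sigma> L h (Suc m) Z lay (val(e0 := val h + c m)) (par(e0 := int h)) (via(e0 := int m))"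
    (is "tree \<sigma> L h (Suc m) Z lay ?val ?par ?via")
  unfolding tree_def
proof (intro conjI allI impI; (elim conjE)?)
  have lay_e0: "lay e0 = lay h + 1" using child by (simp add: child_def)
  have e0_gt: "h < e0"
    using tree_mono[OF tr, of e0 h] h lay_e0 by (cases e0 h rule: linorder_cases) auto
  show "0 < L" "h \<le> L" using treeD[OF tr] by auto
  show "lay 0 = 0" "?val 0 = 0" using treeD[OF tr] e0_gt by auto
  show "Z i = 0" if "i < d" for i using treeD(5)[OF tr that] .
  show "\<exists>p j. ?par e = int p \<and> ?via e = int j \<and> p < e \<and> p \<le> h \<and> legal \<sigma> lay p j \<and>
      child Z lay p j e \<and> (\<forall>i<d. \<bar>Z (e * d + i)\<bar> \<le> K) \<and> ?val e = ?val p + c j"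
    if e: "0 < e" "e < L" for e
  proof (cases "e = e0")
    case True
    then show ?thesis using tree_entry[OF tr e] e0_gt legal child
      by (intro exI[of _ h] exI[of _ m]) auto
  next
    case False
    obtain p j where p: "par e = int p" "via e = int j" "p < e" "p \<le> h" "legal \<sigma> lay p j"
      "child Z lay p j e" "\<forall>i<d. \<bar>Z (e * d + i)\<bar> \<le> K" "val e = val p + c j"
      using tree_entry[OF tr e] by blast
    then have "p \<noteq> e0" using e0_gt by simp
    with p False show ?thesis by (intro exI[of _ p] exI[of _ j]) simp
  qed
  show "lay e \<le> lay e'" "\<not> same Z lay e e'" if "e < e'" "e' < L" for e e'
    using tree_mono[OF tr that] tree_distinct[OF tr that] by auto
  show "lay e \<le> lay e' + 1" if "e < L" "h \<le> e'" "e' < L" for e e'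
    using tree_top[OF tr that] .
  show "\<exists>e'<L. child Z lay e j e' \<and> ?val e + c j \<le> ?val e'"
    if e: "e < L" "e < h \<or> e = h \<and> j < Suc m" "legal \<sigma> lay e j"
      "\<forall>i<d. \<bar>Z (e * d + i) + w i j\<bar> \<le> K" for e j
  proof (cases "e = h \<and> j = m")
    case True
    then show ?thesis using child e0 e0_gt by (intro exI[of _ e0]) simp
  next
    case False
    then obtain e' where e': "e' < L" "child Z lay e j e'" "val e + c j \<le> val e'"
      using e h tree_done[OF tr, of e j] by (auto simp: less_Suc_eq)
    have "e \<noteq> e0" using e e0_gt by auto
    then show ?thesis using e' better by (intro exI[of _ e']) auto
  qed
qed

section \<open>Counting the entries\<close>

lemma tree_layer:
  assumes tr: "tree \<sigma> L h m Z lay val par via" and "e < L"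
  shows "\<exists>k\<le>t. lay e = int k"
proof (cases "e = 0")
  case True
  then show ?thesis using treeD(3)[OF tr] by auto
next
  case False
  then obtain p j where "legal \<sigma> lay p j" "child Z lay p j e"
    using tree_entry[OF tr] assms(2) by blast
  then obtain k where "k < t" "lay e = int k + 1" by (auto simp: legal_def child_def)
  then show ?thesis by (intro exI[of _ "Suc k"]) auto
qed

text \<open>Every pick raises the layer by one and adds \<open>w i j\<close>, which is congruent to
  \<open>- b i\<close> modulo \<open>t + 1\<close>.\<close>

lemma tree_congruent:
  assumes tr: "tree \<sigma> L h m Z lay val par via" and "e < L" "i < d"
  shows "int (t + 1) dvd Z (e * d + i) + lay e * b i"
  using assms(2)
proof (induction e rule: less_induct)
  case (less e)
  show ?case
  proof (cases "e = 0")
    case True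
    then show ?thesis using treeD(3,5)[OF tr] assms(3) by simp
  next
    case False
    then obtain p j where p: "p < e" "child Z lay p j e"
      using tree_entry[OF tr] less.prems by blast
    then have eq: "Z (e * d + i) + lay e * b i =
        (Z (p * d + i) + lay p * b i) + int (t + 1) * A i j"
      using assms(3) by (simp add: child_def w_def algebra_simps)
    have "int (t + 1) dvd Z (p * d + i) + lay p * b i" using less.IH[OF p(1)] p less.prems by simp
    then show ?thesis unfolding eq by simp
  qed
qed

lemma tree_box:
  assumes tr: "tree \<sigma> L h m Z lay val par via" and "e < L" "i < d"
  shows "\<bar>Z (e * d + i)\<bar> \<le> K"
proof (cases "e = 0")
  case True
  then show ?thesis using treeD(5)[OF tr assms(3)] K_nonneg by simp
next
  case False
  then show ?thesis using tree_entry[OF tr] assms by blast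
qed

definition max_entries :: nat where "max_entries = (t + 1) * (2 * R + 1) ^ d"

text \<open>Entries differ in layer or point, and per layer each coordinate has at most
  \<open>2 * R + 1\<close> values. Since the bound follows from the invariant alone, it also limits
  the number of rounds of the search.\<close>

lemma tree_size:
  assumes tr: "tree \<sigma> L h m Z lay val par via"
  shows "L \<le> max_entries"
proof -
  define S where "S k i = {z. \<bar>z\<bar> \<le> int R * int (t + 1) \<and> int (t + 1) dvd z + int k * b i}" for k i
  define B where "B = (SIGMA k:{..t}. \<Pi>\<^sub>E i\<in>{..<d}. S k i)"
  define F where "F e = (nat (lay e), \<lambda>i\<in>{..<d}. Z (e * d + i))" for e
  have S: "card (S k i) \<le> 2 * R + 1" "finite (S k i)" for k i
    using card_scaled_box[of "int (t + 1)" R "int k * b i"] by (simp_all add: S_def)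
  have "F ` {..<L} \<subseteq> B"
  proof (rule image_subsetI)
    fix e assume "e \<in> {..<L}"
    then have "e < L" by simp
    then obtain k where k: "k \<le> t" "lay e = int k" using tree_layer[OF tr] by blast
    have "Z (e * d + i) \<in> S k i" if "i < d" for i
      using tree_box[OF tr \<open>e < L\<close> that] tree_congruent[OF tr \<open>e < L\<close> that] k
      by (simp add: S_def K_def)
    then show "F e \<in> B" using k by (auto simp: B_def F_def)
  qed
  moreover have "inj_on F {..<L}"
  proof (rule inj_onI, rule ccontr)
    fix e e' assume e: "e \<in> {..<L}" "e' \<in> {..<L}" and eq: "F e = F e'" and "e \<noteq> e'"
    have "nat (lay e) = nat (lay e')" using eq by (simp add: F_def)
    moreover obtain k k' where "lay e = int k" "lay e' = int k'"
      using tree_layer[OF tr] e by (metis lessThan_iff)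
    ultimately have "lay e = lay e'" by simp
    moreover have "Z (e * d + i) = Z (e' * d + i)" if "i < d" for i
    proof -
      have "(\<lambda>i\<in>{..<d}. Z (e * d + i)) = (\<lambda>i\<in>{..<d}. Z (e' * d + i))"
        using eq by (simp add: F_def)
      from fun_cong[OF this, of i] show ?thesis using that by simp
    qed
    ultimately have "same Z lay e e'" "same Z lay e' e" by (simp_all add: same_def)
    then show False using tree_distinct[OF tr] e \<open>e \<noteq> e'\<close> by (metis lessThan_iff linorder_neqE_nat)
  qed
  moreover have "finite B" unfolding B_def using S by (intro finite_SigmaI finite_PiE) auto
  ultimately have "L \<le> card B" using card_inj_on_le[of F "{..<L}" B] by simp
  also have "card B = (\<Sum>k\<le>t. \<Prod>i<d. card (S k i))"
    unfolding B_def using S by (subst card_SigmaI) (auto intro!: finite_PiE simp: card_PiE)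
  also have "\<dots> \<le> (\<Sum>k\<le>t. \<Prod>i<d. 2 * R + 1)"
    using S by (intro sum_mono prod_mono) auto
  also have "\<dots> = max_entries" by (simp add: max_entries_def)
  finally show ?thesis .
qed

section \<open>Reading off an optimal solution\<close>

lemma tree_complete:
  assumes tr: "tree \<sigma> L L 0 Z lay val par via" and js: "path \<sigma> js"
    and box: "\<And>k i. k \<le> length js \<Longrightarrow> i < d \<Longrightarrow> \<bar>\<Sum>j\<leftarrow>take k js. w i j\<bar> \<le> K"
  shows "\<exists>e<L. lay e = int (length js) \<and> (\<forall>i<d. Z (e * d + i) = (\<Sum>j\<leftarrow>js. w i j)) \<and>
    (\<Sum>j\<leftarrow>js. c j) \<le> val e"
  using js box
proof (induction js rule: rev_induct)
  case Nil
  then show ?case using treeD[OF tr] by (intro exI[of _ 0]) simp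
next
  case (snoc j js)
  have js: "path \<sigma> js" "length js < t" "j < n" "lab j = \<sigma> (length js)"
    using snoc.prems(1) by (simp_all add: path_snoc)
  have "\<bar>\<Sum>j\<leftarrow>take k js. w i j\<bar> \<le> K" if "k \<le> length js" "i < d" for k i
    using snoc.prems(2)[of k i] that by simp
  from snoc.IH[OF js(1) this] obtain e where e: "e < L" "lay e = int (length js)"
    "\<forall>i<d. Z (e * d + i) = (\<Sum>j\<leftarrow>js. w i j)" "(\<Sum>j\<leftarrow>js. c j) \<le> val e" by blast
  have "legal \<sigma> lay e j" using js e(2) by (auto simp: legal_def)
  moreover have "\<bar>Z (e * d + i) + w i j\<bar> \<le> K" if "i < d" for i
    using snoc.prems(2)[of "length (js @ [j])" i] e(3) that by simp
  \<comment> \<open>The entry may owe its value to another path to the same point, so only an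
    inequality between values is maintained.\<close>
  ultimately obtain e' where e': "e' < L" "child Z lay e j e'" "val e + c j \<le> val e'"
    using tree_done[OF tr e(1)] e(1) by blast
  then show ?case using e by (intro exI[of _ e']) (auto simp: child_def)
qed

text \<open>Following predecessors yields the picks in reverse. As a relation on the two arrays
  alone, it lets backtracking be verified without the search invariant.\<close>

inductive branch :: "(nat \<Rightarrow> int) \<Rightarrow> (nat \<Rightarrow> int) \<Rightarrow> nat \<Rightarrow> nat list \<Rightarrow> bool"
  for par via where
  root: "branch par via 0 []"
| step: "branch par via p js \<Longrightarrow> 0 < e \<Longrightarrow> par e = int p \<Longrightarrow> via e = int j \<Longrightarrow>
    branch par via e (js @ [j])"

lemma tree_branch:
  assumes tr: "tree \<sigma> L h m Z lay val par via" and "e < L"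
  obtains js where "branch par via e js" "path \<sigma> js" "lay e = int (length js)"
    "\<And>i. i < d \<Longrightarrow> Z (e * d + i) = (\<Sum>j\<leftarrow>js. w i j)" "val e = (\<Sum>j\<leftarrow>js. c j)"
proof -
  have "\<exists>js. branch par via e js \<and> path \<sigma> js \<and> lay e = int (length js) \<and>
      (\<forall>i<d. Z (e * d + i) = (\<Sum>j\<leftarrow>js. w i j)) \<and> val e = (\<Sum>j\<leftarrow>js. c j)"
    using assms(2)
  proof (induction e rule: less_induct)
    case (less e)
    show ?case
    proof (cases "e = 0")
      case True
      then show ?thesis
        using treeD[OF tr] by (intro exI[of _ "[]"]) (auto intro: branch.root path_Nil)
    next
      case False
      then obtain p j where p: "par e = int p" "via e = int j" "p < e" "legal \<sigma> lay p j"
        "child Z lay p j e" "val e = val p + c j"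
        using tree_entry[OF tr] less.prems by blast
      then obtain js where "branch par via p js" "path \<sigma> js" "lay p = int (length js)"
        "\<forall>i<d. Z (p * d + i) = (\<Sum>j\<leftarrow>js. w i j)" "val p = (\<Sum>j\<leftarrow>js. c j)"
        using less.IH[OF p(3)] less.prems by auto
      with p False show ?thesis
        by (intro exI[of _ "js @ [j]"])
          (auto simp: path_snoc legal_def child_def intro: branch.step)
    qed
  qed
  then show ?thesis using that by blast
qed

text \<open>The target is \<open>b\<close> and not 0, because \<open>t\<close> picks of a solution
  have the scaled sum \<open>(t + 1) * b - t * b\<close>.\<close>

definition goal :: "(nat \<Rightarrow> int) \<Rightarrow> (nat \<Rightarrow> int) \<Rightarrow> nat \<Rightarrow> bool" where
  "goal Z lay e \<longleftrightarrow> lay e = int t \<and> (\<forall>i<d. Z (e * d + i) = b i)"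

lemma tree_goal_upper:
  assumes "balanced \<sigma> t" "tree \<sigma> L L 0 Z lay val par via" "feas x"
  shows "\<exists>e<L. goal Z lay e \<and> (\<Sum>j<n. c j * x j) \<le> val e"
proof -
  obtain js where "path \<sigma> js" "length js = t"
    "\<And>k i. k \<le> t \<Longrightarrow> i < d \<Longrightarrow> \<bar>\<Sum>j\<leftarrow>take k js. w i j\<bar> \<le> K"
    "\<And>i. i < d \<Longrightarrow> (\<Sum>j\<leftarrow>js. w i j) = b i" "(\<Sum>j\<leftarrow>js. c j) = (\<Sum>j<n. c j * x j)"
    by (rule path_of_feasible[OF assms(1,3)], rule that)
  then show ?thesis using tree_complete[OF assms(2), of js] by (auto simp: goal_def)
qed

text \<open>Layer and point determine a goal, and no two entries agree in both, so there is at most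
  one goal entry. Its value dominates every feasible objective by \<open>tree_goal_upper\<close>,
  and the picks on its branch attain it.\<close>

lemma tree_goal:
  assumes bal: "balanced \<sigma> t" and tr: "tree \<sigma> L L 0 Z lay val par via"
    and e: "e < L" "goal Z lay e"
  obtains js where "branch par via e js" "length js = t" "set js \<subseteq> {..<n}"
    "feas (\<lambda>j. int (count_list js j))"
    "\<And>y. feas y \<Longrightarrow> (\<Sum>j<n. c j * y j) \<le> (\<Sum>j<n. c j * int (count_list js j))"
proof -
  obtain js where js: "branch par via e js" "path \<sigma> js" "lay e = int (length js)"
    "\<And>i. i < d \<Longrightarrow> Z (e * d + i) = (\<Sum>j\<leftarrow>js. w i j)" "val e = (\<Sum>j\<leftarrow>js. c j)"
    by (rule tree_branch[OF tr e(1)], rule that)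
  have len: "length js = t" and target: "\<And>i. i < d \<Longrightarrow> (\<Sum>j\<leftarrow>js. w i j) = b i"
    using js e(2) by (auto simp: goal_def)
  have sub: "set js \<subseteq> {..<n}" using js(2) by (auto simp: path_def in_set_conv_nth)
  have "(\<Sum>j<n. c j * y j) \<le> (\<Sum>j<n. c j * int (count_list js j))" if y: "feas y" for y
  proof -
    obtain e' where e': "e' < L" "goal Z lay e'" "(\<Sum>j<n. c j * y j) \<le> val e'"
      using tree_goal_upper[OF bal tr y] by blast
    have "same Z lay e e'" "same Z lay e' e" using e e' by (auto simp: goal_def same_def)
    then have "e' = e" using tree_distinct[OF tr] e(1) e'(1) by (metis linorder_neqE_nat)
    then show ?thesis
      using e'(3) js(5) feasible_of_path(2)[OF bal js(2) len target] by simp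
  qed
  then show ?thesis
    using that[OF js(1) len sub feasible_of_path(1)[OF bal js(2) len target]] by blast
qed

end

section \<open>The program\<close>

text \<open>
  Registers: 5 holds \<open>t\<close>, 6 the bound \<open>K\<close>, 7 the number of entries, 8 the entry being expanded,
  9 a column, 10 a row, 11 a flag, 12 the result of a search, 13 to 18 intermediate results.
  Arrays: 5 is the solution, 6 to 10 are \<open>Z\<close>, \<open>lay\<close>, \<open>val\<close>, \<open>par\<close>, \<open>via\<close>,
  11 the lag of every class, 12 the schedule.
\<close>

definition set_if_distinct :: "int \<Rightarrow> aexp \<Rightarrow> aexp \<Rightarrow> com" where
  "set_if_distinct v e f =
    IfLess e f (Assign 11 (Const v)) (IfLess f e (Assign 11 (Const v)) Skip)"

definition compare :: com where
  "compare = For 10 (Reg 1)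
    (set_if_distinct 1 (Read 6 (Plus (Reg 15) (Reg 10))) (Read 6 (Plus (Reg 16) (Reg 10))))"

definition probe :: com where
  "probe =
    Seq (Assign 11 (Const 0))
    (Seq (set_if_distinct 1 (Read 7 (Reg 12)) (Read 7 (Reg 7)))
    (Seq (Mul 15 13 (Reg 1) (Reg 7))
    (Seq (Mul 16 13 (Reg 1) (Reg 12))
    (Seq compare
    (IfLess (Const 0) (Reg 11) (Assign 12 (Plus (Reg 12) (Const 1))) Skip)))))"

text \<open>
  The entry searched for is placed in the slot behind the last entry, where it also serves as the
  sentinel.
\<close>

definition search :: com where
  "search =
    Seq (Assign 12 (Const 0))
    (Seq (Assign 11 (Const 1))
    (WhileLess (Const 0) (Reg 11) probe))"

text \<open>The candidate is written into the slot behind the list whether or not it is admissible;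
  register 11 decides afterwards if it is entered.\<close>

definition fill :: com where
  "fill =
    (let z = Read 6 (Plus (Reg 15) (Reg 10)) in
    Seq (Mul 17 13 (Reg 10) (Reg 0))
    (Seq (Assign 14 (Plus (Reg 5) (Const 1)))
    (Seq (Mul 18 13 (Reg 14) (Read 0 (Plus (Reg 17) (Reg 9))))
    (Seq (Write 6 (Plus (Reg 15) (Reg 10))
      (Minus (Plus (Read 6 (Plus (Reg 16) (Reg 10))) (Reg 18)) (Read 1 (Reg 10))))
    (Seq (IfLess (Reg 6) z (Assign 11 (Const 0)) Skip)
    (IfLess z (Minus (Const 0) (Reg 6)) (Assign 11 (Const 0)) Skip))))))"

definition update :: com where
  "update =
    Seq (Write 8 (Reg 12) (Plus (Read 8 (Reg 8)) (Read 2 (Reg 9))))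
    (Seq (Write 9 (Reg 12) (Reg 8))
    (Write 10 (Reg 12) (Reg 9)))"

definition enter :: com where
  "enter =
    Seq (Write 7 (Reg 7) (Plus (Read 7 (Reg 8)) (Const 1)))
    (Seq search
    (IfLess (Reg 12) (Reg 7)
      (IfLess (Read 8 (Reg 12)) (Plus (Read 8 (Reg 8)) (Read 2 (Reg 9))) update Skip)
      (Seq update (Assign 7 (Plus (Reg 7) (Const 1))))))"

definition expand :: com where
  "expand =
    Seq (Assign 11 (Const 1))
    (Seq (set_if_distinct 0 (Read 3 (Reg 9)) (Read 12 (Read 7 (Reg 8))))
    (Seq (Mul 15 13 (Reg 1) (Reg 7))
    (Seq (Mul 16 13 (Reg 1) (Reg 8))
    (Seq (For 10 (Reg 1) fill)
    (IfLess (Const 0) (Reg 11) enter Skip)))))"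

definition explore :: com where
  "explore =
    Seq (Assign 7 (Const 1))
    (Seq (Assign 8 (Const 0))
    (WhileLess (Reg 8) (Reg 7)
      (Seq (For 9 (Reg 0) expand) (Assign 8 (Plus (Reg 8) (Const 1))))))"

definition total :: com where
  "total = For 10 (Reg 3) (Assign 5 (Plus (Reg 5) (Read 4 (Reg 10))))"

definition advance :: com where
  "advance =
    Seq (Write 11 (Reg 10) (Plus (Read 11 (Reg 10)) (Read 4 (Reg 10))))
    (IfLess (Const 0) (Read 11 (Reg 10)) (Assign 12 (Reg 10)) Skip)"

text \<open>Array 11 holds \<open>k * tp q - t * occ \<sigma> q k\<close>, kept up to date by
  additions only: every class gains \<open>tp q\<close>, and a class that is then positive is picked
  and loses \<open>t\<close>. The final \<open>- 1\<close> differs from every class number, so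
  entries in layer \<open>t\<close> have no successors.\<close>

definition schedule :: com where
  "schedule =
    Seq (For 8 (Reg 5)
      (Seq (For 10 (Reg 3) advance)
      (Seq (Write 11 (Reg 12) (Minus (Read 11 (Reg 12)) (Reg 5)))
      (Write 12 (Reg 8) (Reg 12)))))
    (Write 12 (Reg 5) (Const (- 1)))"

definition radius :: com where
  "radius =
    Seq (Assign 14 (Plus (Plus (Reg 1) (Reg 1)) (Plus (Reg 3) (Const 1))))
    (Seq (Mul 15 13 (Reg 14) (Reg 2))
    (Seq (Mul 16 13 (Reg 3) (Reg 15))
    (Seq (Assign 14 (Plus (Reg 5) (Const 1)))
    (Mul 6 13 (Reg 14) (Reg 16)))))"

definition backtrack :: com where
  "backtrack =
    WhileLess (Const 0) (Reg 12)
      (Seq (Write 5 (Read 10 (Reg 12)) (Plus (Read 5 (Read 10 (Reg 12))) (Const 1)))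
      (Assign 12 (Read 9 (Reg 12))))"

text \<open>The goal itself, layer \<open>t\<close> and point \<open>b\<close>, is put into the slot
  and searched for; hitting only the slot means that no feasible point exists.\<close>

definition finish :: com where
  "finish =
    Seq (Write 7 (Reg 7) (Reg 5))
    (Seq (Mul 15 13 (Reg 1) (Reg 7))
    (Seq (For 10 (Reg 1) (Write 6 (Plus (Reg 15) (Reg 10)) (Read 1 (Reg 10))))
    (Seq search
    (IfLess (Reg 12) (Reg 7) (Seq (Assign 4 (Const 1)) backtrack) Skip))))"

definition solver :: com where
  "solver = Seq total (Seq schedule (Seq radius (Seq explore finish)))"

section \<open>Registers and arrays written by the parts of the program\<close>

lemma written_set_if_distinct [simp]:
  "written_regs (set_if_distinct v e f) = {11}" "written_arrs (set_if_distinct v e f) = {}"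
  by (auto simp: set_if_distinct_def)

lemma wp_set_if_distinct:
  assumes "\<And>T. T \<le> 2 * (acost e + acost f) + 4 \<Longrightarrow>
    Q T (s\<lparr>reg := (reg s)(11 := if aval e s = aval f s then reg s 11 else v)\<rparr>)"
  shows "wp (set_if_distinct v e f) Q s"
  using assms by (auto simp: set_if_distinct_def)

lemma written_compare [simp]: "written_regs compare = {10, 11}" "written_arrs compare = {}"
  by (auto simp: compare_def)

lemma written_probe [simp]:
  "written_regs probe = {10, 11, 12, 13, 15, 16}" "written_arrs probe = {}"
  by (auto simp: probe_def)

lemma written_search [simp]:
  "written_regs search = {10, 11, 12, 13, 15, 16}" "written_arrs search = {}"
  by (auto simp: search_def)

lemma written_fill [simp]:
  "written_regs fill = {11, 13, 14, 17, 18}" "written_arrs fill = {6}"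
  by (auto simp: fill_def Let_def)

lemma written_enter [simp]:
  "written_regs enter = {7, 10, 11, 12, 13, 15, 16}" "written_arrs enter = {7, 8, 9, 10}"
  by (auto simp: enter_def update_def)

lemma written_expand [simp]:
  "written_regs expand = {7, 10, 11, 12, 13, 14, 15, 16, 17, 18}"
  "written_arrs expand = {6, 7, 8, 9, 10}"
  by (auto simp: expand_def)

lemma written_explore [simp]:
  "written_regs explore = {7, 8, 9, 10, 11, 12, 13, 14, 15, 16, 17, 18}"
  "written_arrs explore = {6, 7, 8, 9, 10}"
  by (auto simp: explore_def)

lemma written_total [simp]: "written_regs total = {5, 10}" "written_arrs total = {}"
  by (auto simp: total_def)

lemma written_advance [simp]: "written_regs advance = {12}" "written_arrs advance = {11}"
  by (auto simp: advance_def)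

lemma written_schedule [simp]:
  "written_regs schedule = {8, 10, 12}" "written_arrs schedule = {11, 12}"
  by (auto simp: schedule_def)

lemma written_radius [simp]:
  "written_regs radius = {6, 13, 14, 15, 16}" "written_arrs radius = {}"
  by (auto simp: radius_def)

lemma nat_cell [simp]:
  "nat (int e * int d + int i) = e * d + i" "nat (int d * int e + int i) = e * d + i"
  by (metis nat_int of_nat_add of_nat_mult) (metis mult.commute nat_int of_nat_add of_nat_mult)

declare One_nat_def [simp del]

context problem
begin

text \<open>The common unit of all running times: it exceeds every loop limit and the number of
  entries.\<close>

definition X :: nat where "X = (n + t + 1) * (2 * R + 1) ^ d"

lemma factor_le_R: "2 * d + P + 1 \<le> R"
  using D_pos P_pos mult_le_mono1[of 1 "P * D" "2 * d + P + 1"] by (simp add: R_def)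

text \<open>The slack covers the slot behind the list and the failing test of a search through all
  entries and the slot.\<close>

lemma max_entries_less: "max_entries + 2 < X"
proof -
  have "2 * R + 1 \<le> (2 * R + 1) ^ d" using d_pos by (intro self_le_power) auto
  then have "3 \<le> (2 * R + 1) ^ d" using factor_le_R by linarith
  moreover have "max_entries + n * (2 * R + 1) ^ d = X"
    by (simp add: max_entries_def X_def algebra_simps)
  moreover have "(2 * R + 1) ^ d \<le> n * (2 * R + 1) ^ d" using n_pos by simp
  ultimately show ?thesis by linarith
qed

lemma less_X: "n < X" "d < X" "D < X" "P < X" "t + 1 < X" "2 * d + P + 1 < X"
proof -
  have p: "2 * R + 1 \<le> (2 * R + 1) ^ d" using d_pos by (intro self_le_power) auto
  have "(n + t + 1) * 1 \<le> X" unfolding X_def by (intro mult_le_mono) auto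
  moreover have "1 * (2 * R + 1) \<le> X" unfolding X_def using p by (intro mult_le_mono) auto
  moreover have "D \<le> R"
    using P_pos mult_le_mono[of D "P * D" 1 "2 * d + P + 1"] by (simp add: R_def)
  ultimately show "n < X" "d < X" "D < X" "P < X" "t + 1 < X" "2 * d + P + 1 < X"
    using factor_le_R n_pos by simp_all
qed

lemma X_pos: "1 \<le> X"
  using less_X(1) by simp

lemma X_le_sq: "X \<le> X * X" and sq_le_cube: "X * X \<le> X * (X * X)"
  using X_pos by simp_all

section \<open>The input cells and their preservation\<close>

definition input_regs :: "(nat \<Rightarrow> int) \<Rightarrow> bool" where
  "input_regs f \<longleftrightarrow> f 0 = int n \<and> f 1 = int d \<and> f 2 = int D \<and> f 3 = int P"

definition input_arrs :: "(nat \<Rightarrow> nat \<Rightarrow> int) \<Rightarrow> bool" where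
  "input_arrs f \<longleftrightarrow> (\<forall>i<d. \<forall>j<n. f 0 (i * n + j) = A i j) \<and> (\<forall>i<d. f 1 i = b i) \<and>
    (\<forall>j<n. f 2 j = c j) \<and> (\<forall>j<n. f 3 j = int (lab j)) \<and> (\<forall>q<P. f 4 q = int (tp q))"

lemma input_regs_upd [simp]: "4 \<le> r \<Longrightarrow> input_regs (f(r := v)) \<longleftrightarrow> input_regs f"
  by (simp add: input_regs_def)

lemma input_arrs_upd [simp]: "5 \<le> a \<Longrightarrow> input_arrs (f(a := v)) \<longleftrightarrow> input_arrs f"
  by (simp add: input_arrs_def)

lemma input_regsD [simp]:
  assumes "input_regs f"
  shows "f 0 = int n" "f 1 = int d" "f 2 = int D" "f 3 = int P"
  using assms by (simp_all add: input_regs_def)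

lemma input_arrsD [simp]:
  assumes "input_arrs f"
  shows "i < d \<Longrightarrow> j < n \<Longrightarrow> f 0 (i * n + j) = A i j" "i < d \<Longrightarrow> f 1 i = b i"
    "j < n \<Longrightarrow> f 2 j = c j" "j < n \<Longrightarrow> f 3 j = int (lab j)" "q < P \<Longrightarrow> f 4 q = int (tp q)"
  using assms by (simp_all add: input_arrs_def)

lemma unchanged_input_regs:
  assumes "unchanged p s s'" "input_regs (reg s)" "written_regs p \<inter> {0, 1, 2, 3} = {}"
  shows "input_regs (reg s')"
  using assms unchanged_reg[OF assms(1)] unfolding input_regs_def by auto

lemma unchanged_input_arrs:
  assumes "unchanged p s s'" "input_arrs (arr s)" "written_arrs p \<inter> {0, 1, 2, 3, 4} = {}"
  shows "input_arrs (arr s')"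
proof -
  have "\<And>a. a \<in> {0, 1, 2, 3, 4} \<Longrightarrow> arr s' a = arr s a"
    using unchanged_arr[OF assms(1)] assms(3) by blast
  then show ?thesis using assms(2) unfolding input_arrs_def by simp
qed

section \<open>Correctness and cost of the parts of the program\<close>

lemma wp_compare:
  assumes regs: "reg s 1 = int d" "reg s 15 = int (L * d)" "reg s 16 = int (e * d)"
    and flag: "reg s 11 = (if arr s 7 e = arr s 7 L then 0 else 1)"
    and exit: "\<And>T s'. unchanged compare s s' \<Longrightarrow> T \<le> 29 * X \<Longrightarrow>
      reg s' 11 = (if same (arr s 6) (arr s 7) e L then 0 else 1) \<Longrightarrow> Q T s'"
  shows "wp compare Q s"
  unfolding compare_def
proof (rule wp_For[where N = d and X = X and B = 20 and
      I = "\<lambda>k s'. reg s' 11 = (if arr s 7 e = arr s 7 L \<and>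
        (\<forall>i<k. arr s 6 (e * d + i) = arr s 6 (L * d + i)) then 0 else 1)"])
  note compare = compare_def[symmetric]
  fix s' assume "unchanged (For 10 (Reg 1) (set_if_distinct 1 (Read 6 (Plus (Reg 15) (Reg 10)))
    (Read 6 (Plus (Reg 16) (Reg 10))))) s s'"
  then have u: "unchanged compare s s'" unfolding compare .
  show "aval (Reg 1) s' = int d" using regs unchanged_reg[OF u, of 1] by simp
  {
    fix k assume i: "reg s' 10 = int k" and inv: "reg s' 11 = (if arr s 7 e = arr s 7 L \<and>
        (\<forall>i<k. arr s 6 (e * d + i) = arr s 6 (L * d + i)) then 0 else 1)"
    have *: "nat (reg s' 15 + int k) = L * d + k" "nat (reg s' 16 + int k) = e * d + k"
      "arr s' 6 = arr s 6"
      using regs unchanged_reg[OF u, of 15] unchanged_reg[OF u, of 16] unchanged_arr[OF u, of 6]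
      by simp_all
    show "wp (set_if_distinct 1 (Read 6 (Plus (Reg 15) (Reg 10))) (Read 6 (Plus (Reg 16) (Reg 10))))
        (\<lambda>T s''. T \<le> 20 \<and> reg (s''\<lparr>reg := (reg s'')(10 := int k + 1)\<rparr>) 11 =
          (if arr s 7 e = arr s 7 L \<and>
            (\<forall>i<Suc k. arr s 6 (e * d + i) = arr s 6 (L * d + i)) then 0 else 1)) s'"
      by (rule wp_set_if_distinct) (auto simp: * i inv less_Suc_eq)
  }
  {
    fix T assume "T \<le> X * (20 + acost (Reg 1) + 8)" and
      "reg s' 11 = (if arr s 7 e = arr s 7 L \<and>
        (\<forall>i<d. arr s 6 (e * d + i) = arr s 6 (L * d + i)) then 0 else 1)"
    then show "Q T s'" using exit[OF u] by (simp add: same_def)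
  }
qed (use less_X flag in auto)

lemma wp_probe:
  assumes inp: "reg s 1 = int d" and L: "reg s 7 = int L" and e: "reg s 12 = int e"
    and exit: "\<And>T s'. unchanged probe s s' \<Longrightarrow> T \<le> 90 * X \<Longrightarrow>
      (if same (arr s 6) (arr s 7) e L then reg s' 11 = 0 \<and> reg s' 12 = int e
       else reg s' 11 = 1 \<and> reg s' 12 = int (Suc e)) \<Longrightarrow> Q T s'"
  shows "wp probe Q s"
proof (rule wp_mono)
  show "wp probe (\<lambda>T s'. T \<le> 90 * X \<and>
      (if same (arr s 6) (arr s 7) e L then reg s' 11 = 0 \<and> reg s' 12 = int e
       else reg s' 11 = 1 \<and> reg s' 12 = int (Suc e))) s"
    unfolding probe_def wp_Seq wp_Assign
    apply (rule wp_set_if_distinct)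
    apply (rule wp_Mul[where N = d and X = X]; (simp add: inp less_X; fail)?)
    apply (rule wp_Mul[where N = d and X = X]; (simp add: inp less_X; fail)?)
    apply (rule wp_compare[where e = e and L = L]; (simp add: inp L e; fail)?)
    subgoal premises prems for T T' T'' s' U
      using prems unchanged_reg[OF prems(4), of 12] X_pos e
      by (auto split: if_splits)
    done
qed (use exit in blast)

lemma wp_search:
  assumes inp: "reg s 1 = int d" and L: "reg s 7 = int L" "Suc L < X"
    and exit: "\<And>T s' e. unchanged search s s' \<Longrightarrow> T \<le> 110 * (X * X) \<Longrightarrow> reg s' 12 = int e \<Longrightarrow>
      e \<le> L \<Longrightarrow> same (arr s 6) (arr s 7) e L \<Longrightarrow>
      (\<And>e'. e' < e \<Longrightarrow> \<not> same (arr s 6) (arr s 7) e' L) \<Longrightarrow> Q T s'"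
  shows "wp search Q s"
proof (rule wp_mono)
  define sm where "sm e \<longleftrightarrow> same (arr s 6) (arr s 7) e L" for e
  have sm_L: "sm L" by (simp add: sm_def same_def)
  show "wp search (\<lambda>T s'. T \<le> 110 * (X * X) \<and>
      (\<exists>e. reg s' 12 = int e \<and> e \<le> L \<and> sm e \<and> (\<forall>e'<e. \<not> sm e'))) s"
    unfolding search_def wp_Seq wp_Assign
  proof (rule wp_WhileLess[where N = "Suc L" and B = "90 * X" and
      I = "\<lambda>k s'. reg s' 11 = 1 \<and> reg s' 12 = int k \<and> k \<le> L \<and> (\<forall>e<k. \<not> sm e) \<or>
        reg s' 11 = 0 \<and> (\<exists>e. reg s' 12 = int e \<and> e \<le> L \<and> sm e \<and> (\<forall>e'<e. \<not> sm e'))"],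
      goal_cases)
    case 1
    then show ?case by simp
  next
    case (2 k s')
    then have k: "reg s' 12 = int k" "k \<le> L" "\<forall>e<k. \<not> sm e" by auto
    have regs: "reg s' 1 = int d" "reg s' 7 = int L"
      using unchanged_reg[OF 2(1), of 1] unchanged_reg[OF 2(1), of 7] inp L by simp_all
    have arrs: "arr s' 6 = arr s 6" "arr s' 7 = arr s 7"
      using unchanged_arr[OF 2(1), of 6] unchanged_arr[OF 2(1), of 7] by simp_all
    \<comment> \<open>The slot agrees with itself, so the search cannot run past it.\<close>
    have "k \<noteq> L" if "\<not> sm k" using sm_L that by auto
    then show ?case
      using k by (intro conjI wp_probe[OF regs k(1)])
        (auto simp: arrs sm_def[symmetric] less_Suc_eq split: if_splits)
  next
    case (3 T k s')
    have "T \<le> X * (90 * X + acost (Const 0) + acost (Reg 11) + 1)"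
      using 3(4) by (rule order_trans) (use L(2) in \<open>intro mult_le_mono; simp\<close>)
    then have "T \<le> 90 * (X * X) + 3 * X" by (simp add: algebra_simps)
    then have "T + 4 \<le> 110 * (X * X)" using X_le_sq X_pos by linarith
    then show ?case using 3(2,3) by auto
  qed
  show "Q T s'" if "unchanged search s s'" "T \<le> 110 * (X * X) \<and>
      (\<exists>e. reg s' 12 = int e \<and> e \<le> L \<and> sm e \<and> (\<forall>e'<e. \<not> sm e'))" for T s'
    using that exit unfolding sm_def by blast
qed

lemma wp_fill:
  assumes inp: "input_regs (reg s)" "input_arrs (arr s)" "reg s 5 = int t" "reg s 6 = K"
    and regs: "reg s 15 = int (L * d)" "reg s 16 = int (h * d)" "reg s 9 = int j" "j < n"
      "reg s 10 = int i" "i < d"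
  defines "z \<equiv> arr s 6 (h * d + i) + w i j"
  assumes exit: "\<And>T s'. unchanged fill s s' \<Longrightarrow> T \<le> 70 * X \<Longrightarrow>
      arr s' 6 = (arr s 6)(L * d + i := z) \<Longrightarrow>
      reg s' 11 = (if \<bar>z\<bar> \<le> K then reg s 11 else 0) \<Longrightarrow> Q T s'"
  shows "wp fill Q s"
proof (rule wp_mono)
  have z: "arr s 6 (h * d + i) + (int t + 1) * A i j - b i = z"
    by (simp add: z_def w_def add.commute)
  show "wp fill (\<lambda>T s'. T \<le> 70 * X \<and> arr s' 6 = (arr s 6)(L * d + i := z) \<and>
      reg s' 11 = (if \<bar>z\<bar> \<le> K then reg s 11 else 0)) s"
    unfolding fill_def wp_Seq Let_def
    apply (rule wp_Mul[where N = i and X = X]; (use less_X regs in \<open>simp; fail\<close>)?)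
    apply (unfold wp_Assign)
    apply (rule wp_Mul[where N = "t + 1" and X = X]; (use inp regs less_X in \<open>simp; fail\<close>)?)
    using inp regs X_pos K_nonneg
    by (auto simp: z)
qed (use exit in blast)

text \<open>A match before the slot leads to \<open>tree_improve\<close> or
  \<open>tree_advance\<close>, depending on the values; if the slot is the first match, it becomes a
  new entry by \<open>tree_insert\<close>.\<close>

lemma wp_enter:
  assumes inp: "input_regs (reg s)" "input_arrs (arr s)"
    and regs: "reg s 7 = int L" "reg s 8 = int h" "reg s 9 = int m" "m < n"
    and tr: "tree \<sigma> L h m (arr s 6) (arr s 7) (arr s 8) (arr s 9) (arr s 10)" and h: "h < L"
    and legal: "legal \<sigma> (arr s 7) h m"
    and slot: "\<And>i. i < d \<Longrightarrow> arr s 6 (L * d + i) = arr s 6 (h * d + i) + w i m"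
      "\<And>i. i < d \<Longrightarrow> \<bar>arr s 6 (L * d + i)\<bar> \<le> K"
  shows "wp enter (\<lambda>T s'. T \<le> 150 * (X * X) \<and> (\<exists>L'>h. reg s' 7 = int L' \<and>
    tree \<sigma> L' h (Suc m) (arr s' 6) (arr s' 7) (arr s' 8) (arr s' 9) (arr s' 10))) s"
proof -
  define lay where "lay = (arr s 7)(L := arr s 7 h + 1)"
  define v where "v = arr s 8 h + c m"
  have L: "Suc L < X" using tree_size[OF tr] max_entries_less by linarith
  have tr': "tree \<sigma> L h m (arr s 6) lay (arr s 8) (arr s 9) (arr s 10)"
    by (rule tree_cong[OF tr]) (simp_all add: lay_def)
  have legal': "legal \<sigma> lay h m" using legal h by (simp add: legal_def lay_def)
  have child_L: "child (arr s 6) lay h m L" using slot(1) h by (simp add: child_def lay_def)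
  define s1 where "s1 = s\<lparr>arr := (arr s)(7 := lay)\<rparr>"
  have "wp search (\<lambda>U. wp (IfLess (Reg 12) (Reg 7)
      (IfLess (Read 8 (Reg 12)) (Plus (Read 8 (Reg 8)) (Read 2 (Reg 9))) update Skip)
      (Seq update (Assign 7 (Plus (Reg 7) (Const 1)))))
      (\<lambda>V s'. 6 + (U + V) \<le> 150 * (X * X) \<and> (\<exists>L'>h. reg s' 7 = int L' \<and>
        tree \<sigma> L' h (Suc m) (arr s' 6) (arr s' 7) (arr s' 8) (arr s' 9) (arr s' 10)))) s1"
  proof (rule wp_search[OF _ _ L])
    show "reg s1 1 = int d" "reg s1 7 = int L" using inp regs by (simp_all add: s1_def)
    fix T s' e
    assume u: "unchanged search s1 s'" and T: "T \<le> 110 * (X * X)" and e: "reg s' 12 = int e" "e \<le> L"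
      and same: "same (arr s1 6) (arr s1 7) e L"
      and first: "\<And>e'. e' < e \<Longrightarrow> \<not> same (arr s1 6) (arr s1 7) e' L"
    have T': "T + 40 \<le> 150 * (X * X)" using T X_pos X_le_sq by linarith
    have child: "child (arr s 6) lay h m e"
      using same child_L by (simp add: s1_def same_def child_def)
    have arrs: "arr s' = (arr s)(7 := lay)"
      using unchanged_arr[OF u] by (simp add: s1_def fun_eq_iff)
    have regs': "reg s' 7 = int L" "reg s' 8 = int h" "reg s' 9 = int m"
      using unchanged_reg[OF u, of 7] unchanged_reg[OF u, of 8] unchanged_reg[OF u, of 9] regs
      by (simp_all add: s1_def)
    have cm: "arr s 2 m = c m" using inp regs by simp
    show "wp (IfLess (Reg 12) (Reg 7)
        (IfLess (Read 8 (Reg 12)) (Plus (Read 8 (Reg 8)) (Read 2 (Reg 9))) update Skip)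
        (Seq update (Assign 7 (Plus (Reg 7) (Const 1)))))
      (\<lambda>V s'. 6 + (T + V) \<le> 150 * (X * X) \<and> (\<exists>L'>h. reg s' 7 = int L' \<and>
        tree \<sigma> L' h (Suc m) (arr s' 6) (arr s' 7) (arr s' 8) (arr s' 9) (arr s' 10))) s'"
    proof (cases "e < L")
      case True
      have better: "tree \<sigma> L h (Suc m) (arr s 6) lay ((arr s 8)(e := v)) ((arr s 9)(e := int h))
          ((arr s 10)(e := int m))" if "arr s 8 e < v"
        using tree_improve[OF tr' h legal' True child] that by (simp add: v_def)
      have keep: "tree \<sigma> L h (Suc m) (arr s 6) lay (arr s 8) (arr s 9) (arr s 10)"
        if "\<not> arr s 8 e < v"
        using that True child by (intro tree_advance[OF tr']) (auto simp: v_def)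
      show ?thesis
        using better keep True T' h by (auto simp: update_def e regs' arrs cm v_def)
    next
      case False
      then have eL: "e = L" using e by simp
      have "tree \<sigma> (Suc L) h (Suc m) (arr s 6) lay ((arr s 8)(L := v)) ((arr s 9)(L := int h))
          ((arr s 10)(L := int m))"
      proof (rule tree_insert[OF _ h legal' child_L])
        show "tree \<sigma> L h m (arr s 6) lay ((arr s 8)(L := v)) ((arr s 9)(L := int h))
            ((arr s 10)(L := int m))"
          by (rule tree_cong[OF tr']) simp_all
        show "\<bar>arr s 6 (L * d + i)\<bar> \<le> K" if "i < d" for i using slot(2)[OF that] .
        show "\<not> same (arr s 6) lay e' L" if "e' < L" for e'
          using first[of e'] that eL by (simp add: s1_def)
        show "((arr s 8)(L := v)) L = ((arr s 8)(L := v)) h + c m" using h by (simp add: v_def)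
      qed simp_all
      then show ?thesis
        using T' h eL by (auto simp: update_def e regs' arrs cm v_def intro!: exI[of _ "Suc L"])
    qed
  qed
  then show ?thesis
    unfolding enter_def wp_Seq wp_Write using regs by (simp add: s1_def lay_def)
qed

lemma wp_fill_row:
  assumes inp: "input_regs (reg s)" "input_arrs (arr s)" "reg s 5 = int t" "reg s 6 = K"
    and regs: "reg s 15 = int (L * d)" "reg s 16 = int (h * d)" "reg s 9 = int j" "j < n" "h < L"
  defines "z \<equiv> \<lambda>i. arr s 6 (h * d + i) + w i j"
  assumes exit: "\<And>T s'. unchanged (For 10 (Reg 1) fill) s s' \<Longrightarrow> T \<le> 80 * (X * X) \<Longrightarrow>
      (\<And>i. i < d \<Longrightarrow> arr s' 6 (L * d + i) = z i) \<Longrightarrow>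
      (\<And>e i. e < L \<Longrightarrow> i < d \<Longrightarrow> arr s' 6 (e * d + i) = arr s 6 (e * d + i)) \<Longrightarrow>
      reg s' 11 = (if \<forall>i<d. \<bar>z i\<bar> \<le> K then reg s 11 else 0) \<Longrightarrow> Q T s'"
  shows "wp (For 10 (Reg 1) fill) Q s"
proof (rule wp_For[where N = d and X = X and B = "70 * X" and
      I = "\<lambda>k s'. (\<forall>i<k. arr s' 6 (L * d + i) = z i) \<and>
        (\<forall>e<L. \<forall>i<d. arr s' 6 (e * d + i) = arr s 6 (e * d + i)) \<and>
        reg s' 11 = (if \<forall>i<k. \<bar>z i\<bar> \<le> K then reg s 11 else 0)"], goal_cases)
  case (3 s')
  then show ?case using inp unchanged_reg[OF 3, of 1] by simp
next
  case (5 k s')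
  have u: "reg s' r = reg s r" if "r \<in> {5, 6, 9, 15, 16}" for r
    using that unchanged_reg[OF 5(2), of r] by auto
  have inp': "input_regs (reg s')" "input_arrs (arr s')"
    using unchanged_input_regs[OF 5(2) inp(1)] unchanged_input_arrs[OF 5(2) inp(2)] by simp_all
  have zk: "arr s 6 (h * d + k) + w k j = z k" by (simp add: z_def)
  have cell: "e * d + i \<noteq> L * d + k" if "e < L" "i < d" for e i
    using that 5(1) cell_eq_iff[of i d k e L] by simp
  show ?case
    by (rule wp_fill[of s' L h j k])
      (use inp inp' regs 5(1,3,4) u in \<open>auto simp: zk cell less_Suc_eq\<close>)
next
  case (6 T s')
  have "T \<le> 70 * (X * X) + 9 * X" using 6(4) by (simp add: algebra_simps)
  then have "T \<le> 80 * (X * X)" using X_le_sq by linarith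
  then show ?case using exit[OF 6(1)] 6(3) by blast
qed (use less_X in auto)

lemma wp_expand:
  assumes inp: "input_regs (reg s)" "input_arrs (arr s)" "reg s 5 = int t" "reg s 6 = K"
    and sched: "\<And>k. k < t \<Longrightarrow> arr s 12 k = int (\<sigma> k)" "arr s 12 t = - 1"
    and regs: "reg s 7 = int L" "reg s 8 = int h" "reg s 9 = int m" "m < n"
    and tr: "tree \<sigma> L h m (arr s 6) (arr s 7) (arr s 8) (arr s 9) (arr s 10)" and h: "h < L"
  shows "wp expand (\<lambda>T s'. T \<le> 300 * (X * X) \<and> (\<exists>L'>h. reg s' 7 = int L' \<and>
    tree \<sigma> L' h (Suc m) (arr s' 6) (arr s' 7) (arr s' 8) (arr s' 9) (arr s' 10))) s"
proof -
  obtain k where k: "k \<le> t" "arr s 7 h = int k" using tree_layer[OF tr h] by blast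
  \<comment> \<open>In layer \<open>t\<close> the schedule holds \<open>- 1\<close>, which no label
    equals, in accordance with \<open>k < t\<close> in \<open>legal\<close>.\<close>
  have legal: "legal \<sigma> (arr s 7) h m \<longleftrightarrow> int (lab m) = arr s 12 (nat (arr s 7 h))"
    using k sched regs(4) by (cases "k = t") (auto simp: legal_def)
  have lab: "arr s 3 m = int (lab m)" using inp regs by simp
  show ?thesis
    unfolding expand_def wp_Seq wp_Assign
    apply (rule wp_set_if_distinct)
    apply (rule wp_Mul[where N = d and X = X]; (use inp less_X in \<open>simp; fail\<close>)?)
    apply (rule wp_Mul[where N = d and X = X]; (use inp less_X in \<open>simp; fail\<close>)?)
    apply (rule wp_fill_row[where L = L and h = h and j = m];
      (use inp less_X regs h in \<open>simp add: mult.commute; fail\<close>)?)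
  proof goal_cases
    case (1 T1 T2 T3 T4 s')
    note u = 1(4)
    define Z where "Z = arr s 6"
    have arrs: "arr s' a = arr s a" if "a \<noteq> 6" for a
      using unchanged_arr[OF u, of a] that by simp
    have regs': "reg s' r = reg s r" if "r \<in> {7, 8, 9}" for r
      using unchanged_reg[OF u, of r] that by auto
    have inp': "input_regs (reg s')" "input_arrs (arr s')"
      using unchanged_input_regs[OF u] unchanged_input_arrs[OF u] inp by simp_all
    have slot: "arr s' 6 (L * d + i) = Z (h * d + i) + w i m" if "i < d" for i
      using 1(6)[OF that] by (simp add: Z_def)
    have old: "arr s' 6 (e * d + i) = Z (e * d + i)" if "e < L" "i < d" for e i
      using 1(7)[OF that] by (simp add: Z_def)
    have flag: "reg s' 11 = (if legal \<sigma> (arr s 7) h m \<and> (\<forall>i<d. \<bar>Z (h * d + i) + w i m\<bar> \<le> K)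
        then 1 else 0)"
      using 1(8) regs lab legal by (auto simp: Z_def)
    have tr': "tree \<sigma> L h m (arr s' 6) (arr s' 7) (arr s' 8) (arr s' 9) (arr s' 10)"
      by (rule tree_cong[OF tr]) (simp_all add: arrs old Z_def)
    have T: "T1 + (T2 + (T3 + T4)) + 20 \<le> 150 * (X * X)"
    proof -
      have "T1 \<le> 16" "T2 \<le> 15 * X" "T3 \<le> 15 * X" using 1(1-3) by simp_all
      then show ?thesis using 1(5) X_le_sq X_pos by linarith
    qed
    show ?case
    proof (cases "legal \<sigma> (arr s 7) h m \<and> (\<forall>i<d. \<bar>Z (h * d + i) + w i m\<bar> \<le> K)")
      case True
      have "wp enter (\<lambda>T s'. T \<le> 150 * (X * X) \<and> (\<exists>L'>h. reg s' 7 = int L' \<and>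
          tree \<sigma> L' h (Suc m) (arr s' 6) (arr s' 7) (arr s' 8) (arr s' 9) (arr s' 10))) s'"
        using True slot old h regs regs' arrs inp'
        by (intro wp_enter[OF _ _ _ _ _ _ tr']) auto
      then have "wp enter (\<lambda>T s'. 2 + (T1 + (T2 + (T3 + (T4 + (3 + T))))) \<le> 300 * (X * X) \<and>
          (\<exists>L'>h. reg s' 7 = int L' \<and>
          tree \<sigma> L' h (Suc m) (arr s' 6) (arr s' 7) (arr s' 8) (arr s' 9) (arr s' 10))) s'"
        by (rule wp_mono) (use T in auto)
      then show ?thesis using True flag by simp
    next
      case False
      have "tree \<sigma> L h (Suc m) (arr s' 6) (arr s' 7) (arr s' 8) (arr s' 9) (arr s' 10)"
        using False old h by (intro tree_advance[OF tr']) (auto simp: arrs)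
      then show ?thesis using False flag T h regs regs' by auto
    qed
  qed
qed

text \<open>The fourth power arises from fewer than \<open>X\<close> entries, fewer than
  \<open>X\<close> columns for each, and a linear search of quadratic cost per column.\<close>

lemma wp_explore:
  assumes inp: "input_regs (reg s)" "input_arrs (arr s)" "reg s 5 = int t" "reg s 6 = K"
    and sched: "\<And>k. k < t \<Longrightarrow> arr s 12 k = int (\<sigma> k)" "arr s 12 t = - 1"
    and init: "\<And>a k. a \<in> {6, 7, 8} \<Longrightarrow> arr s a k = 0"
    and exit: "\<And>T s' L. unchanged explore s s' \<Longrightarrow> T \<le> 400 * (X * (X * (X * X))) \<Longrightarrow>
      reg s' 7 = int L \<Longrightarrow>
      tree \<sigma> L L 0 (arr s' 6) (arr s' 7) (arr s' 8) (arr s' 9) (arr s' 10) \<Longrightarrow> Q T s'"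
  shows "wp explore Q s"
proof (rule wp_mono)
  let ?tree = "\<lambda>L h m s'. reg s' 7 = int L \<and>
    tree \<sigma> L h m (arr s' 6) (arr s' 7) (arr s' 8) (arr s' 9) (arr s' 10)"
  let ?row = "For 9 (Reg 0) expand"
  have row: "wp ?row (\<lambda>T s'. T \<le> 310 * (X * (X * X)) \<and> reg s' 8 = int h \<and>
      (\<exists>L>h. ?tree L h n s')) s'"
    if u: "unchanged (Seq ?row (Assign 8 (Plus (Reg 8) (Const 1)))) s s'"
      "reg s' 8 = int h" "h < L" "?tree L h 0 s'" for s' h L
  proof (rule wp_For[where N = n and X = X and B = "300 * (X * X)" and
        I = "\<lambda>m s'. \<exists>L>h. ?tree L h m s'"], goal_cases)
    case (3 s'')
    have "reg s'' 0 = int n"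
      using inp unchanged_reg[OF 3, of 0] unchanged_reg[OF u(1), of 0] by simp
    then show ?case by simp
  next
    case 4
    then show ?case using u by auto
  next
    case (5 m s'')
    then obtain L' where L': "h < L'" "?tree L' h m s''" by blast
    have uu: "unchanged (Seq ?row (Assign 8 (Plus (Reg 8) (Const 1)))) s s''"
      using u(1) 5(2) by (simp add: unchanged_def)
    have "reg s'' 8 = int h" using u(2) unchanged_reg[OF 5(2), of 8] by simp
    moreover have "reg s'' r = reg s r" if "r \<in> {5, 6}" for r
      using that unchanged_reg[OF uu, of r] by auto
    moreover have "arr s'' 12 = arr s 12" using unchanged_arr[OF uu, of 12] by simp
    moreover have "input_regs (reg s'')" "input_arrs (arr s'')"
      using unchanged_input_regs[OF uu inp(1)] unchanged_input_arrs[OF uu inp(2)] by simp_all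
    ultimately have "wp expand (\<lambda>T s'. T \<le> 300 * (X * X) \<and> (\<exists>L'>h. ?tree L' h (Suc m) s')) s''"
      using L' 5(1,3) inp sched by (intro wp_expand[of _ \<sigma> L']) auto
    then show ?case by simp
  next
    case (6 T s'')
    have "T \<le> 300 * (X * (X * X)) + 9 * X" using 6(4) by (simp add: algebra_simps)
    then have "T \<le> 310 * (X * (X * X))" using X_le_sq sq_le_cube by linarith
    moreover have "reg s'' 8 = int h" using u(2) unchanged_reg[OF 6(1), of 8] by simp
    ultimately show ?case using 6(3) by blast
  qed (use less_X in auto)
  show "wp explore (\<lambda>T s'. T \<le> 400 * (X * (X * (X * X))) \<and> (\<exists>L. ?tree L L 0 s')) s"
    unfolding explore_def wp_Seq wp_Assign
  proof (rule wp_WhileLess[where N = max_entries and B = "310 * (X * (X * X)) + 4" and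
        I = "\<lambda>k s'. reg s' 8 = int k \<and> (\<exists>L. ?tree L k 0 s')"], goal_cases)
    case 1
    show ?case using init by (auto intro!: exI[of _ 1] tree_init)
  next
    case (2 k s')
    then obtain L where L: "reg s' 8 = int k" "k < L" "?tree L k 0 s'" by auto
    have "k < max_entries" using L tree_size[of \<sigma> L k 0] by (metis order_less_le_trans)
    moreover have "wp (Seq ?row (Assign 8 (Plus (Reg 8) (Const 1))))
      (\<lambda>T s''. T \<le> 310 * (X * (X * X)) + 4 \<and> reg s'' 8 = int (Suc k) \<and> (\<exists>L. ?tree L (Suc k) 0 s'')) s'"
      unfolding wp_Seq
    proof (rule wp_mono[OF row[OF _ L]])
      show "unchanged (Seq ?row (Assign 8 (Plus (Reg 8) (Const 1)))) s s'"
        using 2(1) by (auto simp: unchanged_def)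
    qed (auto intro: tree_next)
    ultimately show ?case by blast
  next
    case (3 T k s')
    then obtain L where L: "reg s' 8 = int k" "?tree L k 0 s'" by auto
    moreover have "k \<le> L" using L treeD(2) by blast
    moreover have "\<not> k < L" using 3(3) L by simp
    ultimately have "\<exists>L. ?tree L L 0 s'" by (metis le_neq_implies_less)
    moreover have "T \<le> X * (310 * (X * (X * X)) + 4 + acost (Reg 8) + acost (Reg 7) + 1)"
      using 3(4) by (rule order_trans) (use max_entries_less in \<open>intro mult_le_mono; simp\<close>)
    then have "T \<le> 310 * (X * (X * (X * X))) + 7 * X" by (simp add: algebra_simps)
    then have "4 + T \<le> 400 * (X * (X * (X * X)))"
      using X_pos X_le_sq sq_le_cube mult_le_mono[OF order_refl[of X] sq_le_cube] by linarith
    ultimately show ?case by simp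
  qed
qed (use exit in blast)

lemma wp_total:
  assumes inp: "input_regs (reg s)" "input_arrs (arr s)" "reg s 5 = 0"
  shows "wp total (\<lambda>T s'. T \<le> 14 * X \<and> reg s' 5 = int t) s"
  unfolding total_def
proof (rule wp_For[where N = P and X = X and B = 5 and
      I = "\<lambda>k s'. reg s' 5 = (\<Sum>q<k. int (tp q))"], goal_cases)
  case (3 s')
  then show ?case using inp unchanged_reg[OF 3, of 3] by simp
next
  case (5 k s')
  have "arr s' 4 = arr s 4" using unchanged_arr[OF 5(2), of 4] by simp
  then show ?case using 5 inp by simp
next
  case (6 T s')
  then show ?case by (simp add: int_t)
qed (use less_X inp in auto)

lemma wp_advance_row:
  assumes inp: "input_regs (reg s)" "input_arrs (arr s)"
    and pos: "\<exists>q<P. 0 < arr s 11 q + int (tp q)"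
    and exit: "\<And>T s' p. unchanged (For 10 (Reg 3) advance) s s' \<Longrightarrow> T \<le> 22 * X \<Longrightarrow>
      (\<And>q. q < P \<Longrightarrow> arr s' 11 q = arr s 11 q + int (tp q)) \<Longrightarrow>
      reg s' 12 = int p \<Longrightarrow> p < P \<Longrightarrow> 0 < arr s 11 p + int (tp p) \<Longrightarrow> Q T s'"
  shows "wp (For 10 (Reg 3) advance) Q s"
\<comment> \<open>Register 12 keeps a stale value until a positive class is met, hence the
  implication in the invariant.\<close>
proof (rule wp_For[where N = P and X = X and B = 13 and
      I = "\<lambda>k s'. (\<forall>q<P. arr s' 11 q = arr s 11 q + (if q < k then int (tp q) else 0)) \<and>
        ((\<exists>q<k. 0 < arr s 11 q + int (tp q)) \<longrightarrow>
          (\<exists>q<k. 0 < arr s 11 q + int (tp q) \<and> reg s' 12 = int q))"], goal_cases)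
  case (3 s')
  then show ?case using inp unchanged_reg[OF 3, of 3] by simp
next
  case (5 k s')
  have "arr s' 4 k = int (tp k)" using unchanged_arr[OF 5(2), of 4] inp 5(1) by simp
  then show ?case using 5 by (auto simp: advance_def less_Suc_eq)
next
  case (6 T s')
  from 6(3) pos obtain p where "p < P" "0 < arr s 11 p + int (tp p)" "reg s' 12 = int p" by blast
  then show ?case using exit[OF 6(1)] 6(3,4) by (simp add: mult.commute)
qed (use less_X in auto)

lemma wp_schedule:
  assumes inp: "input_regs (reg s)" "input_arrs (arr s)" "reg s 5 = int t"
    and init: "\<And>q. arr s 11 q = 0"
  shows "wp schedule (\<lambda>T s'. T \<le> 50 * (X * X) \<and> (\<exists>\<sigma>. balanced \<sigma> t \<and>
    (\<forall>k<t. arr s' 12 k = int (\<sigma> k)) \<and> arr s' 12 t = - 1)) s"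
  unfolding schedule_def wp_Seq
proof (rule wp_For[where N = t and X = X and B = "31 * X" and
      I = "\<lambda>k s'. \<exists>\<sigma>. balanced \<sigma> k \<and> (\<forall>k'<k. arr s' 12 k' = int (\<sigma> k')) \<and>
        (\<forall>q<P. arr s' 11 q = int k * int (tp q) - int t * int (occ \<sigma> q k))"], goal_cases)
  case (3 s')
  then show ?case using inp unchanged_reg[OF 3, of 5] by simp
next
  case 4
  then show ?case using init by (auto intro: balanced_0)
next
  case (5 k s')
  then obtain \<sigma> where bal: "balanced \<sigma> k" and \<sigma>: "\<forall>k'<k. arr s' 12 k' = int (\<sigma> k')"
    and lag: "\<forall>q<P. arr s' 11 q = int k * int (tp q) - int t * int (occ \<sigma> q k)" by blast
  have lag': "arr s' 11 q + int (tp q) = int (Suc k) * int (tp q) - int t * int (occ \<sigma> q k)"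
    if "q < P" for q using lag that by (simp add: algebra_simps)
  have inp': "input_regs (reg s')" "input_arrs (arr s')" "reg s' 5 = int t"
    using unchanged_input_regs[OF 5(2) inp(1)] unchanged_input_arrs[OF 5(2) inp(2)]
      unchanged_reg[OF 5(2), of 5] inp by simp_all
  have "\<exists>q<P. 0 < arr s' 11 q + int (tp q)"
    using lagging_class[OF bal] 5(1) lag' by force
  show ?case
    unfolding wp_Seq
  proof (rule wp_advance_row[OF inp'(1,2) \<open>\<exists>q<P. _\<close>], goal_cases)
    case (1 T u p)
    \<comment> \<open>Only the values of \<sigma> below \<open>k\<close> have been fixed so far, so
      it may be redefined at \<open>k\<close>.\<close>
    define \<tau> where "\<tau> = \<sigma>(k := p)"
    have occ: "occ \<tau> q k = occ \<sigma> q k" for q by (rule occ_cong) (simp add: \<tau>_def)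
    have "balanced \<tau> k" using balanced_cong[of k \<tau> \<sigma>] bal by (simp add: \<tau>_def)
    then have "balanced \<tau> (Suc k)"
      using 1(5,6) lag'[OF 1(5)] by (intro balanced_Suc) (simp_all add: occ, simp_all add: \<tau>_def)
    moreover have "arr u 12 = arr s' 12" "reg u 8 = int k" "reg u 5 = int t"
      using unchanged_arr[OF 1(1), of 12] unchanged_reg[OF 1(1), of 8] unchanged_reg[OF 1(1), of 5]
        5(3) inp' by simp_all
    moreover have "((arr u 11)(p := arr u 11 p - int t)) q =
        int (Suc k) * int (tp q) - int t * int (occ \<tau> q (Suc k))" if "q < P" for q
    proof -
      have "\<tau> k = p" by (simp add: \<tau>_def)
      then show ?thesis using 1(3)[OF that] lag'[OF that] by (auto simp: occ_Suc occ algebra_simps)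
    qed
    moreover have "T + 9 \<le> 31 * X" using 1(2) X_pos by linarith
    ultimately show ?case using 1(4) \<sigma>
      by (auto intro!: exI[of _ \<tau>] simp: \<tau>_def less_Suc_eq)
  qed
next
  case (6 T s')
  have "reg s' 5 = int t" using inp unchanged_reg[OF 6(1), of 5] by simp
  moreover have "T \<le> 31 * (X * X) + 9 * X" using 6(4) by (simp add: algebra_simps)
  then have "T + 3 \<le> 50 * (X * X)" using X_le_sq X_pos by linarith
  ultimately show ?case using 6(3) by auto
qed (use less_X in auto)

lemma wp_radius:
  assumes inp: "input_regs (reg s)" "reg s 5 = int t"
  shows "wp radius (\<lambda>T s'. T \<le> 60 * X \<and> reg s' 6 = K) s"
  unfolding radius_def wp_Seq wp_Assign
  apply (rule wp_Mul[where N = "2 * d + P + 1" and X = X]; (use inp less_X in \<open>simp; fail\<close>)?)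
  apply (rule wp_Mul[where N = P and X = X]; (use inp less_X in \<open>simp; fail\<close>)?)
  apply (rule wp_Mul[where N = "t + 1" and X = X]; (use inp less_X in \<open>simp; fail\<close>)?)
  subgoal for T T' T''
    using inp X_pos by (simp add: K_def R_def algebra_simps)
  done

lemma wp_backtrack:
  assumes e: "branch (arr s 9) (arr s 10) e js" "reg s 12 = int e"
    and init: "\<And>j. arr s 5 j = 0" and len: "length js = t"
  shows "wp backtrack (\<lambda>T s'. T \<le> 20 * X \<and> arr s' 5 = (\<lambda>j. int (count_list js j))) s"
  unfolding backtrack_def
\<comment> \<open>The branch is followed from its end: \<open>js2\<close> is counted already,
  \<open>js1\<close> is still to come.\<close>
proof (rule wp_WhileLess[where N = t and B = 12 and
      I = "\<lambda>k s'. \<exists>e' js1 js2. js = js1 @ js2 \<and> length js2 = k \<and> reg s' 12 = int e' \<and>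
        branch (arr s 9) (arr s 10) e' js1 \<and> arr s' 5 = (\<lambda>j. int (count_list js2 j))"], goal_cases)
  case 1
  then show ?case using e init by (intro exI[of _ e] exI[of _ js] exI[of _ "[]"]) auto
next
  case (2 k s')
  then obtain e' js1 js2 where e': "js = js1 @ js2" "length js2 = k" "reg s' 12 = int e'"
    "branch (arr s 9) (arr s 10) e' js1" "arr s' 5 = (\<lambda>j. int (count_list js2 j))" by blast
  have "0 < e'" using 2(3) e'(3) by simp
  with e'(4) obtain p js0 j where p: "js1 = js0 @ [j]" "branch (arr s 9) (arr s 10) p js0"
    "arr s 9 e' = int p" "arr s 10 e' = int j" by (cases rule: branch.cases) auto
  have "arr s' 9 = arr s 9" "arr s' 10 = arr s 10"
    using unchanged_arr[OF 2(1), of 9] unchanged_arr[OF 2(1), of 10] by simp_all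
  moreover have "k < t" using e'(1,2) p(1) len by auto
  moreover have "(\<lambda>j'. int (count_list js2 j'))(j := int (count_list js2 j) + 1) =
      (\<lambda>j'. int (count_list (j # js2) j'))" by auto
  then have "\<exists>e'' js1 js2'. js = js1 @ js2' \<and> length js2' = Suc k \<and> int p = int e'' \<and>
      branch (arr s 9) (arr s 10) e'' js1 \<and>
      (\<lambda>j'. int (count_list js2 j'))(j := int (count_list js2 j) + 1) =
        (\<lambda>j'. int (count_list js2' j'))"
    using e'(1,2) p(1,2) by (intro exI[of _ p] exI[of _ js0] exI[of _ "j # js2"]) simp
  ultimately show ?case using e'(3,5) p(3,4) by simp
next
  case (3 T k s')
  then obtain e' js1 js2 where e': "js = js1 @ js2" "reg s' 12 = int e'"
    "branch (arr s 9) (arr s 10) e' js1" "arr s' 5 = (\<lambda>j. int (count_list js2 j))" by blast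
  have "e' = 0" using 3(3) e'(2) by simp
  with e'(3) have "js1 = []" by (cases rule: branch.cases) auto
  moreover have "Suc t * 15 \<le> X * 20" using less_X(5) by (intro mult_le_mono) auto
  then have "T \<le> 20 * X" using 3(4) by simp
  ultimately show ?case using e' by simp
qed

definition solved :: "state \<Rightarrow> bool" where
  "solved s \<longleftrightarrow> (if \<exists>x. feas x
    then reg s 4 = 1 \<and> feas (arr s 5) \<and>
      (\<forall>y. feas y \<longrightarrow> (\<Sum>j<n. c j * y j) \<le> (\<Sum>j<n. c j * arr s 5 j))
    else reg s 4 = 0)"

lemma wp_finish:
  assumes inp: "input_regs (reg s)" "input_arrs (arr s)" "reg s 5 = int t"
    and out: "reg s 4 = 0" "\<And>j. arr s 5 j = 0"
    and bal: "balanced \<sigma> t" and L: "reg s 7 = int L"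
    and tr: "tree \<sigma> L L 0 (arr s 6) (arr s 7) (arr s 8) (arr s 9) (arr s 10)"
  shows "wp finish (\<lambda>T s'. T \<le> 200 * (X * X) \<and> solved s') s"
proof -
  have L_less: "Suc L < X" using tree_size[OF tr] max_entries_less by linarith
  let ?write = "Write 6 (Plus (Reg 15) (Reg 10)) (Read 1 (Reg 10))"
  define s1 where "s1 = s\<lparr>reg := (reg s)(15 := int d * int L, 13 := int d),
    arr := (arr s)(7 := (arr s 7)(L := int t))\<rparr>"
  have row: "wp (For 10 (Reg 1) ?write) (\<lambda>T s'. T \<le> 20 * X \<and>
      unchanged (For 10 (Reg 1) ?write) s1 s' \<and> (\<forall>i<d. arr s' 6 (L * d + i) = b i) \<and>
      (\<forall>e<L. \<forall>i<d. arr s' 6 (e * d + i) = arr s 6 (e * d + i))) s1"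
  proof (rule wp_For[where N = d and X = X and B = 6 and
      I = "\<lambda>k s'. (\<forall>i<k. arr s' 6 (L * d + i) = b i) \<and>
        (\<forall>e<L. \<forall>i<d. arr s' 6 (e * d + i) = arr s 6 (e * d + i))"], goal_cases)
    case (3 s')
    then show ?case using inp unchanged_reg[OF 3, of 1] by (simp add: s1_def)
  next
    case (5 k s')
    have cell: "e * d + i \<noteq> L * d + k" if "e < L" "i < d" for e i
      using that 5(1) cell_eq_iff[of i d k e L] by simp
    have "reg s' 15 = int d * int L" "arr s' 1 k = b k"
      using unchanged_reg[OF 5(2), of 15] unchanged_arr[OF 5(2), of 1] inp 5(1)
      by (simp_all add: s1_def)
    then show ?case using 5 cell by (auto simp: less_Suc_eq mult.commute[of d L])
  next
    case (6 T s')
    then show ?case by simp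
  qed (use less_X in \<open>auto simp: s1_def\<close>)
  have rest: "wp search (\<lambda>T. wp (IfLess (Reg 12) (Reg 7) (Seq (Assign 4 (Const 1)) backtrack) Skip)
      (\<lambda>U s'. T + U \<le> 140 * (X * X) \<and> solved s')) s2"
    if u: "unchanged (For 10 (Reg 1) ?write) s1 s2" and slot: "\<forall>i<d. arr s2 6 (L * d + i) = b i"
      and old: "\<forall>e<L. \<forall>i<d. arr s2 6 (e * d + i) = arr s 6 (e * d + i)" for s2
  proof -
    define lay where "lay = (arr s 7)(L := int t)"
    have arrs: "arr s2 7 = lay" "a \<notin> {6, 7} \<Longrightarrow> arr s2 a = arr s a" for a
      using unchanged_arr[OF u, of a] unchanged_arr[OF u, of 7] by (simp_all add: s1_def lay_def)
    have regs: "reg s2 1 = int d" "reg s2 7 = int L" "reg s2 4 = 0"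
      using unchanged_reg[OF u, of 1] unchanged_reg[OF u, of 7] unchanged_reg[OF u, of 4] inp L out
      by (simp_all add: s1_def)
    have tr': "tree \<sigma> L L 0 (arr s2 6) lay (arr s 8) (arr s 9) (arr s 10)"
      by (rule tree_cong[OF tr]) (use old in \<open>auto simp: lay_def\<close>)
    have goal: "same (arr s2 6) lay e L \<longleftrightarrow> goal (arr s2 6) lay e" for e
      using slot by (auto simp: same_def goal_def lay_def)
    show ?thesis
    proof (rule wp_search[OF regs(1,2) L_less], goal_cases)
      case (1 T s' e)
      have arrs': "arr s' a = arr s2 a" for a using unchanged_arr[OF 1(1), of a] by simp
      have regs': "reg s' 7 = int L" "reg s' 4 = 0"
        using unchanged_reg[OF 1(1), of 7] unchanged_reg[OF 1(1), of 4] regs by simp_all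
      show ?case
      proof (cases "e < L")
        case True
        have "goal (arr s2 6) lay e" using 1(5) arrs(1) goal by simp
        then obtain js where js: "branch (arr s 9) (arr s 10) e js" "length js = t"
          "feas (\<lambda>j. int (count_list js j))"
          "\<And>y. feas y \<Longrightarrow> (\<Sum>j<n. c j * y j) \<le> (\<Sum>j<n. c j * int (count_list js j))"
          using tree_goal[OF bal tr' True] by metis
        have "wp backtrack (\<lambda>T s'. T \<le> 20 * X \<and> arr s' 5 = (\<lambda>j. int (count_list js j)))
            (s'\<lparr>reg := (reg s')(4 := 1)\<rparr>)"
          using js(1,2) 1(3) out(2) by (intro wp_backtrack[where e = e]) (simp_all add: arrs arrs')
        then have "wp backtrack (\<lambda>U s'. T + (3 + (2 + U)) \<le> 140 * (X * X) \<and> solved s')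
            (s'\<lparr>reg := (reg s')(4 := 1)\<rparr>)"
        proof (rule wp_mono)
          fix U s'' assume "unchanged backtrack (s'\<lparr>reg := (reg s')(4 := 1)\<rparr>) s''"
            and *: "U \<le> 20 * X \<and> arr s'' 5 = (\<lambda>j. int (count_list js j))"
          then have "reg s'' 4 = 1" by (simp add: unchanged_def backtrack_def)
          moreover have "T + (3 + (2 + U)) \<le> 140 * (X * X)"
            using * 1(2) X_le_sq X_pos by linarith
          ultimately show "T + (3 + (2 + U)) \<le> 140 * (X * X) \<and> solved s''"
            using js(3,4) * unfolding solved_def by auto
        qed
        then show ?thesis using True 1(3) regs' by simp
      next
        case False
        then have eL: "e = L" using 1(4) by simp
        \<comment> \<open>The slot was the first match, so no entry is a goal.\<close>
        have "\<not> feas x" for x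
        proof
          assume "feas x"
          then obtain e' where "e' < L" "goal (arr s2 6) lay e'"
            using tree_goal_upper[OF bal tr'] by blast
          then show False using 1(6)[of e'] eL goal arrs(1) by simp
        qed
        moreover have "T + 4 \<le> 140 * (X * X)" using 1(2) X_le_sq X_pos by linarith
        ultimately show ?thesis using False 1(3) eL regs' by (simp add: solved_def)
      qed
    qed
  qed
  show ?thesis
    unfolding finish_def wp_Seq wp_Write
    apply (rule wp_Mul[where N = d and X = X]; (use inp less_X in \<open>simp; fail\<close>)?)
  proof -
    fix T assume T: "T \<le> X * (acost (Reg 1) + acost (Reg 7) + 13)"
    have s1: "(s\<lparr>arr := (arr s)(7 := (arr s 7)(nat (aval (Reg 7) s) := aval (Reg 5) s))\<rparr>)
        \<lparr>reg := (reg (s\<lparr>arr := (arr s)(7 := (arr s 7)(nat (aval (Reg 7) s) := aval (Reg 5) s))\<rparr>))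
          (15 := int d * reg s 7, 13 := int d)\<rparr> = s1"
      using L inp by (simp add: s1_def)
    have "wp (For 10 (Reg 1) ?write) (\<lambda>U. wp search (\<lambda>V.
        wp (IfLess (Reg 12) (Reg 7) (Seq (Assign 4 (Const 1)) backtrack) Skip)
          (\<lambda>W s'. 1 + acost (Reg 7) + acost (Reg 5) + (T + (U + (V + W))) \<le> 200 * (X * X) \<and>
            solved s'))) s1"
    proof (rule wp_mono[OF row], elim conjE)
      fix U s2 assume U: "U \<le> 20 * X" and u: "unchanged (For 10 (Reg 1) ?write) s1 s2"
        "\<forall>i<d. arr s2 6 (L * d + i) = b i"
        "\<forall>e<L. \<forall>i<d. arr s2 6 (e * d + i) = arr s 6 (e * d + i)"
      show "wp search (\<lambda>V. wp (IfLess (Reg 12) (Reg 7) (Seq (Assign 4 (Const 1)) backtrack) Skip)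
          (\<lambda>W s'. 1 + acost (Reg 7) + acost (Reg 5) + (T + (U + (V + W))) \<le> 200 * (X * X) \<and>
            solved s')) s2"
      proof (rule wp_mono[OF rest[OF u]], erule wp_mono)
        fix V W s' assume *: "V + W \<le> 140 * (X * X) \<and> solved s'"
        have "T \<le> 15 * X" using T by simp
        then have "3 + (T + (U + (V + W))) \<le> 200 * (X * X)"
          using * U X_le_sq X_pos by linarith
        then show "1 + acost (Reg 7) + acost (Reg 5) + (T + (U + (V + W))) \<le> 200 * (X * X) \<and>
            solved s'"
          using * by simp
      qed
    qed
    then show "wp (For 10 (Reg 1) ?write) (\<lambda>U. wp search (\<lambda>V.
        wp (IfLess (Reg 12) (Reg 7) (Seq (Assign 4 (Const 1)) backtrack) Skip)
          (\<lambda>W s'. 1 + acost (Reg 7) + acost (Reg 5) + (T + (U + (V + W))) \<le> 200 * (X * X) \<and>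
            solved s')))
      (s\<lparr>arr := (arr s)(7 := (arr s 7)(nat (aval (Reg 7) s) := aval (Reg 5) s)),
         reg := (reg (s\<lparr>arr := (arr s)(7 := (arr s 7)(nat (aval (Reg 7) s) := aval (Reg 5) s))\<rparr>))
          (15 := int d * reg s 7, 13 := int d)\<rparr>)"
      unfolding s1 .
  qed
qed

lemma wp_solver:
  assumes inp: "input_regs (reg s)" "input_arrs (arr s)"
    and zero: "\<And>r. 4 \<le> r \<Longrightarrow> reg s r = 0" "\<And>a k. 5 \<le> a \<Longrightarrow> arr s a k = 0"
  shows "wp solver (\<lambda>T s'. T \<le> 800 * X ^ 4 \<and> solved s') s"
  unfolding solver_def wp_Seq
proof (rule wp_mono[OF wp_total[OF inp]])
  show "reg s 5 = 0" using zero by simp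
  fix T1 s1 assume u1: "unchanged total s s1" and s1: "T1 \<le> 14 * X \<and> reg s1 5 = int t"
  have inp1: "input_regs (reg s1)" "input_arrs (arr s1)"
    using unchanged_input_regs[OF u1] unchanged_input_arrs[OF u1] inp by simp_all
  have zero1: "reg s1 4 = 0" "\<And>a k. 5 \<le> a \<Longrightarrow> arr s1 a k = 0"
    using unchanged_reg[OF u1, of 4] unchanged_arr[OF u1] zero by simp_all
  have sched: "wp schedule (\<lambda>T s'. T \<le> 50 * (X * X) \<and> (\<exists>\<sigma>. balanced \<sigma> t \<and>
      (\<forall>k<t. arr s' 12 k = int (\<sigma> k)) \<and> arr s' 12 t = - 1)) s1"
    by (rule wp_schedule[OF inp1]) (use s1 zero1 in auto)
  show "wp schedule (\<lambda>T2. wp radius (\<lambda>T3. wp explore (\<lambda>T4. wp finish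
    (\<lambda>T5 s'. T1 + (T2 + (T3 + (T4 + T5))) \<le> 800 * X ^ 4 \<and> solved s')))) s1"
  proof (rule wp_mono[OF sched], elim conjE exE)
    fix T2 s2 \<sigma> assume u2: "unchanged schedule s1 s2" and T2: "T2 \<le> 50 * (X * X)"
      and bal: "balanced \<sigma> t" and \<sigma>: "\<forall>k<t. arr s2 12 k = int (\<sigma> k)" "arr s2 12 t = - 1"
    have inp2: "input_regs (reg s2)" "input_arrs (arr s2)" "reg s2 5 = int t" "reg s2 4 = 0"
      using unchanged_input_regs[OF u2 inp1(1)] unchanged_input_arrs[OF u2 inp1(2)]
        unchanged_reg[OF u2, of 5] unchanged_reg[OF u2, of 4] s1 zero1 by simp_all
    have zero2: "arr s2 a k = 0" if "5 \<le> a" "a \<le> 8" for a k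
      using unchanged_arr[OF u2, of a] zero1 that by simp
    show "wp radius (\<lambda>T3. wp explore (\<lambda>T4. wp finish
      (\<lambda>T5 s'. T1 + (T2 + (T3 + (T4 + T5))) \<le> 800 * X ^ 4 \<and> solved s'))) s2"
    proof (rule wp_mono[OF wp_radius[OF inp2(1,3)]], elim conjE)
      fix T3 s3 assume u3: "unchanged radius s2 s3" and T3: "T3 \<le> 60 * X" and K: "reg s3 6 = K"
      have inp3: "input_regs (reg s3)" "input_arrs (arr s3)" "reg s3 5 = int t" "reg s3 4 = 0"
        using unchanged_input_regs[OF u3 inp2(1)] unchanged_input_arrs[OF u3 inp2(2)]
          unchanged_reg[OF u3, of 5] unchanged_reg[OF u3, of 4] inp2 by simp_all
      have arr3: "arr s3 = arr s2" using unchanged_arr[OF u3] by (simp add: fun_eq_iff)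
      show "wp explore (\<lambda>T4. wp finish
        (\<lambda>T5 s'. T1 + (T2 + (T3 + (T4 + T5))) \<le> 800 * X ^ 4 \<and> solved s')) s3"
      proof (rule wp_explore[OF inp3(1,2,3) K, of \<sigma>])
        fix T4 s4 L assume u4: "unchanged explore s3 s4" and T4: "T4 \<le> 400 * (X * (X * (X * X)))"
          and L: "reg s4 7 = int L"
          and tr: "tree \<sigma> L L 0 (arr s4 6) (arr s4 7) (arr s4 8) (arr s4 9) (arr s4 10)"
        have inp4: "input_regs (reg s4)" "input_arrs (arr s4)" "reg s4 5 = int t" "reg s4 4 = 0"
          "\<And>j. arr s4 5 j = 0"
          using unchanged_input_regs[OF u4 inp3(1)] unchanged_input_arrs[OF u4 inp3(2)]
            unchanged_reg[OF u4, of 5] unchanged_reg[OF u4, of 4] unchanged_arr[OF u4, of 5]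
            inp3 zero2 arr3 by simp_all
        show "wp finish (\<lambda>T5 s'. T1 + (T2 + (T3 + (T4 + T5))) \<le> 800 * X ^ 4 \<and> solved s') s4"
        proof (rule wp_mono[OF wp_finish[OF inp4 bal L tr]], elim conjE)
          fix T5 s5 assume T5: "T5 \<le> 200 * (X * X)" "solved s5"
          have "X ^ 4 = X * (X * (X * X))" by (simp add: power4_eq_xxxx mult.assoc)
          then have "T1 + (T2 + (T3 + (T4 + T5))) \<le> 800 * X ^ 4"
            using s1 T2 T3 T4 T5(1) X_le_sq sq_le_cube mult_le_mono[OF order_refl[of X] sq_le_cube]
            by linarith
          with T5(2) show "T1 + (T2 + (T3 + (T4 + T5))) \<le> 800 * X ^ 4 \<and> solved s5" by simp
        qed
      qed (use \<sigma> zero2 arr3 in auto)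
    qed
  qed
qed

text \<open>The delicate term is the factor \<open>12 ^ d\<close>. If \<open>G = d * D * P\<close>
  is at least 2, then \<open>G ^ 4\<close> exceeds 12 and a power of \<open>G\<close> absorbs it. If
  \<open>G = 1\<close>, no power helps, but then \<open>d = 1\<close> and the factor is just
  12.\<close>

lemma X_bound:
  "X \<le> 24 * ((d * D * P) ^ (6 * d) * (n + t))"
proof -
  define G where "G = d * D * P"
  have G: "1 \<le> G" using d_pos D_pos P_pos by (simp add: G_def One_nat_def Suc_le_eq)
  have "R \<le> 4 * G ^ 2"
  proof -
    have "2 * d + P + 1 \<le> 4 * (d * P)"
    proof -
      have "d \<le> d * P" "P \<le> d * P" "1 \<le> d * P"
        using d_pos P_pos by (simp_all add: One_nat_def Suc_le_eq)
      then show ?thesis by linarith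
    qed
    then have "R \<le> P * D * (4 * (d * P))" unfolding R_def by (rule mult_le_mono2)
    \<comment> \<open>The factor \<open>d * D\<close> is at least 1 and completes the square of
      \<open>G\<close>.\<close>
    also have "\<dots> \<le> P * D * (4 * (d * P)) * (d * D)" using d_pos D_pos by simp
    also have "\<dots> = 4 * G ^ 2" by (simp add: G_def power2_eq_square)
    finally show ?thesis .
  qed
  moreover have "1 \<le> G ^ 2" using G by simp
  ultimately have "2 * R + 1 \<le> 12 * G ^ 2" by linarith
  then have "(2 * R + 1) ^ d \<le> (12 * G ^ 2) ^ d" by (rule power_mono) simp
  also have "\<dots> = 12 ^ d * G ^ (2 * d)" by (simp add: power_mult_distrib power_mult)
  also have "\<dots> \<le> 12 * G ^ (4 * d) * G ^ (2 * d)"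
  proof (rule mult_le_mono1)
    show "12 ^ d \<le> 12 * G ^ (4 * d)"
    proof (cases "G = 1")
      case True
      then have "d = 1" by (simp add: G_def)
      then show ?thesis using G by simp
    next
      case False
      then have "2 \<le> G" using G by simp
      then have "(2::nat) ^ 4 \<le> G ^ 4" by (rule power_mono) simp
      then have "12 ^ d \<le> (G ^ 4) ^ d" by (intro power_mono) simp_all
      then show ?thesis by (simp add: power_mult)
    qed
  qed
  also have "\<dots> = 12 * G ^ (6 * d)" by (simp flip: power_add)
  finally have "(2 * R + 1) ^ d \<le> 12 * G ^ (6 * d)" .
  moreover have "n + t + 1 \<le> 2 * (n + t)" using n_pos by simp
  ultimately have "X \<le> 2 * (n + t) * (12 * G ^ (6 * d))" unfolding X_def by (rule mult_le_mono[rotated])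
  also have "\<dots> = 24 * (G ^ (6 * d) * (n + t))" by (simp add: algebra_simps)
  finally show ?thesis unfolding G_def .
qed

end

text \<open>Classes are disjoint and listed without repetition, so the least index of a class
  containing \<open>j\<close> is the only one.\<close>

lemma class_label:
  assumes "distinct Ss" "set Ss = parts I" "partition_on {0..<n} (parts I)" "j < n"
  shows "class_label Ss j < length Ss" "j \<in> Ss ! class_label Ss j"
    and "k < length Ss \<Longrightarrow> j \<in> Ss ! k \<longleftrightarrow> class_label Ss j = k"
proof -
  have "j \<in> \<Union> (set Ss)" using assms(2-4) by (simp add: partition_on_def)
  then have "\<exists>k. k < length Ss \<and> j \<in> Ss ! k" by (auto simp: in_set_conv_nth)
  from LeastI_ex[OF this] show *: "class_label Ss j < length Ss" "j \<in> Ss ! class_label Ss j"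
    by (simp_all add: class_label_def)
  show "j \<in> Ss ! k \<longleftrightarrow> class_label Ss j = k" if k: "k < length Ss"
  proof
    assume j: "j \<in> Ss ! k"
    have "Ss ! k \<in> parts I" "Ss ! class_label Ss j \<in> parts I"
      using k *(1) assms(2) nth_mem by auto
    then have "Ss ! k = Ss ! class_label Ss j"
      using j *(2) assms(3) unfolding partition_on_def disjoint_def by blast
    then show "class_label Ss j = k" using nth_eq_iff_index_eq[OF assms(1)] k *(1) by metis
  qed (use * in blast)
qed

lemma solver_correct:
  assumes inst: "mcip_instance I" and Ss: "distinct Ss" "set Ss = parts I"
  shows "\<exists>T s. exec solver (input_state I Ss) T s \<and> correct_output I s \<and>
    T \<le> 800 * (24 * ((num_rows I * entry_bound I * card (parts I)) ^ (6 * num_rows I) *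
      (num_vars I + total_sum I))) ^ 4"
proof -
  define n d D P where "n = num_vars I" and "d = num_rows I" and "D = entry_bound I"
    and "P = card (parts I)"
  define A where "A i j = constr_mat I $$ (i, j)" for i j
  define b where "b i = rhs I $ i" for i
  define c where "c j = objective I $ j" for j
  define lab where "lab = class_label Ss"
  define tp where "tp q = part_sum I (Ss ! q)" for q
  have P: "length Ss = P" using distinct_card[OF Ss(1)] Ss(2) by (simp add: P_def)
  have part: "partition_on {0..<n} (parts I)" using inst by (simp add: mcip_instance_def n_def)
  note lab = class_label[OF Ss part, folded lab_def]
  have "parts I \<noteq> {}"
    using part inst by (auto simp: partition_on_def mcip_instance_def n_def)
  then have "1 \<le> P" using P Ss(2) by (cases Ss) (auto simp: One_nat_def)
  interpret problem n d D P A b c lab tp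
  proof
    show "1 \<le> n" "1 \<le> d" "1 \<le> D" using inst by (simp_all add: mcip_instance_def n_def d_def D_def)
    show "\<bar>A i j\<bar> \<le> int D" if "i < d" "j < n" for i j
      using inst that by (simp add: mcip_instance_def n_def d_def D_def A_def)
    show "lab j < P" if "j < n" for j using lab(1)[OF that] P by simp
  qed fact
  have dims: "constr_mat I \<in> carrier_mat d n" "rhs I \<in> carrier_vec d" "objective I \<in> carrier_vec n"
    using inst by (simp_all add: mcip_instance_def n_def d_def)
  have t: "t = total_sum I"
  proof -
    have "total_sum I = (\<Sum>S\<leftarrow>Ss. part_sum I S)"
      using sum_list_distinct_conv_sum_set[OF Ss(1), of "part_sum I"] Ss(2)
      by (simp add: total_sum_def)
    then show ?thesis by (simp add: t_def tp_def sum_list_sum_nth P atLeast0LessThan)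
  qed
  have feas: "feasible I (vec n x) \<longleftrightarrow> feas x" for x
  proof -
    have "constr_mat I *\<^sub>v vec n x = rhs I \<longleftrightarrow> (\<forall>i<d. (\<Sum>j<n. A i j * x j) = b i)"
      using dims by (auto simp: vec_eq_iff scalar_prod_def A_def b_def atLeast0LessThan
          intro!: sum.cong)
    moreover have "(\<Sum>j\<in>Ss ! q. vec n x $ j) = (\<Sum>j | j < n \<and> lab j = q. x j)" if "q < P" for q
    proof -
      have "Ss ! q \<subseteq> {0..<n}"
        using part that P Ss(2) nth_mem[of q Ss] by (auto simp: partition_on_def)
      then have "Ss ! q = {j. j < n \<and> lab j = q}" using lab(3) that P by fastforce
      then show ?thesis by (auto intro!: sum.cong)
    qed
    then have "(\<forall>S\<in>parts I. (\<Sum>j\<in>S. vec n x $ j) = int (part_sum I S)) \<longleftrightarrow>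
        (\<forall>q<P. (\<Sum>j | j < n \<and> lab j = q. x j) = int (tp q))"
      by (simp add: Ss(2)[symmetric] all_set_conv_all_nth P tp_def)
    ultimately show ?thesis
      by (simp add: feasible_def feas_def flip: n_def)
  qed
  have carrier: "x = vec n (\<lambda>j. x $ j)" if "feasible I x" for x
    using that by (auto simp: feasible_def n_def)
  have obj: "objective I \<bullet> vec n x = (\<Sum>j<n. c j * x j)" for x
    by (auto simp: scalar_prod_def c_def atLeast0LessThan intro!: sum.cong)
  let ?s = "input_state I Ss"
  have "input_regs (reg ?s)"
    unfolding input_regs_def
    by (simp add: input_state_def input_reg_def n_def d_def D_def P_def)
  moreover have "input_arrs (arr ?s)"
    unfolding input_arrs_def
  proof (intro conjI allI impI)
    show "arr ?s 0 (i * n + j) = A i j" if "i < d" "j < n" for i j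
    proof -
      have "i * n + j < Suc i * n" using that by simp
      also have "\<dots> \<le> d * n" using that by (intro mult_le_mono1) simp
      finally show ?thesis
        using that by (simp add: input_state_def input_arr_def A_def flip: n_def d_def)
    qed
  qed (simp_all add: input_state_def input_arr_def b_def c_def lab_def tp_def P
      flip: n_def d_def)
  ultimately have "wp solver (\<lambda>T s'. T \<le> 800 * X ^ 4 \<and> solved s') ?s"
    by (rule wp_solver) (simp_all add: input_state_def input_reg_def input_arr_def)
  then obtain T s where s: "exec solver ?s T s" "T \<le> 800 * X ^ 4" "solved s"
    unfolding wp_def by blast
  have "correct_output I s"
  proof (cases "\<exists>x. feas x")
    case True
    then have *: "reg s 4 = 1" "feas (arr s 5)"
      "\<And>y. feas y \<Longrightarrow> (\<Sum>j<n. c j * y j) \<le> (\<Sum>j<n. c j * arr s 5 j)"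
      using s(3) by (auto simp: solved_def)
    have "optimal I (vec n (arr s 5))"
      unfolding optimal_def
    proof (intro conjI allI impI)
      fix y assume "feasible I y"
      then have "feas (\<lambda>j. y $ j)" using feas carrier by metis
      from *(3)[OF this] show "objective I \<bullet> y \<le> objective I \<bullet> vec n (arr s 5)"
        using carrier[OF \<open>feasible I y\<close>] obj by metis
    qed (use * feas in simp)
    then show ?thesis using * feas by (auto simp: correct_output_def simp flip: n_def)
  next
    case False
    then have "\<not> (\<exists>x. feasible I x)" using feas carrier by metis
    then show ?thesis using s(3) False by (simp add: correct_output_def solved_def)
  qed
  moreover have "X ^ 4 \<le> (24 * ((d * D * P) ^ (6 * d) * (n + t))) ^ 4"
    using X_bound by (intro power_mono) simp_all
  then have "T \<le> 800 * (24 * ((d * D * P) ^ (6 * d) * (n + t))) ^ 4" using s(2) by linarith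
  ultimately show ?thesis using s(1) unfolding t unfolding n_def d_def D_def P_def by blast
qed

theorem theorem2:
  shows "\<exists>p C\<^sub>0 C\<^sub>1 C\<^sub>2. \<forall>I. mcip_instance I \<longrightarrow>
    solves_within p I
      (C\<^sub>0 * (num_rows I * entry_bound I * card (parts I)) ^ (C\<^sub>1 * num_rows I)
          * (num_vars I + total_sum I) ^ C\<^sub>2)"
proof (intro exI allI impI)
  fix I assume inst: "mcip_instance I"
  let ?G = "num_rows I * entry_bound I * card (parts I)" and ?N = "num_vars I + total_sum I"
  have "(?G ^ (6 * num_rows I)) ^ 4 = ?G ^ (24 * num_rows I)" by (simp flip: power_mult)
  then have "800 * (24 * (?G ^ (6 * num_rows I) * ?N)) ^ 4 =
      800 * 24 ^ 4 * ?G ^ (24 * num_rows I) * ?N ^ 4"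
    by (simp add: power_mult_distrib)
  then show "solves_within solver I (800 * 24 ^ 4 * ?G ^ (24 * num_rows I) * ?N ^ 4)"
    using solver_correct[OF inst] unfolding solves_within_def by metis
qed

end
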